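(* Let $B^4\subset\mathbb{R}^4$ be the closed unit ball with Euclidean metric $dx^2$ and boundary $S^3$, and let $$\mathcal{V}=\{g=e^{2u}dx^2 : u\in C^\infty(B^4),\ \mathrm{Vol}_{\iota^*g}(S^3)=\omega_3\}.$$ Suppose that $g\in\mathcal{V}$ is a local minimizer of $\mathcal{F}_2\colon\mathcal{V}\to\mathbb{R}$ and that $g\in\mathcal{C}_1$, i.e. $\sigma_1^g\ge0$ in $B^4$ and $H^g>0$ on $S^3$. Then $g=dx^2$ up to the action of the conformal group of $B^4$; that is, there is a conformal diffeomorphism $\Phi$ of $B^4$ (mapping $S^3$ to itself) such that $\Phi^*g=dx^2$.
   Context: $\iota\colon S^3\to B^4$ is the inclusion of the boundary, $\omega_3$ is the volume of the standard round unit $3$-sphere, and smooth functions/metrics on $B^4$ are smooth up to the boundary. For a Riemannian metric $g$ on a $4$-manifold $X$ with boundary (so $n=3$), the Schouten tensor is $P=\frac12\left(\mathrm{Ric}-\frac R6g\right)$, its trace is $J=\frac R6$, and $\sigma_1^g=J$, $\sigma_2^g=\frac12\left(J^2-|P|^2\right)$. With $\eta$ the outward-pointing unit normal along $\partial X$, the mean curvature is $H^g=\frac13\mathrm{tr}_{\iota^*g}\nabla\eta$ (so the unit sphere bounding the Euclidean unit ball has $H=1$). When the boundary is umbilic (as is always the case for metrics conformal to $dx^2$ on the ball), $H_2^g=H^g\,\mathrm{tr}_{\iota^*g}(P|_{T\partial X})+(H^g)^3$. For $u\in C^\infty(B^4)$ set $g_s=e^{2su}dx^2$; the functional is $$\mathcal{F}_2(e^{2u}dx^2)=\int_0^1\left\{\int_{B^4}u\,\sigma_2^{g_s}\,\mathrm{dvol}_{g_s}+\oint_{S^3}u\,H_2^{g_s}\,\mathrm{dvol}_{\iota^*g_s}\right\}ds.$$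 "Local minimizer" is with respect to the $C^\infty$ topology on $u$. *)

theory Defs
  imports "HOL-Analysis.Analysis"
begin

abbreviation B4 :: "(real^4) set" where "B4 \<equiv> cball 0 1"
abbreviation S3 :: "(real^4) set" where "S3 \<equiv> sphere 0 1"


section \<open>Smooth functions on the closed ball\<close>

text \<open>
  Functions on the closed ball are total functions of which only the values on the ball matter.
  Derivatives are taken within the closed ball, hence are one-sided at boundary points; they are
  unique there because the ball is convex with nonempty interior (lemma \<open>pd_eqI\<close> below).
\<close>

definition pd :: "4 \<Rightarrow> (real^4 \<Rightarrow> real) \<Rightarrow> real^4 \<Rightarrow> real" where
  "pd i f x = frechet_derivative f (at x within B4) (axis i 1)"

fun iter_pd :: "4 list \<Rightarrow> (real^4 \<Rightarrow> real) \<Rightarrow> real^4 \<Rightarrow> real" where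
  "iter_pd [] f = f"
| "iter_pd (i # is) f = pd i (iter_pd is f)"

definition smooth_B4 :: "(real^4 \<Rightarrow> real) set" where
  "smooth_B4 = {f. \<forall>is. iter_pd is f differentiable_on B4}"

definition smooth_map_B4 :: "(real^4 \<Rightarrow> real^4) \<Rightarrow> bool" where
  "smooth_map_B4 \<Phi> \<longleftrightarrow> (\<forall>k. (\<lambda>x. \<Phi> x $ k) \<in> smooth_B4)"

lemma has_derivative_within_B4_unique:
  fixes f :: "real^4 \<Rightarrow> real"
  assumes x: "x \<in> B4"
    and D: "(f has_derivative D) (at x within B4)" "(f has_derivative D') (at x within B4)"
  shows "D = D'"
proof -
  define L where "L v = D v - D' v" for v
  have L: "bounded_linear L"
    unfolding L_def using D by (intro bounded_linear_sub has_derivative_bounded_linear)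
  have lin: "linear L" using L by (rule bounded_linear.linear)
  have 0: "((\<lambda>x. 0) has_derivative L) (at x within B4)"
    using has_derivative_diff[OF D] by (simp add: L_def[abs_def])
  have inB: "L (y - x) = 0" if y: "y \<in> B4" for y
  proof -
    define p where "p t = x + t *\<^sub>R (y - x)" for t :: real
    have pB: "p ` {0..1} \<subseteq> B4"
    proof
      fix z assume "z \<in> p ` {0..1}"
      then obtain t where t: "0 \<le> t" "t \<le> 1" "z = p t" by auto
      have "z = (1 - t) *\<^sub>R x + t *\<^sub>R y" by (simp add: t p_def algebra_simps)
      then show "z \<in> B4"
        using convexD_alt[OF convex_cball x y t(1,2)] by simp
    qed
    have p': "(p has_derivative (\<lambda>h. h *\<^sub>R (y - x))) (at 0 within {0..1})"
      unfolding p_def by (auto intro!: derivative_eq_intros)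
    have p0: "p 0 = x" by (simp add: p_def)
    have "((\<lambda>t. 0) has_derivative (\<lambda>h. L (h *\<^sub>R (y - x)))) (at 0 within {0..1})"
      using has_derivative_in_compose[OF p', of "\<lambda>x. 0" L] has_derivative_subset[OF 0 pB]
      by (simp add: p0)
    then have "((\<lambda>t. 0) has_vector_derivative L (y - x)) (at 0 within {0..1})"
      by (simp add: has_vector_derivative_def linear_cmul[OF lin])
    moreover have "((\<lambda>t. 0) has_vector_derivative (0::real)) (at 0 within {0..1})"
      by (rule has_vector_derivative_const)
    ultimately show ?thesis
      using vector_derivative_unique_within_closed_interval[of 0 1 0 "\<lambda>t. 0" "L (y - x)" 0]
      by auto
  qed
  have "L v = 0" for v
  proof (cases "v = 0")
    case True
    then show ?thesis using linear_0[OF lin] by simp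
  next
    case False
    have z: "0 \<in> B4" "(1 / norm v) *\<^sub>R v \<in> B4" using False by auto
    have Lx: "L x = 0"
      using inB[OF z(1)] linear_neg[OF lin, of x] by simp
    have "L ((1 / norm v) *\<^sub>R v) = 0"
      using inB[OF z(2)] linear_diff[OF lin, of "(1 / norm v) *\<^sub>R v" x] Lx by simp
    then show ?thesis using False by (simp add: linear_cmul[OF lin])
  qed
  then show ?thesis unfolding L_def by (intro ext) simp
qed

lemma pd_eqI:
  assumes "x \<in> B4" "(f has_derivative D) (at x within B4)"
  shows "pd i f x = D (axis i 1)"
  using assms has_derivative_within_B4_unique frechet_derivative_works differentiableI
  unfolding pd_def by metis


section \<open>The smooth topology\<close>

definition Cinf_ball :: "(real^4 \<Rightarrow> real) \<Rightarrow> nat \<Rightarrow> real \<Rightarrow> (real^4 \<Rightarrow> real) set" where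
  "Cinf_ball u k e = {v \<in> smooth_B4.
     \<forall>is. length is \<le> k \<longrightarrow> (\<forall>x\<in>B4. \<bar>iter_pd is v x - iter_pd is u x\<bar> < e)}"

definition Cinf_topology :: "(real^4 \<Rightarrow> real) topology" where
  "Cinf_topology = topology (\<lambda>U. U \<subseteq> smooth_B4 \<and>
     (\<forall>u\<in>U. \<exists>k. \<exists>e>0. Cinf_ball u k e \<subseteq> U))"

lemma openin_Cinf_topology:
  "openin Cinf_topology U \<longleftrightarrow>
     U \<subseteq> smooth_B4 \<and> (\<forall>u\<in>U. \<exists>k. \<exists>e>0. Cinf_ball u k e \<subseteq> U)"
proof -
  have mono: "Cinf_ball u (max k k') (min e e') \<subseteq> Cinf_ball u k e \<inter> Cinf_ball u k' e'"
    for u k k' e e'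
    by (auto simp: Cinf_ball_def)
  have "istopology (\<lambda>U. U \<subseteq> smooth_B4 \<and> (\<forall>u\<in>U. \<exists>k. \<exists>e>0. Cinf_ball u k e \<subseteq> U))"
    unfolding istopology_def
  proof (intro conjI allI impI ballI)
    fix S T u
    assume S: "S \<subseteq> smooth_B4 \<and> (\<forall>u\<in>S. \<exists>k. \<exists>e>0. Cinf_ball u k e \<subseteq> S)"
      and T: "T \<subseteq> smooth_B4 \<and> (\<forall>u\<in>T. \<exists>k. \<exists>e>0. Cinf_ball u k e \<subseteq> T)"
      and u: "u \<in> S \<inter> T"
    obtain k e where 1: "e > 0" "Cinf_ball u k e \<subseteq> S" using S u by blast
    obtain k' e' where 2: "e' > 0" "Cinf_ball u k' e' \<subseteq> T" using T u by blast
    show "\<exists>k. \<exists>e>0. Cinf_ball u k e \<subseteq> S \<inter> T"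
      using mono[of u k k' e e'] 1 2
      by (intro exI[of _ "max k k'"] exI[of _ "min e e'"]) auto
  next
    fix \<K> u
    assume K: "\<forall>K\<in>\<K>. K \<subseteq> smooth_B4 \<and> (\<forall>u\<in>K. \<exists>k. \<exists>e>0. Cinf_ball u k e \<subseteq> K)"
      and "u \<in> \<Union>\<K>"
    then obtain K where "K \<in> \<K>" "u \<in> K" by blast
    then show "\<exists>k. \<exists>e>0. Cinf_ball u k e \<subseteq> \<Union>\<K>"
      using K by (meson Union_upper order_trans)
  qed auto
  then show ?thesis by (simp add: Cinf_topology_def topology_inverse')
qed


section \<open>Riemannian metrics on the ball and their curvature\<close>

text \<open>
  A metric is given by its component matrix in the standard coordinates; indices of tensors such
  as \<open>Ricci g i j x\<close> are components with respect to the coordinate frame.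
\<close>

type_synonym metric = "real^4 \<Rightarrow> real^4^4"

definition flat_metric :: metric where
  "flat_metric = (\<lambda>x. mat 1)"

definition conformal_metric :: "(real^4 \<Rightarrow> real) \<Rightarrow> metric" where
  "conformal_metric u = (\<lambda>x. exp (2 * u x) *\<^sub>R flat_metric x)"

definition ginv :: "metric \<Rightarrow> 4 \<Rightarrow> 4 \<Rightarrow> real^4 \<Rightarrow> real" where
  "ginv g i j x = matrix_inv (g x) $ i $ j"

text \<open>\<open>Christoffel g k i j\<close> has upper index \<open>k\<close>.\<close>

definition Christoffel :: "metric \<Rightarrow> 4 \<Rightarrow> 4 \<Rightarrow> 4 \<Rightarrow> real^4 \<Rightarrow> real" where
  "Christoffel g k i j x = (1/2) * (\<Sum>l\<in>UNIV. ginv g k l x *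
     (pd i (\<lambda>y. g y $ j $ l) x + pd j (\<lambda>y. g y $ i $ l) x - pd l (\<lambda>y. g y $ i $ j) x))"

definition Ricci :: "metric \<Rightarrow> 4 \<Rightarrow> 4 \<Rightarrow> real^4 \<Rightarrow> real" where
  "Ricci g i j x =
     (\<Sum>k\<in>UNIV. pd k (Christoffel g k i j) x - pd j (Christoffel g k i k) x)
   + (\<Sum>k\<in>UNIV. \<Sum>l\<in>UNIV. Christoffel g k k l x * Christoffel g l i j x
                       - Christoffel g k j l x * Christoffel g l i k x)"

definition scalar_curv :: "metric \<Rightarrow> real^4 \<Rightarrow> real" where
  "scalar_curv g x = (\<Sum>i\<in>UNIV. \<Sum>j\<in>UNIV. ginv g i j x * Ricci g i j x)"

definition Schouten :: "metric \<Rightarrow> 4 \<Rightarrow> 4 \<Rightarrow> real^4 \<Rightarrow> real" where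
  "Schouten g i j x = (1/2) * (Ricci g i j x - scalar_curv g x / 6 * g x $ i $ j)"

definition Schouten_norm_sq :: "metric \<Rightarrow> real^4 \<Rightarrow> real" where
  "Schouten_norm_sq g x = (\<Sum>i\<in>UNIV. \<Sum>j\<in>UNIV. \<Sum>k\<in>UNIV. \<Sum>l\<in>UNIV.
     ginv g i k x * ginv g j l x * Schouten g i j x * Schouten g k l x)"

definition sigma1 :: "metric \<Rightarrow> real^4 \<Rightarrow> real" where
  "sigma1 g x = scalar_curv g x / 6"

definition sigma2 :: "metric \<Rightarrow> real^4 \<Rightarrow> real" where
  "sigma2 g x = (1/2) * ((sigma1 g x)\<^sup>2 - Schouten_norm_sq g x)"


section \<open>Boundary geometry\<close>

text \<open>
  On the sphere, \<open>x\<close> is a Euclidean conormal, so raising its index with \<open>g\<close> and normalising gives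
  the outward \<open>g\<close>-unit normal. The same formula extends it to the punctured ball, so that its
  coordinate derivatives make sense; \<open>mean_curv\<close> uses tangential derivatives only.
\<close>

definition normal :: "metric \<Rightarrow> 4 \<Rightarrow> real^4 \<Rightarrow> real" where
  "normal g k x = (\<Sum>j\<in>UNIV. ginv g k j x * x $ j) /
     sqrt (\<Sum>i\<in>UNIV. \<Sum>j\<in>UNIV. ginv g i j x * x $ i * x $ j)"

text \<open>
  The trace over the tangent space of the boundary, with respect to the induced metric, of a
  covariant 2-tensor \<open>T\<close>: the inverse of the induced metric is \<open>g\<^sup>i\<^sup>j - \<eta>\<^sup>i \<eta>\<^sup>j\<close>.
\<close>

definition bdry_trace :: "metric \<Rightarrow> (4 \<Rightarrow> 4 \<Rightarrow> real^4 \<Rightarrow> real) \<Rightarrow> real^4 \<Rightarrow> real" where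
  "bdry_trace g T x = (\<Sum>i\<in>UNIV. \<Sum>j\<in>UNIV. (ginv g i j x - normal g i x * normal g j x) * T i j x)"

text \<open>\<open>nabla_normal g i j\<close> is \<open>g(\<nabla>\<^sub>i \<eta>, \<partial>\<^sub>j)\<close>.\<close>

definition nabla_normal :: "metric \<Rightarrow> 4 \<Rightarrow> 4 \<Rightarrow> real^4 \<Rightarrow> real" where
  "nabla_normal g i j x = (\<Sum>k\<in>UNIV. g x $ k $ j *
     (pd i (normal g k) x + (\<Sum>l\<in>UNIV. Christoffel g k i l x * normal g l x)))"

definition mean_curv :: "metric \<Rightarrow> real^4 \<Rightarrow> real" where
  "mean_curv g x = (1/3) * bdry_trace g (nabla_normal g) x"

text \<open>The formula for umbilic boundary, which is the case for every conformally flat metric used here.\<close>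

definition H2 :: "metric \<Rightarrow> real^4 \<Rightarrow> real" where
  "H2 g x = mean_curv g x * bdry_trace g (Schouten g) x + (mean_curv g x) ^ 3"


section \<open>Volumes and integrals\<close>

definition integral_B4 :: "metric \<Rightarrow> (real^4 \<Rightarrow> real) \<Rightarrow> real" where
  "integral_B4 g f = (LINT x:B4|lborel. f x * sqrt (det (g x)))"

text \<open>
  The surface measure of the round unit sphere, from polar coordinates \<open>dx = r\<^sup>3 dr d\<sigma>\<close>:
  \<open>\<sigma>(A)\<close> is four times the Lebesgue measure of the cone in the unit ball over \<open>A\<close>.
\<close>

definition sphere_measure :: "(real^4) measure" where
  "sphere_measure = scale_measure 4 (distr (restrict_space lborel B4) borel (\<lambda>x. x /\<^sub>R norm x))"

text \<open>
  The volume density of the metric induced by \<open>g\<close> on the sphere, relative to the round one, is the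
  square root of the determinant of \<open>g\<close> restricted to the tangent space. Writing \<open>Q\<close> for the
  Euclidean projection to the tangent space at \<open>x\<close>, that determinant is \<open>det (Q g Q + x x\<^sup>T)\<close>.
\<close>

definition bdry_density :: "metric \<Rightarrow> real^4 \<Rightarrow> real" where
  "bdry_density g x =
     (let X = (\<chi> i j. x $ i * x $ j); Q = mat 1 - X in sqrt (det (Q ** g x ** Q + X)))"

definition integral_S3 :: "metric \<Rightarrow> (real^4 \<Rightarrow> real) \<Rightarrow> real" where
  "integral_S3 g f = (LINT x:S3|sphere_measure. f x * bdry_density g x)"

definition bdry_vol :: "metric \<Rightarrow> real" where
  "bdry_vol g = integral_S3 g (\<lambda>x. 1)"

definition omega3 :: real where
  "omega3 = measure sphere_measure S3"


section \<open>The variational problem\<close>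

definition V :: "metric set" where
  "V = {conformal_metric u | u. u \<in> smooth_B4 \<and> bdry_vol (conformal_metric u) = omega3}"

definition C1 :: "metric set" where
  "C1 = {g. (\<forall>x\<in>B4. sigma1 g x \<ge> 0) \<and> (\<forall>x\<in>S3. mean_curv g x > 0)}"

text \<open>
  \<open>F2 u\<close> is the value of the functional at \<open>conformal_metric u\<close>; \<open>u\<close> is determined by the metric.
\<close>

definition F2 :: "(real^4 \<Rightarrow> real) \<Rightarrow> real" where
  "F2 u = (LINT s:{0..1}|lborel.
     (let g = conformal_metric (\<lambda>x. s * u x)
      in integral_B4 g (\<lambda>x. u x * sigma2 g x) + integral_S3 g (\<lambda>x. u x * H2 g x)))"

definition local_minimizer_F2 :: "(real^4 \<Rightarrow> real) \<Rightarrow> bool" where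
  "local_minimizer_F2 u \<longleftrightarrow> conformal_metric u \<in> V \<and>
     (\<exists>U. openin Cinf_topology U \<and> u \<in> U \<and> (\<forall>v\<in>U. conformal_metric v \<in> V \<longrightarrow> F2 u \<le> F2 v))"


section \<open>Conformal diffeomorphisms\<close>

definition jacobian :: "(real^4 \<Rightarrow> real^4) \<Rightarrow> real^4 \<Rightarrow> real^4^4" where
  "jacobian \<Phi> x = (\<chi> k i. pd i (\<lambda>y. \<Phi> y $ k) x)"

definition pullback :: "(real^4 \<Rightarrow> real^4) \<Rightarrow> metric \<Rightarrow> metric" where
  "pullback \<Phi> g x = transpose (jacobian \<Phi> x) ** g (\<Phi> x) ** jacobian \<Phi> x"

definition conformal_diffeo :: "(real^4 \<Rightarrow> real^4) \<Rightarrow> bool" where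
  "conformal_diffeo \<Phi> \<longleftrightarrow>
     bij_betw \<Phi> B4 B4 \<and> \<Phi> ` S3 = S3 \<and>
     smooth_map_B4 \<Phi> \<and> smooth_map_B4 (inv_into B4 \<Phi>) \<and>
     (\<exists>w\<in>smooth_B4. \<forall>x\<in>B4. pullback \<Phi> flat_metric x = conformal_metric w x)"

end

theory Submission
  imports Defs
begin

text \<open>
  In flat coordinates the functional is a polynomial of degree four in u and its derivatives. Its
  first variation has a weak form coming from a symmetric multilinear expression, so that the second
  variation at u in direction v is the integral of T(dv, dv) over the ball, with T the first Newton
  tensor, plus the integral of (1 + du/dr) |dv|^2 (tangential gradient) over the sphere. Adding a
  constant to u changes the functional by that constant times the volume of the sphere; a local
  minimizer under the volume constraint therefore has second variation at least 3 times the
  integral of v^2 exp(3u), for all v orthogonal to exp(3u).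

  A Hersch-type argument gives a Moebius map phi of the ball whose components are orthogonal to
  exp(3u), and these are used as test functions. Writing exp(2w) for the conformal factor of phi
  and summing over the components, conformality turns the Newton tensor into its trace.
  Integration by parts, with the facts that exp(2w) dx^2 is flat with boundary mean curvature 1 and
  boundary volume that of the sphere, reduces the inequality to: the integral of exp(2w) |d(u - w)|^2
  is at most 0. Hence u = w, and the inverse of phi pulls the metric back to the flat one.
\<close>


text \<open>The test functions come from the equality case. At u = 0 each coordinate function
  \<open>x $ k\<close> has second variation exactly 3 times the integral of its square over the
  sphere. For general u the coordinate functions fail to be orthogonal to
  \<open>exp (3 * u)\<close>; a Moebius map has a parameter with four real components, as many as
  there are conditions to be met.

  The obstacle is the Hessian of u in the second variation, which has no sign. After summation over
  the components only its trace is left, so that u enters through \<open>lap u\<close> and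
  \<open>gdot u u\<close> alone. One integration by parts with weight \<open>exp (2 * w)\<close>
  removes \<open>lap u\<close>, and what remains completes a square in du - dw.

  The factor 3 is the exponent of the boundary volume: restoring the volume costs
  \<open>omega3 / 3\<close> times the logarithm of the volume ratio, whose second order term is 3/2
  times t^2 times the integral of \<open>v^2 * exp (3 * u)\<close>. As the energy is a polynomial in
  t along \<open>u + t * v\<close>, the second variation is read off as a coefficient, and comparing
  t with -t eliminates the linear term.\<close>

section \<open>Smooth functions on the ball\<close>

text \<open>Membership in the ball is kept folded, so that it matches the premises of the rules below.\<close>

declare mem_cball [simp del] mem_cball_0 [simp del]

lemma has_derivative_B4_cong:
  assumes "x \<in> B4" "\<And>y. y \<in> B4 \<Longrightarrow> f y = g y"
  shows "(f has_derivative D) (at x within B4) \<longleftrightarrow> (g has_derivative D) (at x within B4)"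
  using assms has_derivative_transform[OF assms(1), of f g D] has_derivative_transform[OF assms(1), of g f D] by auto

lemma pd_cong:
  assumes "x \<in> B4" "\<And>y. y \<in> B4 \<Longrightarrow> f y = g y"
  shows "pd i f x = pd i g x"
  using has_derivative_B4_cong[OF assms] by (simp add: pd_def frechet_derivative_def)

lemma has_derivative_pd:
  assumes "f differentiable (at x within B4)" "x \<in> B4"
  shows "(f has_derivative (\<lambda>h. \<Sum>i\<in>UNIV. h $ i * pd i f x)) (at x within B4)"
proof -
  obtain D where D: "(f has_derivative D) (at x within B4)"
    using assms(1) by (auto simp: differentiable_def)
  then have lin: "linear D" by (rule has_derivative_linear)
  have "D h = (\<Sum>i\<in>UNIV. h $ i * pd i f x)" for h
  proof -
    have "D h = D (\<Sum>i\<in>UNIV. h $ i *s axis i 1)"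
      by (simp add: basis_expansion)
    also have "\<dots> = (\<Sum>i\<in>UNIV. h $ i * pd i f x)"
      by (simp add: linear_sum[OF lin] scalar_mult_eq_scaleR linear_cmul[OF lin] pd_eqI[OF assms(2) D])
    finally show ?thesis .
  qed
  then have "D = (\<lambda>h. \<Sum>i\<in>UNIV. h $ i * pd i f x)" by auto
  with D show ?thesis by simp
qed

lemma pd_const [simp]: "x \<in> B4 \<Longrightarrow> pd i (\<lambda>_. c) x = 0"
  by (subst pd_eqI[where D = "\<lambda>_. 0"]) auto

lemma pd_nth: "x \<in> B4 \<Longrightarrow> pd i (\<lambda>y. y $ k) x = (if i = k then 1 else 0)"
proof -
  assume "x \<in> B4"
  moreover have "((\<lambda>y. y $ k) has_derivative (\<lambda>h. h $ k)) (at x within B4)"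
    by (intro bounded_linear_imp_has_derivative bounded_linear_vec_nth)
  ultimately show ?thesis by (simp add: pd_eqI axis_def)
qed

lemma pd_add_diff:
  assumes "x \<in> B4" "f differentiable (at x within B4)" "g differentiable (at x within B4)"
  shows "pd i (\<lambda>y. f y + g y) x = pd i f x + pd i g x"
    and "pd i (\<lambda>y. f y - g y) x = pd i f x - pd i g x"
    and "pd i (\<lambda>y. f y * g y) x = pd i f x * g x + f x * pd i g x"
proof -
  note D = has_derivative_pd[OF assms(2,1)] has_derivative_pd[OF assms(3,1)]
  note [simp] = axis_def if_distrib[where f = "\<lambda>a. a * _"]
  show "pd i (\<lambda>y. f y + g y) x = pd i f x + pd i g x"
    using pd_eqI[OF assms(1) has_derivative_add[OF D], of i] by (simp cong: if_cong)
  show "pd i (\<lambda>y. f y - g y) x = pd i f x - pd i g x"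
    using pd_eqI[OF assms(1) has_derivative_diff[OF D], of i] by (simp cong: if_cong)
  show "pd i (\<lambda>y. f y * g y) x = pd i f x * g x + f x * pd i g x"
    using pd_eqI[OF assms(1) has_derivative_mult[OF D], of i] by (simp cong: if_cong)
qed

lemma pd_compose:
  assumes "x \<in> B4" "f differentiable (at x within B4)" "(h has_real_derivative d) (at (f x))"
  shows "pd i (\<lambda>y. h (f y)) x = d * pd i f x"
proof -
  have "((\<lambda>y. h (f y)) has_derivative (\<lambda>v. d * (\<Sum>i\<in>UNIV. v $ i * pd i f x))) (at x within B4)"
    using has_derivative_compose[OF has_derivative_pd[OF assms(2,1)]] assms(3)
    by (simp add: has_field_derivative_def)
  from pd_eqI[OF assms(1) this, of i] show ?thesis
    by (simp add: axis_def if_distrib[where f = "\<lambda>a. a * _"] cong: if_cong)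
qed

lemma pd_sum:
  assumes "x \<in> B4" "finite A" "\<And>k. k \<in> A \<Longrightarrow> f k differentiable (at x within B4)"
  shows "pd i (\<lambda>y. \<Sum>k\<in>A. f k y) x = (\<Sum>k\<in>A. pd i (f k) x)"
proof -
  have "((\<lambda>y. \<Sum>k\<in>A. f k y) has_derivative
      (\<lambda>h. \<Sum>k\<in>A. \<Sum>i\<in>UNIV. h $ i * pd i (f k) x)) (at x within B4)"
    using assms by (intro has_derivative_sum has_derivative_pd)
  from pd_eqI[OF assms(1) this, of i] show ?thesis
    by (simp add: axis_def if_distrib[where f = "\<lambda>a. a * _"] cong: if_cong)
qed

text \<open>\<open>iter_pd\<close> adds derivatives on the outside, while the product and chain
  rules rewrite the innermost derivative \<open>pd i f\<close>. Peeling derivatives off from the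
  inside gives an induction on the order with f arbitrary.\<close>

primrec diff_order :: "nat \<Rightarrow> (real^4 \<Rightarrow> real) \<Rightarrow> bool" where
  "diff_order 0 f \<longleftrightarrow> f differentiable_on B4"
| "diff_order (Suc n) f \<longleftrightarrow> f differentiable_on B4 \<and> (\<forall>i. diff_order n (pd i f))"

lemma iter_pd_append: "iter_pd (is @ js) f = iter_pd is (iter_pd js f)"
  by (induction "is") auto

lemma smooth_B4_iff_diff_order: "f \<in> smooth_B4 \<longleftrightarrow> (\<forall>n. diff_order n f)"
proof -
  have "diff_order n f \<longleftrightarrow> (\<forall>is. length is \<le> n \<longrightarrow> iter_pd is f differentiable_on B4)" for n f
  proof (induction n arbitrary: f)
    case (Suc n)
    have "(\<forall>is. length is \<le> Suc n \<longrightarrow> iter_pd is f differentiable_on B4) \<longleftrightarrow>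
      f differentiable_on B4 \<and>
      (\<forall>i is. length is \<le> n \<longrightarrow> iter_pd is (pd i f) differentiable_on B4)" (is "?L = ?R")
    proof
      assume ?L
      then show ?R
      proof (intro conjI allI impI)
        show "f differentiable_on B4" using \<open>?L\<close>[rule_format, of "[]"] by simp
        show "iter_pd is (pd i f) differentiable_on B4" if "length is \<le> n" for i "is"
          using \<open>?L\<close>[rule_format, of "is @ [i]"] that by (simp add: iter_pd_append)
      qed
    next
      assume R: ?R
      show ?L
      proof (intro allI impI)
        fix js :: "4 list"
        assume "length js \<le> Suc n"
        then show "iter_pd js f differentiable_on B4"
          using R by (cases js rule: rev_cases) (auto simp: iter_pd_append)
      qed
    qed
    then show ?case using Suc by auto
  qed auto
  then show ?thesis by (auto simp: smooth_B4_def)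
qed

lemma diff_order_Suc_imp: "diff_order (Suc n) f \<Longrightarrow> diff_order n f"
  by (induction n arbitrary: f) auto

lemma diff_order_differentiable:
  "diff_order n f \<Longrightarrow> x \<in> B4 \<Longrightarrow> f differentiable (at x within B4)"
  by (cases n) (auto simp: differentiable_on_def)

lemma differentiable_on_B4_cong:
  assumes "\<And>x. x \<in> B4 \<Longrightarrow> f x = g x"
  shows "f differentiable_on B4 \<longleftrightarrow> g differentiable_on B4"
  using has_derivative_B4_cong[of _ f g] assms
  unfolding differentiable_on_def differentiable_def by auto

lemma diff_order_cong:
  assumes "\<And>x. x \<in> B4 \<Longrightarrow> f x = g x"
  shows "diff_order n f \<longleftrightarrow> diff_order n g"
  using assms
proof (induction n arbitrary: f g)
  case 0
  show ?case unfolding diff_order.simps by (rule differentiable_on_B4_cong) (rule 0)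
next
  case (Suc n)
  have "f differentiable_on B4 \<longleftrightarrow> g differentiable_on B4"
    by (rule differentiable_on_B4_cong) (rule Suc.prems)
  moreover have "pd i f x = pd i g x" if "x \<in> B4" for i x
    using that Suc.prems by (rule pd_cong)
  then have "diff_order n (pd i f) \<longleftrightarrow> diff_order n (pd i g)" for i
    by (rule Suc.IH)
  ultimately show ?case unfolding diff_order.simps by blast
qed

lemma diff_order_add: "diff_order n f \<Longrightarrow> diff_order n g \<Longrightarrow> diff_order n (\<lambda>x. f x + g x)"
proof (induction n arbitrary: f g)
  case (Suc n)
  have "diff_order n (pd i (\<lambda>x. f x + g x)) \<longleftrightarrow> diff_order n (\<lambda>x. pd i f x + pd i g x)" for i
    by (intro diff_order_cong pd_add_diff diff_order_differentiable[OF Suc.prems(1)]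
        diff_order_differentiable[OF Suc.prems(2)])
  then show ?case using Suc by (simp add: differentiable_on_add)
qed (simp add: differentiable_on_add)

lemma diff_order_mult: "diff_order n f \<Longrightarrow> diff_order n g \<Longrightarrow> diff_order n (\<lambda>x. f x * g x)"
proof (induction n arbitrary: f g)
  case (Suc n)
  have "diff_order n (pd i (\<lambda>x. f x * g x)) \<longleftrightarrow> diff_order n (\<lambda>x. pd i f x * g x + f x * pd i g x)" for i
    by (intro diff_order_cong pd_add_diff diff_order_differentiable[OF Suc.prems(1)]
        diff_order_differentiable[OF Suc.prems(2)])
  moreover have "diff_order n (\<lambda>x. pd i f x * g x + f x * pd i g x)" for i
    using Suc diff_order_Suc_imp[OF Suc.prems(1)] diff_order_Suc_imp[OF Suc.prems(2)]
    by (intro diff_order_add Suc.IH) auto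
  ultimately show ?case using Suc.prems by (simp add: differentiable_on_mult)
qed (simp add: differentiable_on_mult)

lemma diff_order_const: "diff_order n (\<lambda>_. c)"
proof (induction n arbitrary: c)
  case (Suc n)
  have "diff_order n (pd i (\<lambda>_. c)) \<longleftrightarrow> diff_order n (\<lambda>_. 0)" for i
    by (intro diff_order_cong) simp
  with Suc show ?case by simp
qed simp

lemma smooth_const [intro, simp]: "(\<lambda>_. c) \<in> smooth_B4"
  by (simp add: smooth_B4_iff_diff_order diff_order_const)

lemma smooth_add [intro]: "f \<in> smooth_B4 \<Longrightarrow> g \<in> smooth_B4 \<Longrightarrow> (\<lambda>x. f x + g x) \<in> smooth_B4"
  by (simp add: smooth_B4_iff_diff_order diff_order_add)

lemma smooth_mult [intro]: "f \<in> smooth_B4 \<Longrightarrow> g \<in> smooth_B4 \<Longrightarrow> (\<lambda>x. f x * g x) \<in> smooth_B4"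
  by (simp add: smooth_B4_iff_diff_order diff_order_mult)

lemma smooth_minus [intro]: "f \<in> smooth_B4 \<Longrightarrow> (\<lambda>x. - f x) \<in> smooth_B4"
  using smooth_mult[OF smooth_const[of "-1"], of f] by simp

lemma smooth_diff [intro]: "f \<in> smooth_B4 \<Longrightarrow> g \<in> smooth_B4 \<Longrightarrow> (\<lambda>x. f x - g x) \<in> smooth_B4"
  using smooth_add[of f "\<lambda>x. - g x"] smooth_minus[of g] by simp

lemma smooth_power [intro]: "f \<in> smooth_B4 \<Longrightarrow> (\<lambda>x. f x ^ n) \<in> smooth_B4"
  by (induction n) auto

lemma smooth_sum [intro]:
  "(\<And>k. k \<in> A \<Longrightarrow> f k \<in> smooth_B4) \<Longrightarrow> (\<lambda>x. \<Sum>k\<in>A. f k x) \<in> smooth_B4"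
  by (induction A rule: infinite_finite_induct) auto

lemma smooth_pd [intro]: "f \<in> smooth_B4 \<Longrightarrow> pd i f \<in> smooth_B4"
  unfolding smooth_B4_iff_diff_order by (metis diff_order.simps(2))

named_theorems smooth_intros

declare smooth_const [smooth_intros] smooth_add [smooth_intros] smooth_mult [smooth_intros] smooth_diff [smooth_intros]
  smooth_sum [smooth_intros] smooth_pd [smooth_intros]

lemma smooth_cong: "(\<And>x. x \<in> B4 \<Longrightarrow> f x = g x) \<Longrightarrow> f \<in> smooth_B4 \<longleftrightarrow> g \<in> smooth_B4"
  unfolding smooth_B4_iff_diff_order using diff_order_cong by blast

lemma smooth_differentiable [intro]:
  "f \<in> smooth_B4 \<Longrightarrow> x \<in> B4 \<Longrightarrow> f differentiable (at x within B4)"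
  unfolding smooth_B4_iff_diff_order using diff_order_differentiable by blast

lemma smooth_continuous_on [intro]: "f \<in> smooth_B4 \<Longrightarrow> continuous_on B4 f"
  by (simp add: smooth_differentiable continuous_on_eq_continuous_within differentiable_imp_continuous_within)

lemma smooth_nth [intro, simp, smooth_intros]: "(\<lambda>x. x $ k) \<in> smooth_B4"
  unfolding smooth_B4_iff_diff_order
proof
  fix n
  have d: "(\<lambda>x. x $ k) differentiable_on B4"
    by (intro linear_imp_differentiable_on bounded_linear.linear bounded_linear_vec_nth)
  show "diff_order n (\<lambda>x. x $ k)"
  proof (cases n)
    case (Suc m)
    have "diff_order m (pd i (\<lambda>x. x $ k))" for i
      by (subst diff_order_cong[where g = "\<lambda>x. if i = k then 1 else 0"])
        (auto simp: pd_nth diff_order_const)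
    with d Suc show ?thesis by simp
  qed (use d in simp)
qed

text \<open>The chain rule gains one order, the derivative of \<open>h (f x)\<close> being
  \<open>h' (f x) * pd i f x\<close>. This bootstraps when \<open>h'\<close> is expressed through
  \<open>h\<close> itself, as for \<open>exp\<close> and \<open>inverse\<close>, and is a single
  step for \<open>ln\<close>, whose derivative is \<open>inverse\<close>.\<close>

lemma smooth_compose_aux:
  assumes "\<And>x. x \<in> B4 \<Longrightarrow> (h has_real_derivative h' (f x)) (at (f x))"
    and "f \<in> smooth_B4" and "diff_order n (\<lambda>x. h' (f x))"
  shows "diff_order (Suc n) (\<lambda>x. h (f x))"
proof -
  have "diff_order n (pd i (\<lambda>x. h (f x)))" for i
    using assms smooth_pd[OF assms(2), of i]
    by (subst diff_order_cong[where g = "\<lambda>x. h' (f x) * pd i f x"])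
      (auto intro!: pd_compose diff_order_mult simp: smooth_B4_iff_diff_order
        intro: diff_order_differentiable)
  moreover have "(\<lambda>x. h (f x)) differentiable (at x within B4)" if "x \<in> B4" for x
    using has_derivative_compose[OF has_derivative_pd[OF smooth_differentiable[OF assms(2) that] that]]
      assms(1)[OF that]
    unfolding has_field_derivative_def differentiable_def by blast
  ultimately show ?thesis by (simp add: differentiable_on_def)
qed

lemma smooth_exp [intro]:
  assumes "f \<in> smooth_B4" shows "(\<lambda>x. exp (f x)) \<in> smooth_B4"
proof -
  have "diff_order n (\<lambda>x. exp (f x))" for n
  proof (induction n)
    case 0
    have "(\<lambda>x. exp (f x)) differentiable (at x within B4)" if "x \<in> B4" for x
      using has_derivative_exp[OF has_derivative_pd[OF smooth_differentiable[OF assms that] that]]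
      by (auto simp: differentiable_def)
    then show ?case by (simp add: differentiable_on_def)
  next
    case (Suc n)
    then show ?case by (intro smooth_compose_aux[where h' = exp] assms) auto
  qed
  then show ?thesis by (simp add: smooth_B4_iff_diff_order)
qed

lemma smooth_inverse [intro]:
  assumes "f \<in> smooth_B4" "\<And>x. x \<in> B4 \<Longrightarrow> f x \<noteq> 0" shows "(\<lambda>x. inverse (f x)) \<in> smooth_B4"
proof -
  have D: "(inverse has_real_derivative - (inverse y * inverse y)) (at y)" if "y \<noteq> 0" for y :: real
    using DERIV_inverse[OF that] by (simp add: power2_eq_square)
  have "diff_order n (\<lambda>x. inverse (f x))" for n
  proof (induction n)
    case 0
    have "(\<lambda>x. inverse (f x)) differentiable (at x within B4)" if "x \<in> B4" for x
      using assms(2)[OF that] smooth_differentiable[OF assms(1) that] by (rule differentiable_inverse[rotated])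
    then show ?case by (simp add: differentiable_on_def)
  next
    case (Suc n)
    then have *: "diff_order n (\<lambda>x. - 1 * (inverse (f x) * inverse (f x)))"
      by (intro diff_order_mult diff_order_const)
    show ?case
      by (rule smooth_compose_aux[where h' = "\<lambda>y. - (inverse y * inverse y)"])
        (use * assms D in simp_all)
  qed
  then show ?thesis by (simp add: smooth_B4_iff_diff_order)
qed

lemma smooth_divide [intro]:
  assumes "f \<in> smooth_B4" "g \<in> smooth_B4" "\<And>x. x \<in> B4 \<Longrightarrow> g x \<noteq> 0"
  shows "(\<lambda>x. f x / g x) \<in> smooth_B4"
  using smooth_mult[OF assms(1) smooth_inverse[OF assms(2,3)]] by (simp add: divide_inverse)

lemma smooth_ln [intro]:
  assumes "f \<in> smooth_B4" "\<And>x. x \<in> B4 \<Longrightarrow> f x > 0" shows "(\<lambda>x. ln (f x)) \<in> smooth_B4"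
proof -
  have "(\<lambda>x. inverse (f x)) \<in> smooth_B4"
    by (rule smooth_inverse) (use assms(1) assms(2) less_irrefl in metis)+
  then have "diff_order n (\<lambda>x. inverse (f x))" for n
    by (simp add: smooth_B4_iff_diff_order)
  then have "diff_order (Suc n) (\<lambda>x. ln (f x))" for n
    by (intro smooth_compose_aux[where h' = inverse] DERIV_ln assms)
  then show ?thesis
    unfolding smooth_B4_iff_diff_order by (blast intro: diff_order_Suc_imp)
qed

lemma smooth_pd_add:
  assumes "x \<in> B4" "f \<in> smooth_B4" "g \<in> smooth_B4"
  shows "pd i (\<lambda>y. f y + g y) x = pd i f x + pd i g x"
    and "pd i (\<lambda>y. f y - g y) x = pd i f x - pd i g x"
    and "pd i (\<lambda>y. f y * g y) x = pd i f x * g x + f x * pd i g x"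
  using assms by (auto intro!: pd_add_diff)

lemma smooth_pd_uminus: "x \<in> B4 \<Longrightarrow> f \<in> smooth_B4 \<Longrightarrow> pd i (\<lambda>y. - f y) x = - pd i f x"
  using smooth_pd_add(2)[of x "\<lambda>_. 0" f i] by simp

lemma smooth_pd_sum:
  assumes "x \<in> B4" "\<And>k. k \<in> A \<Longrightarrow> f k \<in> smooth_B4" "finite A"
  shows "pd i (\<lambda>y. \<Sum>k\<in>A. f k y) x = (\<Sum>k\<in>A. pd i (f k) x)"
  using assms by (auto intro!: pd_sum)

lemma smooth_pd_exp: "x \<in> B4 \<Longrightarrow> f \<in> smooth_B4 \<Longrightarrow> pd i (\<lambda>y. exp (f y)) x = exp (f x) * pd i f x"
  by (rule pd_compose) auto

lemma smooth_pd_inverse: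
  "x \<in> B4 \<Longrightarrow> f \<in> smooth_B4 \<Longrightarrow> f x \<noteq> 0 \<Longrightarrow> pd i (\<lambda>y. inverse (f y)) x = - pd i f x / (f x)\<^sup>2"
  using pd_compose[OF _ smooth_differentiable DERIV_inverse, of x f] by (simp add: field_simps power2_eq_square)

lemma smooth_pd_ln:
  "x \<in> B4 \<Longrightarrow> f \<in> smooth_B4 \<Longrightarrow> f x > 0 \<Longrightarrow> pd i (\<lambda>y. ln (f y)) x = pd i f x / f x"
  using pd_compose[OF _ smooth_differentiable DERIV_ln, of x f] by (simp add: field_simps)

section \<open>Symmetry of second partial derivatives\<close>

lemma DERIV_along_axis:
  assumes "f \<in> smooth_B4" "y + t *\<^sub>R axis i 1 \<in> ball 0 1"
  shows "((\<lambda>t. f (y + t *\<^sub>R axis i 1)) has_real_derivative pd i f (y + t *\<^sub>R axis i 1)) (at t)"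
proof -
  let ?p = "\<lambda>t. y + t *\<^sub>R (axis i 1 :: real^4)"
  have B: "?p t \<in> B4" using assms(2) by (auto simp: mem_cball_0)
  have D1: "(f has_derivative (\<lambda>h. \<Sum>k\<in>UNIV. h $ k * pd k f (?p t))) (at (?p t))"
    using has_derivative_pd[OF smooth_differentiable[OF assms(1) B] B]
      at_within_interior[of "?p t" B4] assms(2) by (simp del: norm_mult)
  have D2: "(?p has_derivative (\<lambda>h. h *\<^sub>R axis i 1)) (at t)"
    by (auto intro!: derivative_eq_intros)
  have "((\<lambda>t. f (?p t)) has_derivative
      (\<lambda>h. \<Sum>k\<in>UNIV. (h *\<^sub>R axis i 1 :: real^4) $ k * pd k f (?p t))) (at t)"
    using has_derivative_compose[OF D2 D1] .
  moreover have "(\<Sum>k\<in>UNIV. (h *\<^sub>R axis i 1 :: real^4) $ k * pd k f (?p t)) = pd i f (?p t) * h" for h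
  proof -
    have "(h *\<^sub>R axis i 1 :: real^4) $ k * pd k f (?p t) = (if k = i then pd k f (?p t) * h else 0)" for k
      by (simp add: axis_def)
    then show ?thesis by simp
  qed
  ultimately show ?thesis by (simp add: has_field_derivative_def)
qed

text \<open>The mean value theorem is applied in direction i to the increment in direction j, then
  in direction j to \<open>pd i f\<close>. The second difference is symmetric in i and j, the
  derivative on the right is taken in a definite order; this is how the two orders get compared. The
  radius \<open>2 * h\<close> covers the case i = j too.\<close>

lemma second_difference_mvt:
  assumes f: "f \<in> smooth_B4" and h: "h > 0" and sub: "cball x (2 * h) \<subseteq> ball 0 1"
  shows "\<exists>z\<in>cball x (2 * h).
    f (x + h *\<^sub>R axis i 1 + h *\<^sub>R axis j 1) - f (x + h *\<^sub>R axis i 1) - f (x + h *\<^sub>R axis j 1) + f x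
      = h * h * pd j (pd i f) z"
proof -
  define \<delta> where "\<delta> k t = t *\<^sub>R (axis k 1 :: real^4)" for k and t :: real
  have n: "norm (\<delta> k t) = \<bar>t\<bar>" for k t by (simp add: \<delta>_def)
  have inb: "x + \<delta> i s + \<delta> j t \<in> cball x (2 * h)" if "0 \<le> s" "s \<le> h" "0 \<le> t" "t \<le> h" for s t
    using norm_triangle_ineq[of "\<delta> j t" "\<delta> i s"] norm_triangle_ineq[of "\<delta> i s" "\<delta> j t"] that h
    by (simp add: n mem_cball dist_norm norm_minus_commute add.assoc)
  have d0: "\<delta> k 0 = 0" for k by (simp add: \<delta>_def)
  define \<phi> where "\<phi> s = f (x + \<delta> i s + \<delta> j h) - f (x + \<delta> i s)" for s
  have D\<phi>: "(\<phi> has_real_derivative pd i f (x + \<delta> i s + \<delta> j h) - pd i f (x + \<delta> i s)) (at s)"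
    if "0 \<le> s" "s \<le> h" for s
  proof -
    have "x + \<delta> j h + \<delta> i s \<in> ball 0 1" "x + \<delta> i s \<in> ball 0 1"
      using inb[OF that, of h] inb[OF that, of 0] h sub by (auto simp: d0 add_ac)
    then show ?thesis
      using DERIV_along_axis[OF f, of "x + \<delta> j h" s i] DERIV_along_axis[OF f, of x s i]
      unfolding \<phi>_def by (auto intro!: DERIV_diff simp: \<delta>_def add_ac)
  qed
  obtain s where s: "0 < s" "s < h"
    "\<phi> h - \<phi> 0 = h * (pd i f (x + \<delta> i s + \<delta> j h) - pd i f (x + \<delta> i s))"
    using MVT2[OF h D\<phi>] by auto
  have D2: "((\<lambda>t. pd i f (x + \<delta> i s + \<delta> j t)) has_real_derivative
      pd j (pd i f) (x + \<delta> i s + \<delta> j t)) (at t)" if "0 \<le> t" "t \<le> h" for t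
    using DERIV_along_axis[OF smooth_pd[OF f], where y = "x + \<delta> i s" and t = t and i = j] inb[of s t] that s sub
    by (auto simp: \<delta>_def)
  obtain t where t: "0 < t" "t < h"
    "pd i f (x + \<delta> i s + \<delta> j h) - pd i f (x + \<delta> i s + \<delta> j 0)
      = h * pd j (pd i f) (x + \<delta> i s + \<delta> j t)"
    using MVT2[OF h D2] by auto
  have "f (x + \<delta> i h + \<delta> j h) - f (x + \<delta> i h) - f (x + \<delta> j h) + f x = \<phi> h - \<phi> 0"
    by (simp add: \<phi>_def d0)
  also have "\<dots> = h * h * pd j (pd i f) (x + \<delta> i s + \<delta> j t)"
    using s(3) t(3) by (simp add: d0)
  finally show ?thesis using inb[of s t] s t unfolding \<delta>_def by (intro bexI) auto
qed

lemma cball_subset_ball_0: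
  "x \<in> ball 0 1 \<Longrightarrow> r < 1 - norm x \<Longrightarrow> cball x r \<subseteq> ball (0::real^4) 1"
proof
  fix y assume a: "x \<in> ball 0 1" "r < 1 - norm x" "y \<in> cball x r"
  then show "y \<in> ball 0 1"
    using norm_triangle_ineq[of x "y - x"] by (simp add: mem_cball dist_norm norm_minus_commute)
qed

text \<open>In the interior both orders are limits of the same second difference. On the sphere,
  where derivatives are one-sided, equality follows by continuity, the closed ball being the closure
  of the open one.\<close>

lemma pd_commute:
  assumes f: "f \<in> smooth_B4" and x: "x \<in> B4"
  shows "pd i (pd j f) x = pd j (pd i f) x"
proof -
  let ?A = "pd j (pd i f)" and ?B = "pd i (pd j f)"
  have s: "?A \<in> smooth_B4" "?B \<in> smooth_B4" using f by auto
  have int: "?A x - ?B x = 0" if x: "x \<in> ball 0 1" for x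
  proof (rule ccontr)
    assume "?A x - ?B x \<noteq> 0"
    define e where "e = \<bar>?A x - ?B x\<bar> / 2"
    have "e > 0" using \<open>?A x - ?B x \<noteq> 0\<close> by (simp add: e_def)
    have cont: "isCont ?A x" "isCont ?B x"
      using continuous_on_interior[OF smooth_continuous_on[OF s(1)], of x]
        continuous_on_interior[OF smooth_continuous_on[OF s(2)], of x] x by auto
    obtain d1 where d1: "d1 > 0" "\<And>y. dist y x < d1 \<Longrightarrow> dist (?A y) (?A x) < e"
      using cont(1) \<open>e > 0\<close> by (auto simp: continuous_at_eps_delta)
    obtain d2 where d2: "d2 > 0" "\<And>y. dist y x < d2 \<Longrightarrow> dist (?B y) (?B x) < e"
      using cont(2) \<open>e > 0\<close> by (auto simp: continuous_at_eps_delta)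
    \<comment> \<open>The points supplied by the mean value theorem lie within \<open>2 * h\<close>
      of x, which is at most half of each of the three radii.\<close>
    define h where "h = min (min d1 d2) (1 - norm x) / 4"
    have h: "h > 0" "2 * h < d1" "2 * h < d2" "2 * h < 1 - norm x"
      using d1 d2 x by (auto simp: h_def min_def)
    have sub: "cball x (2 * h) \<subseteq> ball 0 1" using x h by (intro cball_subset_ball_0) auto
    obtain z where z: "z \<in> cball x (2*h)" and z': "f (x + h *\<^sub>R axis i 1 + h *\<^sub>R axis j 1) -
        f (x + h *\<^sub>R axis i 1) - f (x + h *\<^sub>R axis j 1) + f x = h * h * ?A z"
      using second_difference_mvt[OF f h(1) sub, of i j] by auto
    obtain w where w: "w \<in> cball x (2*h)" and w': "f (x + h *\<^sub>R axis j 1 + h *\<^sub>R axis i 1) -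
        f (x + h *\<^sub>R axis j 1) - f (x + h *\<^sub>R axis i 1) + f x = h * h * ?B w"
      using second_difference_mvt[OF f h(1) sub, of j i] by auto
    have c: "x + h *\<^sub>R axis j 1 + h *\<^sub>R axis i 1 = x + h *\<^sub>R axis i 1 + h *\<^sub>R axis j 1"
      by simp
    have "h * h * ?A z = h * h * ?B w"
      using z' w' unfolding c by linarith
    then have "?A z = ?B w" using h by simp
    moreover have "dist (?A z) (?A x) < e" "dist (?B w) (?B x) < e"
      using z w h d1(2)[of z] d2(2)[of w] by (auto simp: mem_cball dist_commute)
    ultimately show False unfolding e_def dist_real_def by argo
  qed
  have "continuous_on (closure (ball 0 1)) (\<lambda>x. ?A x - ?B x)"
    using s by (auto intro!: continuous_on_diff)
  from continuous_constant_on_closure[OF this int, of x] x show ?thesis by simp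
qed


section \<open>The divergence theorem on the ball\<close>

lemma set_integrable_B4: "continuous_on B4 f \<Longrightarrow> set_integrable lborel B4 f" for f :: "real^4 \<Rightarrow> real"
  unfolding set_integrable_def by (rule borel_integrable_compact) auto

section \<open>Integration over the unit sphere\<close>

definition surf :: "(real^4 \<Rightarrow> real) \<Rightarrow> real" where
  "surf f = (LINT x:S3|sphere_measure. f x)"

text \<open>Written as a density, the scaling becomes a factor of the integrand, from where
  \<open>integral_distr\<close> leads back to Lebesgue measure.\<close>

lemma sphere_measure_eq_density:
  "sphere_measure = density (distr (restrict_space lborel B4) borel (\<lambda>x. x /\<^sub>R norm x)) (\<lambda>_. 4)"
  unfolding sphere_measure_def by (rule measure_eqI) (simp_all add: emeasure_density_const)

lemma sets_sphere_measure [measurable_cong]: "sets sphere_measure = sets borel"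
  by (simp add: sphere_measure_def)

lemma space_sphere_measure [simp]: "space sphere_measure = UNIV"
  using sets_eq_imp_space_eq[OF sets_sphere_measure] by simp

lemma finite_measure_sphere_measure: "finite_measure sphere_measure"
proof
  let ?T = "\<lambda>x::real^4. x /\<^sub>R norm x"
  have [measurable]: "?T \<in> borel_measurable (restrict_space lborel B4)"
    by (rule measurable_restrict_space1) auto
  have "emeasure (distr (restrict_space lborel B4) borel ?T) UNIV = emeasure lborel B4"
    by (simp add: emeasure_distr emeasure_restrict_space space_restrict_space)
  then show "emeasure sphere_measure (space sphere_measure) \<noteq> \<infinity>"
    using emeasure_lborel_cball_finite[of "0::real^4" 1]
    unfolding space_sphere_measure by (simp add: sphere_measure_def ennreal_mult_eq_top_iff)
qed

lemma set_borel_measurable_S3: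
  fixes f :: "real^4 \<Rightarrow> real"
  assumes "continuous_on S3 f"
  shows "(\<lambda>x. indicator S3 x *\<^sub>R f x) \<in> borel_measurable borel"
  using borel_measurable_continuous_on_indicator[OF _ assms] by simp

lemma set_integrable_S3:
  fixes f :: "real^4 \<Rightarrow> real"
  assumes "continuous_on S3 f"
  shows "set_integrable sphere_measure S3 f"
proof -
  interpret finite_measure sphere_measure by (rule finite_measure_sphere_measure)
  have "compact (f ` S3)" using assms by (intro compact_continuous_image) auto
  then obtain M where M: "\<And>x. x \<in> S3 \<Longrightarrow> \<bar>f x\<bar> \<le> M"
    by (meson bounded_real compact_imp_bounded imageI)
  have "norm (indicator S3 x *\<^sub>R f x) \<le> \<bar>M\<bar>" for x
    using M[of x] by (auto simp: indicator_def)
  then show ?thesis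
    unfolding set_integrable_def
    using set_borel_measurable_S3[OF assms]
    by (intro integrable_const_bound[where B = "\<bar>M\<bar>"]) (auto simp: measurable_cong_sets[OF sets_sphere_measure])
qed

text \<open>The factor 4 is the normalisation in \<open>sphere_measure\<close>. The indicator
  discards the origin, which is normalised to 0 and not to a point of the sphere.\<close>

lemma surf_eq_cone_integral:
  assumes "continuous_on S3 f"
  shows "surf f = 4 * (LINT x:B4|lborel. indicator S3 (x /\<^sub>R norm x) * f (x /\<^sub>R norm x))"
proof -
  let ?F = "\<lambda>x. indicator S3 x *\<^sub>R f x"
  have F: "?F \<in> borel_measurable borel" by (rule set_borel_measurable_S3[OF assms])
  have m: "(\<lambda>x. x /\<^sub>R norm x) \<in> restrict_space lborel B4 \<rightarrow>\<^sub>M (borel :: (real^4) measure)"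
    by (rule measurable_restrict_space1) auto
  have "surf f = (LINT x|density (distr (restrict_space lborel B4) borel (\<lambda>x. x /\<^sub>R norm x)) (\<lambda>_. ennreal 4). ?F x)"
    by (simp add: surf_def set_lebesgue_integral_def sphere_measure_eq_density)
  also have "\<dots> = (LINT x|distr (restrict_space lborel B4) borel (\<lambda>x. x /\<^sub>R norm x). 4 *\<^sub>R ?F x)"
    using F by (intro integral_density) auto
  also have "\<dots> = 4 * (LINT x|restrict_space lborel B4. ?F (x /\<^sub>R norm x))"
    using F by (subst integral_distr[OF m]) auto
  also have "(LINT x|restrict_space lborel B4. ?F (x /\<^sub>R norm x)) = (LINT x:B4|lborel. ?F (x /\<^sub>R norm x))"
    unfolding set_lebesgue_integral_def by (rule integral_restrict_space) auto
  finally show ?thesis by simp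
qed

lemma surf_cong: "(\<And>x. x \<in> S3 \<Longrightarrow> f x = g x) \<Longrightarrow> surf f = surf g"
  unfolding surf_def by (rule set_lebesgue_integral_cong) (auto simp: sets_sphere_measure)

lemma surf_add:
  assumes "continuous_on S3 f" "continuous_on S3 g"
  shows "surf (\<lambda>x. f x + g x) = surf f + surf g" "surf (\<lambda>x. f x - g x) = surf f - surf g"
  using assms unfolding surf_def
  by (auto intro!: set_integral_add set_integral_diff set_integrable_S3)

lemma surf_cmult: "surf (\<lambda>x. c * f x) = c * surf f"
  unfolding surf_def by simp

lemma surf_const: "surf (\<lambda>x. c) = c * omega3"
  unfolding surf_def omega3_def
  using finite_measure.emeasure_finite[OF finite_measure_sphere_measure]
  by (simp add: set_lebesgue_integral_def sets_sphere_measure)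

lemma surf_sum:
  assumes "\<And>k. k \<in> A \<Longrightarrow> continuous_on S3 (f k)"
  shows "surf (\<lambda>x. \<Sum>k\<in>A. f k x) = (\<Sum>k\<in>A. surf (f k))"
  using assms
proof (induction A rule: infinite_finite_induct)
  case (insert k A)
  then show ?case by (simp add: surf_add continuous_on_sum)
qed (use surf_const[of 0] in auto)

lemma surf_mono:
  assumes "continuous_on S3 f" "continuous_on S3 g" "\<And>x. x \<in> S3 \<Longrightarrow> f x \<le> g x"
  shows "surf f \<le> surf g"
  using assms unfolding surf_def by (intro set_integral_mono set_integrable_S3)

text \<open>Difference quotients integrate to zero by translation invariance, and they converge boundedly.\<close>

lemma integral_translation_derivative_eq_0:
  fixes h d :: "real^4 \<Rightarrow> real" and e :: "real^4"
  assumes lip: "\<And>x y. \<bar>h x - h y\<bar> \<le> L * norm (x - y)"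
    and supp: "\<And>x. x \<notin> cball 0 1 \<Longrightarrow> h x = 0"
    and e: "norm e = 1"
    and d: "AE x in lborel. ((\<lambda>t. h (x + t *\<^sub>R e)) has_real_derivative d x) (at 0)"
    and [measurable]: "d \<in> borel_measurable borel"
  shows "(LINT x|lborel. d x) = 0"
proof -
  have "continuous_on UNIV h"
  proof (rule continuous_on_iff[THEN iffD2], intro ballI allI impI)
    fix x and \<epsilon> :: real assume "\<epsilon> > 0"
    show "\<exists>d>0. \<forall>x'\<in>UNIV. dist x' x < d \<longrightarrow> dist (h x') (h x) < \<epsilon>"
    proof (intro exI[of _ "\<epsilon> / (\<bar>L\<bar> + 1)"] conjI ballI impI)
      fix y assume "dist y x < \<epsilon> / (\<bar>L\<bar> + 1)"
      then have "(\<bar>L\<bar> + 1) * norm (y - x) < \<epsilon>"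
        by (simp add: dist_norm pos_less_divide_eq mult.commute)
      moreover have "L * norm (y - x) \<le> (\<bar>L\<bar> + 1) * norm (y - x)"
        by (intro mult_right_mono) auto
      ultimately show "dist (h y) (h x) < \<epsilon>"
        using lip[of y x] by (simp add: dist_real_def)
    qed (use \<open>\<epsilon> > 0\<close> in auto)
  qed
  then have [measurable]: "h \<in> borel_measurable borel" by (rule borel_measurable_continuous_onI)
  have ih: "integrable lborel h"
  proof -
    have "integrable lborel (\<lambda>x. indicator B4 x *\<^sub>R h x)"
      using \<open>continuous_on UNIV h\<close> by (intro borel_integrable_compact) (auto intro: continuous_on_subset)
    also have "(\<lambda>x. indicator B4 x *\<^sub>R h x) = h" using supp by (auto simp: indicator_def fun_eq_iff)
    finally show ?thesis .
  qed
  have shift: "integrable lborel (\<lambda>x. h (c + x)) \<and> (LINT x|lborel. h (c + x)) = (LINT x|lborel. h x)" for c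
  proof -
    have m: "(+) c \<in> lborel \<rightarrow>\<^sub>M (borel :: (real^4) measure)" by simp
    have "integrable (distr lborel borel ((+) c)) h" using ih by (simp add: lborel_distr_plus)
    from integrable_distr[OF m this] integral_distr[OF m, of h] show ?thesis
      by (simp add: lborel_distr_plus)
  qed
  define t where "t n = inverse (real (Suc n))" for n
  have t: "0 < t n" "t n \<le> 1" for n by (auto simp: t_def divide_simps)
  define Q where "Q n x = (h (t n *\<^sub>R e + x) - h x) / t n" for n x
  have Q0: "(LINT x|lborel. Q n x) = 0" for n
    using shift[of "t n *\<^sub>R e"] ih by (simp add: Q_def)
  \<comment> \<open>All shifts have length at most 1, so the quotients vanish off the ball of radius
    2; on it they are bounded by the Lipschitz constant.\<close>
  have bound: "norm (Q n x) \<le> indicator (cball 0 2) x * \<bar>L\<bar>" for n x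
  proof (cases "x \<in> cball 0 2")
    case True
    have "\<bar>h (t n *\<^sub>R e + x) - h x\<bar> \<le> \<bar>L\<bar> * t n"
      using order_trans[OF lip[of "t n *\<^sub>R e + x" x]] t[of n] e mult_right_mono[of L "\<bar>L\<bar>" "t n"] by simp
    with True t[of n] show ?thesis by (simp add: Q_def divide_simps abs_mult)
  next
    case False
    have "norm x \<le> norm (t n *\<^sub>R e + x) + t n"
      using norm_triangle_ineq4[of "t n *\<^sub>R e + x" "t n *\<^sub>R e"] e t[of n] by simp
    with False t[of n] have "h (t n *\<^sub>R e + x) = 0" "h x = 0"
      by (auto intro!: supp simp: mem_cball_0)
    with False show ?thesis by (simp add: Q_def)
  qed
  have t0: "t \<longlonglongrightarrow> 0" unfolding t_def by (rule LIMSEQ_inverse_real_of_nat)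
  have "(\<lambda>n. LINT x|lborel. Q n x) \<longlonglongrightarrow> (LINT x|lborel. d x)"
  proof (rule integral_dominated_convergence[where w = "\<lambda>x. indicator (cball 0 2) x * \<bar>L\<bar>"])
    show "AE x in lborel. (\<lambda>n. Q n x) \<longlonglongrightarrow> d x"
      using d
    proof eventually_elim
      case (elim x)
      then have "((\<lambda>s. (h (x + s *\<^sub>R e) - h x) / s) \<longlongrightarrow> d x) (at 0)"
        by (simp add: DERIV_def)
      moreover have "filterlim t (at 0) sequentially"
        using t0 t(1) by (auto simp: filterlim_at less_le)
      ultimately have "(\<lambda>n. (h (x + t n *\<^sub>R e) - h x) / t n) \<longlonglongrightarrow> d x"
        by (rule filterlim_compose)
      then show ?case by (simp add: Q_def add.commute)
    qed
    show "integrable lborel (\<lambda>x::real^4. indicator (cball 0 2) x * \<bar>L\<bar> :: real)"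
      using borel_integrable_compact[of "cball (0::real^4) 2" "\<lambda>_. \<bar>L\<bar>"]
      unfolding real_scaleR_def by simp
    show "AE x in lborel. norm (Q n x) \<le> indicator (cball 0 2) x * \<bar>L\<bar>" for n
      using bound by simp
  qed (auto simp: Q_def)
  then show ?thesis using LIMSEQ_unique[OF _ tendsto_const[of 0]] by (simp add: Q0)
qed

text \<open>Dilation by q multiplies Lebesgue measure by q^4 and does not change a function constant
  along rays. Subtracting from the unit ball gives the integral over a thin shell.\<close>

lemma set_integral_scaleR_cball:
  fixes g :: "real^4 \<Rightarrow> real"
  assumes q: "q > 0" and g: "\<And>x. g (q *\<^sub>R x) = g x" and [measurable]: "g \<in> borel_measurable borel"
  shows "(LINT x:cball 0 q|lborel. g x) = q^4 * (LINT x:cball 0 1|lborel. g x)"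
proof -
  let ?F = "\<lambda>x. indicator (cball 0 q) x *\<^sub>R g x"
  have "(LINT x|lborel. ?F x)
      = (LINT x|density (distr lborel borel (\<lambda>x. 0 + q *\<^sub>R x)) (\<lambda>_. ennreal (q^4)). ?F x)"
    using q by (subst lborel_affine[of q 0]) (auto simp: abs_of_pos)
  also have "\<dots> = (LINT x|distr lborel borel (\<lambda>x::real^4. 0 + q *\<^sub>R x). q^4 *\<^sub>R ?F x)"
    using q by (intro integral_density) auto
  also have "\<dots> = (LINT x|lborel. q^4 *\<^sub>R ?F (0 + q *\<^sub>R x))"
    by (subst integral_distr) auto
  also have "\<dots> = q^4 * (LINT x|lborel. indicator (cball 0 1) x *\<^sub>R g x)"
    using q by (simp add: g indicator_def mem_cball_0)
  finally show ?thesis by (simp add: set_lebesgue_integral_def)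
qed

lemma smooth_bounded:
  assumes "f \<in> smooth_B4" obtains M where "M > 0" "\<And>x. x \<in> B4 \<Longrightarrow> \<bar>f x\<bar> \<le> M"
proof -
  have "compact (f ` B4)" using assms by (intro compact_continuous_image) auto
  then obtain M where "\<And>x. x \<in> B4 \<Longrightarrow> \<bar>f x\<bar> \<le> M"
    by (meson bounded_real compact_imp_bounded imageI)
  then show ?thesis by (intro that[of "max M 1"]) (auto simp: le_max_iff_disj)
qed

lemma smooth_lipschitz:
  assumes f: "f \<in> smooth_B4"
  obtains L where "L > 0" "\<And>x y. x \<in> B4 \<Longrightarrow> y \<in> B4 \<Longrightarrow> \<bar>f x - f y\<bar> \<le> L * norm (x - y)"
proof -
  have "\<exists>M. M > 0 \<and> (\<forall>x\<in>B4. \<bar>pd k f x\<bar> \<le> M)" for k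
  proof -
    obtain M where "M > 0" "\<And>x. x \<in> B4 \<Longrightarrow> \<bar>pd k f x\<bar> \<le> M"
      by (rule smooth_bounded[OF smooth_pd[OF f, of k]]) blast
    then show ?thesis by blast
  qed
  then obtain M where "\<forall>k. M k > 0 \<and> (\<forall>x\<in>B4. \<bar>pd k f x\<bar> \<le> M k)"
    using choice[of "\<lambda>k M. M > 0 \<and> (\<forall>x\<in>B4. \<bar>pd k f x\<bar> \<le> M)"] by blast
  then have M: "\<And>k. M k > 0" "\<And>k x. x \<in> B4 \<Longrightarrow> \<bar>pd k f x\<bar> \<le> M k"
    by auto
  define L where "L = (\<Sum>k\<in>UNIV. M k)"
  have "L > 0" unfolding L_def by (intro sum_pos) (auto simp: M)
  moreover have "\<bar>f x - f y\<bar> \<le> L * norm (x - y)" if "x \<in> B4" "y \<in> B4" for x y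
  proof -
    have "norm (f x - f y) \<le> L * norm (x - y)"
    proof (rule differentiable_bound[OF convex_cball])
      show "(f has_derivative (\<lambda>h. \<Sum>i\<in>UNIV. h $ i * pd i f z)) (at z within B4)" if "z \<in> B4" for z
        using f that by (intro has_derivative_pd) auto
      show "onorm (\<lambda>h. \<Sum>i\<in>UNIV. h $ i * pd i f z) \<le> L" if z: "z \<in> B4" for z
      proof (rule onorm_le)
        fix h :: "real^4"
        have "norm (h $ i * pd i f z) \<le> norm h * M i" for i
          unfolding real_norm_def abs_mult
          by (rule mult_mono) (auto simp: component_le_norm_cart M(2) z)
        then have "norm (\<Sum>i\<in>UNIV. h $ i * pd i f z) \<le> (\<Sum>i\<in>UNIV. norm h * M i)"
          by (rule sum_norm_le)
        then show "norm (\<Sum>i\<in>UNIV. h $ i * pd i f z) \<le> L * norm h"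
          by (simp add: L_def sum_distrib_left mult.commute)
      qed
    qed (use that in auto)
    then show ?thesis by simp
  qed
  ultimately show ?thesis by (rule that)
qed

lemma DERIV_norm_along:
  fixes x e :: "real^4"
  assumes "x \<noteq> 0"
  shows "((\<lambda>t. norm (x + t *\<^sub>R e)) has_real_derivative (x \<bullet> e) / norm x) (at 0)"
proof -
  have "((\<lambda>t. sqrt (x \<bullet> x + 2 * t * (x \<bullet> e) + t\<^sup>2 * (e \<bullet> e))) has_real_derivative
      inverse (sqrt (x \<bullet> x)) / 2 * (2 * (x \<bullet> e))) (at 0)"
    using assms inner_ge_zero[of x] by (auto intro!: derivative_eq_intros simp: not_less[symmetric] simp del: inner_ge_zero)
  moreover have "norm (x + t *\<^sub>R e) = sqrt (x \<bullet> x + 2 * t * (x \<bullet> e) + t\<^sup>2 * (e \<bullet> e))" for t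
    by (simp add: norm_eq_sqrt_inner inner_simps inner_commute power2_eq_square algebra_simps)
  ultimately show ?thesis by (simp add: norm_eq_sqrt_inner field_simps)
qed

text \<open>
  The cutoff equal to 1 on the ball of radius q and decreasing linearly to 0 at the unit sphere
  turns the boundary integral into an average over a thin shell.
\<close>

definition cutoff :: "real \<Rightarrow> real^4 \<Rightarrow> real" where
  "cutoff q x = min 1 ((1 - norm x) / (1 - q))"

text \<open>The product of the cutoff with f, extended by 0, is Lipschitz on the whole space because
  the cutoff vanishes on the sphere, so its derivative has integral 0. The gradient of the cutoff is
  0 inside radius q and \<open>- x / norm x / (1 - q)\<close> on the shell, which produces the
  right-hand side.\<close>

lemma shell_identity:
  fixes q :: real and i :: 4
  assumes f: "f \<in> smooth_B4" and q: "0 < q" "q < 1"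
  shows "(LINT x:B4|lborel. cutoff q x * pd i f x) =
    (LINT x:B4|lborel. indicator {x. q < norm x} x * (x $ i / norm x * f x)) / (1 - q)"
proof -
  obtain L where L: "L > 0" "\<And>x y. x \<in> B4 \<Longrightarrow> y \<in> B4 \<Longrightarrow> \<bar>f x - f y\<bar> \<le> L * norm (x - y)"
    using smooth_lipschitz[OF f] by metis
  obtain M where M: "M > 0" "\<And>x. x \<in> B4 \<Longrightarrow> \<bar>f x\<bar> \<le> M"
    using smooth_bounded[OF f] by metis
  define h where "h x = indicator B4 x * (cutoff q x * f x)" for x
  define d where "d x = indicator B4 x * (cutoff q x * pd i f x) -
    indicator B4 x * (indicator {x. q < norm x} x * (x $ i / norm x * f x)) / (1 - q)" for x
  have c01: "0 \<le> cutoff q x" "cutoff q x \<le> 1" if "x \<in> B4" for x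
    using that q by (auto simp: cutoff_def mem_cball_0)
  have clip: "\<bar>cutoff q x - cutoff q y\<bar> \<le> norm (x - y) / (1 - q)" for x y
  proof -
    have "\<bar>cutoff q x - cutoff q y\<bar> \<le> \<bar>(1 - norm x) / (1 - q) - (1 - norm y) / (1 - q)\<bar>"
      by (simp add: cutoff_def min_def)
    also have "\<dots> = \<bar>norm x - norm y\<bar> / (1 - q)"
      using q by (simp add: diff_divide_distrib[symmetric] abs_divide abs_minus_commute)
    also have "\<dots> \<le> norm (x - y) / (1 - q)"
      using q by (intro divide_right_mono norm_triangle_ineq3) auto
    finally show ?thesis .
  qed
  have one_side: "\<bar>h x - h y\<bar> \<le> (L + M / (1 - q)) * norm (x - y)" if x: "x \<in> B4" for x y
  proof (cases "y \<in> B4")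
    case True
    have "h x - h y = cutoff q x * (f x - f y) + f y * (cutoff q x - cutoff q y)"
      using x True by (simp add: h_def algebra_simps)
    then have "\<bar>h x - h y\<bar> \<le> \<bar>cutoff q x\<bar> * \<bar>f x - f y\<bar> + \<bar>f y\<bar> * \<bar>cutoff q x - cutoff q y\<bar>"
      by (metis abs_mult abs_triangle_ineq)
    also have "\<dots> \<le> 1 * (L * norm (x - y)) + M * (norm (x - y) / (1 - q))"
      using c01[OF x] L(2)[OF x True] M(2)[OF True] clip[of x y] M(1)
      by (intro add_mono mult_mono) auto
    finally show ?thesis by (simp add: algebra_simps)
  next
    case False
    \<comment> \<open>Outside the ball \<open>h y = 0\<close>, and \<open>1 - norm x\<close> is at
      most the distance from x to y.\<close>
    have "\<bar>h x - h y\<bar> = cutoff q x * \<bar>f x\<bar>"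
      using x False c01[OF x] by (simp add: h_def abs_mult)
    also have "\<dots> \<le> (1 - norm x) / (1 - q) * M"
      using c01[OF x] M(2)[OF x] x q by (intro mult_mono) (auto simp: cutoff_def mem_cball_0)
    also have "\<dots> \<le> norm (x - y) / (1 - q) * M"
      using False M(1) q norm_triangle_ineq3[of x y]
      by (intro mult_right_mono divide_right_mono) (auto simp: mem_cball_0)
    also have "\<dots> \<le> (L + M / (1 - q)) * norm (x - y)"
      using L(1) by (simp add: algebra_simps)
    finally show ?thesis .
  qed
  have lip: "\<bar>h x - h y\<bar> \<le> (L + M / (1 - q)) * norm (x - y)" for x y
  proof (cases "x \<in> B4 \<or> y \<in> B4")
    case True
    then show ?thesis using one_side[of x y] one_side[of y x] by (auto simp: norm_minus_commute abs_minus_commute)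
  next
    case False
    then show ?thesis using L(1) M(1) q by (simp add: h_def)
  qed
  have meas: "(\<lambda>x. indicator B4 x * g x) \<in> borel_measurable borel" if "g \<in> smooth_B4" for g
    using borel_measurable_continuous_on_indicator[OF _ smooth_continuous_on[OF that]] by simp
  have [measurable]: "(\<lambda>x. indicator B4 x * f x) \<in> borel_measurable borel"
    "(\<lambda>x. indicator B4 x * pd i f x) \<in> borel_measurable borel" "cutoff q \<in> borel_measurable borel"
    using f by (auto intro!: meas simp: cutoff_def[abs_def])
  have d_eq: "d x = cutoff q x * (indicator B4 x * pd i f x) -
    indicator {x. q < norm x} x * (x $ i / norm x * (indicator B4 x * f x)) / (1 - q)" for x
    by (simp add: d_def)
  have [measurable]: "d \<in> borel_measurable borel" unfolding d_eq[abs_def] by measurable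
  have der: "((\<lambda>t. h (x + t *\<^sub>R axis i 1)) has_real_derivative d x) (at 0)"
    if x: "norm x \<noteq> 1" "norm x \<noteq> q" for x
  proof -
    let ?p = "\<lambda>t. x + t *\<^sub>R (axis i 1 :: real^4)"
    have "isCont (\<lambda>t. norm (?p t)) 0" by (intro continuous_intros)
    then have p: "((\<lambda>t. norm (?p t)) \<longlongrightarrow> norm (?p 0)) (nhds 0)"
      unfolding isCont_def by (rule tendsto_at_iff_tendsto_nhds[of "\<lambda>t. norm (?p t)" 0, THEN iffD1])
    have gt: "eventually (\<lambda>t. norm (?p t) > c) (nhds 0)" if "norm x > c" for c
      using order_tendstoD(1)[OF p] that by simp
    have lt: "eventually (\<lambda>t. norm (?p t) < c) (nhds 0)" if "norm x < c" for c
      using order_tendstoD(2)[OF p] that by simp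
    have Df: "((\<lambda>t. f (?p t)) has_real_derivative pd i f x) (at 0)" if "norm x < 1"
      using DERIV_along_axis[OF f, of x 0 i] that by simp
    consider "norm x > 1" | "norm x < q" | "q < norm x" "norm x < 1" using x by linarith
    then show ?thesis
    proof cases
      case 1
      have "eventually (\<lambda>t. h (?p t) = 0) (nhds 0)"
        using gt[OF 1] by eventually_elim (simp add: h_def mem_cball_0)
      then have "((\<lambda>t. h (?p t)) has_real_derivative 0) (at 0)"
        by (subst DERIV_cong_ev[OF refl _ refl]) auto
      then show ?thesis using 1 by (simp add: d_def mem_cball_0)
    next
      case 2
      have "eventually (\<lambda>t. h (?p t) = f (?p t)) (nhds 0)"
        using lt[OF 2] by eventually_elim (use q in \<open>simp add: h_def mem_cball_0 cutoff_def divide_simps min_def\<close>)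
      then have "((\<lambda>t. h (?p t)) has_real_derivative pd i f x) (at 0)"
        using 2 q Df by (subst DERIV_cong_ev[OF refl _ refl]) auto
      then show ?thesis using 2 q by (simp add: d_def mem_cball_0 cutoff_def divide_simps min_def)
    next
      case 3
      then have "x \<noteq> 0" using q by auto
      have "eventually (\<lambda>t. h (?p t) = (1 - norm (?p t)) / (1 - q) * f (?p t)) (nhds 0)"
        using lt[OF 3(2)] gt[OF 3(1)]
        by eventually_elim (use q in \<open>simp add: h_def mem_cball_0 cutoff_def divide_simps min_def\<close>)
      moreover have "((\<lambda>t. (1 - norm (?p t)) / (1 - q) * f (?p t)) has_real_derivative
          (- (x $ i / norm x) / (1 - q)) * f (?p 0) + pd i f x * ((1 - norm (?p 0)) / (1 - q))) (at 0)"
        using DERIV_norm_along[OF \<open>x \<noteq> 0\<close>, of "axis i 1"] Df[OF 3(2)]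
        by (intro DERIV_mult DERIV_cdivide) (auto intro!: derivative_eq_intros simp: inner_axis)
      ultimately have "((\<lambda>t. h (?p t)) has_real_derivative
          (- (x $ i / norm x) / (1 - q)) * f x + pd i f x * ((1 - norm x) / (1 - q))) (at 0)"
        by (subst DERIV_cong_ev[OF refl _ refl]) auto
      moreover have "d x = (- (x $ i / norm x) / (1 - q)) * f x + pd i f x * ((1 - norm x) / (1 - q))"
        using 3 q by (simp add: d_def mem_cball_0 cutoff_def divide_simps min_def)
      ultimately show ?thesis by simp
    qed
  qed
  \<comment> \<open>The derivative has been established off the spheres of radius q and 1, and these
    are null sets.\<close>
  have "sphere 0 r \<in> null_sets (lborel :: (real^4) measure)" for r
    using negligible_sphere[of "0::real^4" r]
    by (auto simp: null_sets_completion_iff negligible_iff_null_sets negligible_convex_frontier)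
  then have "AE x in lborel. (x::real^4) \<notin> sphere 0 1" "AE x in lborel. (x::real^4) \<notin> sphere 0 q"
    using AE_not_in by blast+
  then have "AE x in lborel. ((\<lambda>t. h (x + t *\<^sub>R axis i 1)) has_real_derivative d x) (at 0)"
    by eventually_elim (auto intro: der)
  then have d0: "(LINT x|lborel. d x) = 0"
    by (intro integral_translation_derivative_eq_0[OF lip, where e = "axis i 1"]) (auto simp: h_def)
  have "integrable lborel (\<lambda>x. indicator B4 x * (cutoff q x * pd i f x))"
  proof -
    have "continuous_on B4 (\<lambda>x. cutoff q x * pd i f x)"
      unfolding cutoff_def using q
      by (intro continuous_intros smooth_continuous_on smooth_pd f) auto
    then show ?thesis
      using set_integrable_B4[of "\<lambda>x. cutoff q x * pd i f x"]
      by (simp add: set_integrable_def)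
  qed
  moreover have "integrable lborel (\<lambda>x. indicator B4 x * (indicator {x. q < norm x} x * (x $ i / norm x * f x)))"
  proof (rule Bochner_Integration.integrable_bound)
    show "integrable lborel (\<lambda>x. indicator B4 x * M)"
      using borel_integrable_compact[of B4 "\<lambda>_. M"] unfolding real_scaleR_def by simp
    have "(\<lambda>x. indicator {x. q < norm x} x * (x $ i / norm x * (indicator B4 x * f x))) \<in> borel_measurable borel"
      by measurable
    then show "(\<lambda>x. indicator B4 x * (indicator {x. q < norm x} x * (x $ i / norm x * f x))) \<in> borel_measurable lborel"
      by (simp add: mult_ac)
    have "\<bar>x $ i / norm x * f x\<bar> \<le> 1 * M" if "x \<in> B4" for x
      unfolding abs_mult using M(2)[OF that] component_le_norm_cart[of x i]
      by (intro mult_mono) (auto simp: divide_le_eq_1)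
    then show "AE x in lborel. norm (indicator B4 x * (indicator {x. q < norm x} x * (x $ i / norm x * f x)))
        \<le> norm (indicator B4 x * M)"
      using M(1) by (intro AE_I2) (auto simp: indicator_def)
  qed
  ultimately have "(LINT x|lborel. d x) = (LINT x|lborel. indicator B4 x * (cutoff q x * pd i f x)) -
    (LINT x|lborel. indicator B4 x * (indicator {x. q < norm x} x * (x $ i / norm x * f x)) / (1 - q))"
    unfolding d_def by (intro Bochner_Integration.integral_diff integrable_divide_zero impI)
  moreover have "(LINT x|lborel. indicator B4 x * (indicator {x. q < norm x} x * (x $ i / norm x * f x)) / (1 - q))
    = (LINT x|lborel. indicator B4 x * (indicator {x. q < norm x} x * (x $ i / norm x * f x))) / (1 - q)"
    by (rule integral_divide_zero)
  ultimately show ?thesis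
    using d0 unfolding set_lebesgue_integral_def real_scaleR_def by linarith
qed

definition vol :: "(real^4 \<Rightarrow> real) \<Rightarrow> real" where
  "vol f = (LINT x:B4|lborel. f x)"

text \<open>On the shell, f is replaced by its value at the radial projection, and in the interior
  the cutoff by 1, with a final error of order \<open>1 - q\<close>. After this the shell integral
  is exactly \<open>(1 - q^4) * I\<close>, with \<open>I\<close> the integral over the cone.
  Dividing by \<open>1 - q\<close> leaves \<open>1 + q + q^2 + q^3\<close>, whose limit 4 is the
  factor between \<open>I\<close> and \<open>surf\<close>.\<close>

theorem divergence_theorem_B4:
  assumes f: "f \<in> smooth_B4"
  shows "vol (pd i f) = surf (\<lambda>x. x $ i * f x)"
proof -
  define T where "T x = x /\<^sub>R norm x" for x :: "real^4"
  define F where "F x = indicator S3 x * (x $ i * f x)" for x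
  define g where "g x = F (T x)" for x
  obtain L where L: "L > 0" "\<And>x y. x \<in> B4 \<Longrightarrow> y \<in> B4 \<Longrightarrow> \<bar>f x - f y\<bar> \<le> L * norm (x - y)"
    by (rule smooth_lipschitz[OF f]) blast
  obtain M where M: "M > 0" "\<And>x. x \<in> B4 \<Longrightarrow> \<bar>f x\<bar> \<le> M"
    by (rule smooth_bounded[OF f]) blast
  obtain N where N: "N > 0" "\<And>x. x \<in> B4 \<Longrightarrow> \<bar>pd i f x\<bar> \<le> N"
    by (rule smooth_bounded[OF smooth_pd[OF f, of i]]) blast
  have S3B4: "x \<in> S3 \<Longrightarrow> x \<in> B4" for x by (simp add: mem_cball_0)
  have contF: "continuous_on S3 (\<lambda>x. x $ i * f x)"
    by (intro continuous_intros continuous_on_subset[OF smooth_continuous_on[OF f]] subsetI S3B4)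
  have [measurable]: "F \<in> borel_measurable borel"
    using set_borel_measurable_S3[OF contF] by (simp add: F_def[abs_def])
  have [measurable]: "T \<in> borel_measurable borel" by (simp add: T_def[abs_def])
  have [measurable]: "g \<in> borel_measurable borel" unfolding g_def[abs_def] by measurable
  define I where "I = vol g"
  have surf_I: "surf (\<lambda>x. x $ i * f x) = 4 * I"
    using surf_eq_cone_integral[OF contF] by (simp add: I_def vol_def g_def F_def T_def)
  have TS: "T x \<in> S3" if "x \<noteq> 0" for x using that by (simp add: T_def)
  have F_bound: "\<bar>F x\<bar> \<le> M" for x
  proof (cases "x \<in> S3")
    case True
    have "\<bar>x $ i * f x\<bar> \<le> 1 * M"
      unfolding abs_mult using M(2)[OF S3B4[OF True]] component_le_norm_cart[of x i] True
      by (intro mult_mono) auto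
    with True show ?thesis by (simp add: F_def)
  qed (use M in \<open>simp add: F_def\<close>)
  have iM: "integrable lborel (\<lambda>x::real^4. indicator B4 x * c)" for c :: real
    using borel_integrable_compact[of B4 "\<lambda>_. c"] unfolding real_scaleR_def by simp
  have int: "integrable lborel (\<lambda>x::real^4. indicator B4 x * k x)"
    if "k \<in> borel_measurable borel" "\<And>x. \<bar>k x\<bar> \<le> c" for k :: "real^4 \<Rightarrow> real" and c
  proof (rule Bochner_Integration.integrable_bound[OF iM[of c]])
    show "AE x in lborel. norm (indicator B4 x * k x) \<le> norm (indicator B4 x * c)"
      using that(2) by (intro AE_I2) (auto simp: indicator_def intro: order_trans[OF that(2) abs_ge_self])
  qed (use that in auto)
  have shell: "vol (\<lambda>x. indicator {x. q < norm x} x * k x) = (1 - q^4) * vol k"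
    if q: "0 < q" "q < 1" and k: "k \<in> borel_measurable borel" "\<And>x. \<bar>k x\<bar> \<le> c"
      and hom: "\<And>x. k (q *\<^sub>R x) = k x" for q c and k :: "real^4 \<Rightarrow> real"
  proof -
    have "vol k - vol (\<lambda>x. indicator {x. q < norm x} x * k x) =
      vol (\<lambda>x. k x - indicator {x. q < norm x} x * k x)"
      unfolding vol_def set_lebesgue_integral_def real_scaleR_def right_diff_distrib
      using k int[OF k]
      by (intro Bochner_Integration.integral_diff[symmetric] int[where c = c])
        (auto simp: indicator_def intro: order_trans[OF abs_ge_zero k(2)])
    also have "\<dots> = (LINT x:cball 0 q|lborel. k x)"
      unfolding vol_def set_lebesgue_integral_def
      using q by (intro Bochner_Integration.integral_cong) (auto simp: indicator_def mem_cball_0)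
    also have "\<dots> = q^4 * vol k"
      unfolding vol_def by (rule set_integral_scaleR_cball) (use q k hom in auto)
    finally show ?thesis by (simp add: algebra_simps)
  qed
  have hom_g: "g (q *\<^sub>R x) = g x" if "0 < q" for q x
  proof -
    have e: "inverse q * inverse (norm x) * q = inverse (norm x)" using that by simp
    have "T (q *\<^sub>R x) = (inverse q * inverse (norm x) * q) *\<^sub>R x" using that by (simp add: T_def)
    then have "T (q *\<^sub>R x) = T x" unfolding e by (simp add: T_def)
    then show ?thesis by (simp add: g_def)
  qed
  define A where "A = vol (pd i f)"
  define W where "W = vol (\<lambda>_. 1)"
  \<comment> \<open>\<open>N\<close> measures the error of putting 1 for the cutoff and
    \<open>L\<close> that of the radial projection; \<open>W * (1 - q^4)\<close> is the volume of
    the shell.\<close>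
  have main: "\<bar>A - (1 + q + q^2 + q^3) * I\<bar> \<le> (N + L) * W * (1 - q^4)" if q: "0 < q" "q < 1" for q
  proof -
    let ?s = "\<lambda>x::real^4. indicator {x. q < norm x} x :: real"
    let ?C = "vol (\<lambda>x. cutoff q x * pd i f x)" and ?D = "vol (\<lambda>x. ?s x * (x $ i / norm x * f x))"
    have CD: "?C = ?D / (1 - q)" using shell_identity[OF f q] by (simp add: vol_def)
    have Jq: "vol (\<lambda>x. ?s x * g x) = (1 - q^4) * I"
      unfolding I_def using q by (intro shell hom_g) (auto simp: g_def intro!: F_bound)
    have Wq: "vol (\<lambda>x. ?s x * 1) = (1 - q^4) * W"
      unfolding W_def using q by (intro shell[where c = 1]) auto
    have meas: "(\<lambda>x. indicator B4 x * h x) \<in> borel_measurable borel" if "h \<in> smooth_B4" for h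
      using borel_measurable_continuous_on_indicator[OF _ smooth_continuous_on[OF that]] by simp
    have [measurable]: "(\<lambda>x. indicator B4 x * f x) \<in> borel_measurable borel"
      "(\<lambda>x. indicator B4 x * pd i f x) \<in> borel_measurable borel" "cutoff q \<in> borel_measurable borel"
      using f by (auto intro!: meas simp: cutoff_def[abs_def])
    have bnd: "\<bar>vol h\<bar> \<le> c * ((1 - q^4) * W) \<and> integrable lborel (\<lambda>x. indicator B4 x * h x)"
      if h: "(\<lambda>x. indicator B4 x * h x) \<in> borel_measurable borel"
        "\<And>x. x \<in> B4 \<Longrightarrow> \<bar>h x\<bar> \<le> c * ?s x" for h c
    proof
      have ics: "integrable lborel (\<lambda>x. indicator B4 x * (c * ?s x))"
        by (rule int[where c = "\<bar>c\<bar>"]) (auto simp: indicator_def)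
      show ih: "integrable lborel (\<lambda>x. indicator B4 x * h x)"
      proof (rule Bochner_Integration.integrable_bound[OF ics])
        have "norm (indicator B4 x * h x) \<le> norm (indicator B4 x * (c * ?s x))" for x
          using h(2)[of x] abs_ge_self[of "c * ?s x"] by (cases "x \<in> B4") simp_all
        then show "AE x in lborel. norm (indicator B4 x * h x) \<le> norm (indicator B4 x * (c * ?s x))"
          by simp
      qed (use h in simp)
      have "\<bar>vol h\<bar> \<le> (LINT x|lborel. \<bar>indicator B4 x * h x\<bar>)"
        unfolding vol_def set_lebesgue_integral_def real_scaleR_def by (rule integral_abs_bound)
      also have "\<dots> \<le> (LINT x|lborel. indicator B4 x * (c * ?s x))"
      proof (rule integral_mono[OF integrable_abs[OF ih] ics])
        show "\<bar>indicator B4 x * h x\<bar> \<le> indicator B4 x * (c * ?s x)" for x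
          using h(2)[of x] by (cases "x \<in> B4") simp_all
      qed
      also have "\<dots> = c * vol (\<lambda>x. ?s x * 1)"
        by (simp add: vol_def set_lebesgue_integral_def mult.left_commute)
      finally show "\<bar>vol h\<bar> \<le> c * ((1 - q^4) * W)" using Wq by simp
    qed
    have 1: "\<bar>vol (\<lambda>x. (1 - cutoff q x) * pd i f x)\<bar> \<le> N * ((1 - q^4) * W)"
      "integrable lborel (\<lambda>x. indicator B4 x * ((1 - cutoff q x) * pd i f x))"
    proof -
      have "\<bar>(1 - cutoff q x) * pd i f x\<bar> \<le> N * ?s x" if x: "x \<in> B4" for x
      proof (cases "q < norm x")
        case True
        have "\<bar>(1 - cutoff q x) * pd i f x\<bar> \<le> 1 * N"
          unfolding abs_mult using x q N(2)[OF x] True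
          by (intro mult_mono) (auto simp: cutoff_def mem_cball_0 min_def divide_simps)
        with True show ?thesis by simp
      next
        case False
        then have "cutoff q x = 1" using q by (simp add: cutoff_def min_def divide_simps)
        with N(1) show ?thesis by simp
      qed
      moreover have "(\<lambda>x. (1 - cutoff q x) * (indicator B4 x * pd i f x)) \<in> borel_measurable borel"
        by measurable
      ultimately show "\<bar>vol (\<lambda>x. (1 - cutoff q x) * pd i f x)\<bar> \<le> N * ((1 - q^4) * W)"
        "integrable lborel (\<lambda>x. indicator B4 x * ((1 - cutoff q x) * pd i f x))"
        using bnd[of "\<lambda>x. (1 - cutoff q x) * pd i f x" N] by (auto simp: mult_ac)
    qed
    have 2: "\<bar>vol (\<lambda>x. ?s x * (x $ i / norm x * f x - g x))\<bar> \<le> (L * (1 - q)) * ((1 - q^4) * W)"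
      "integrable lborel (\<lambda>x. indicator B4 x * (?s x * (x $ i / norm x * f x - g x)))"
    proof -
      have "\<bar>?s x * (x $ i / norm x * f x - g x)\<bar> \<le> (L * (1 - q)) * ?s x" if x: "x \<in> B4" for x
      proof (cases "q < norm x")
        case True
        then have nz: "x \<noteq> 0" using q by auto
        have "x - T x = (1 - inverse (norm x)) *\<^sub>R x" by (simp add: T_def algebra_simps)
        then have "norm (x - T x) = \<bar>1 - inverse (norm x)\<bar> * norm x" by simp
        also have "\<dots> = \<bar>(1 - inverse (norm x)) * norm x\<bar>" by (simp add: abs_mult)
        also have "(1 - inverse (norm x)) * norm x = norm x - 1" using nz by (simp add: algebra_simps)
        finally have nT: "norm (x - T x) \<le> 1 - q" using x True by (simp add: mem_cball_0)
        have "x $ i / norm x * f x - g x = x $ i / norm x * (f x - f (T x))"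
          using TS[OF nz] nz by (simp add: g_def F_def T_def field_simps)
        then have "\<bar>x $ i / norm x * f x - g x\<bar> = \<bar>x $ i / norm x\<bar> * \<bar>f x - f (T x)\<bar>"
          by (simp add: abs_mult)
        also have "\<dots> \<le> 1 * (L * norm (x - T x))"
          using component_le_norm_cart[of x i] L(2)[OF x S3B4[OF TS[OF nz]]] nz
          by (intro mult_mono) (auto simp: divide_le_eq_1)
        also have "\<dots> \<le> L * (1 - q)" using nT L(1) by simp
        finally show ?thesis using True by simp
      qed simp
      moreover have "(\<lambda>x. ?s x * (x $ i / norm x * (indicator B4 x * f x) - indicator B4 x * g x))
          \<in> borel_measurable borel"
        by measurable
      ultimately show "\<bar>vol (\<lambda>x. ?s x * (x $ i / norm x * f x - g x))\<bar> \<le> (L * (1 - q)) * ((1 - q^4) * W)"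
        "integrable lborel (\<lambda>x. indicator B4 x * (?s x * (x $ i / norm x * f x - g x)))"
        using bnd[of "\<lambda>x. ?s x * (x $ i / norm x * f x - g x)" "L * (1 - q)"]
        by (auto simp: algebra_simps)
    qed
    have iA: "integrable lborel (\<lambda>x. indicator B4 x * pd i f x)"
      using set_integrable_B4[OF smooth_continuous_on[OF smooth_pd[OF f]]]
      by (simp add: set_integrable_def)
    have ig: "integrable lborel (\<lambda>x. indicator B4 x * (?s x * g x))"
      by (rule int[where c = M]) (use M(1) F_bound in \<open>auto simp: indicator_def g_def\<close>)
    have e1: "?C = A - vol (\<lambda>x. (1 - cutoff q x) * pd i f x)"
    proof -
      have "A - vol (\<lambda>x. (1 - cutoff q x) * pd i f x) =
        (LINT x|lborel. indicator B4 x * pd i f x - indicator B4 x * ((1 - cutoff q x) * pd i f x))"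
        unfolding A_def vol_def set_lebesgue_integral_def real_scaleR_def
        by (rule Bochner_Integration.integral_diff[symmetric, OF iA 1(2)])
      then show ?thesis by (simp add: vol_def set_lebesgue_integral_def algebra_simps)
    qed
    have e2: "?D = (1 - q^4) * I + vol (\<lambda>x. ?s x * (x $ i / norm x * f x - g x))"
    proof -
      have "(1 - q^4) * I + vol (\<lambda>x. ?s x * (x $ i / norm x * f x - g x)) =
        (LINT x|lborel. indicator B4 x * (?s x * g x) + indicator B4 x * (?s x * (x $ i / norm x * f x - g x)))"
        unfolding Jq[symmetric] vol_def set_lebesgue_integral_def real_scaleR_def
        by (rule Bochner_Integration.integral_add[symmetric, OF ig 2(2)])
      then show ?thesis by (simp add: vol_def set_lebesgue_integral_def algebra_simps)
    qed
    define a where "a = vol (\<lambda>x. (1 - cutoff q x) * pd i f x)"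
    define b where "b = vol (\<lambda>x. ?s x * (x $ i / norm x * f x - g x))"
    define p where "p = 1 + q + q^2 + q^3"
    have p: "1 - q^4 = (1 - q) * p" by (simp add: p_def algebra_simps power2_eq_square power3_eq_cube power4_eq_xxxx)
    define c where "c = b / (1 - q)"
    have "A - a = ((1 - q) * p * I + b) / (1 - q)"
      using CD unfolding e1 e2 a_def[symmetric] b_def[symmetric] p .
    also have "\<dots> = p * I + c" using q by (simp add: add_divide_distrib c_def)
    finally have "A - p * I = a + c" by simp
    moreover have "\<bar>c\<bar> \<le> L * ((1 - q^4) * W)"
      using 2(1) q unfolding b_def[symmetric] c_def by (simp add: abs_divide pos_divide_le_eq mult_ac)
    moreover have "\<bar>a\<bar> \<le> N * ((1 - q^4) * W)" using 1(1) unfolding a_def .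
    moreover have "(N + L) * W * (1 - q^4) = N * ((1 - q^4) * W) + L * ((1 - q^4) * W)"
      by (simp add: algebra_simps)
    ultimately show ?thesis unfolding p_def[symmetric] by linarith
  qed
  have "\<bar>A - (1 + 1 + 1^2 + 1^3) * I\<bar> \<le> (N + L) * W * (1 - 1^4)"
  proof (rule tendsto_le[of "at_left (1::real)"])
    show "((\<lambda>q. (N + L) * W * (1 - q^4)) \<longlongrightarrow> (N + L) * W * (1 - 1^4)) (at_left 1)"
      by (intro tendsto_intros)
    show "((\<lambda>q. \<bar>A - (1 + q + q^2 + q^3) * I\<bar>) \<longlongrightarrow> \<bar>A - (1 + 1 + 1^2 + 1^3) * I\<bar>) (at_left 1)"
      by (intro tendsto_intros)
    show "\<forall>\<^sub>F q in at_left 1. \<bar>A - (1 + q + q^2 + q^3) * I\<bar> \<le> (N + L) * W * (1 - q^4)"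
      using main by (auto simp: eventually_at_left_field intro!: exI[of _ 0])
  qed simp
  then show ?thesis unfolding surf_I A_def by simp
qed


section \<open>Integration by parts on the sphere\<close>

definition gdot :: "(real^4 \<Rightarrow> real) \<Rightarrow> (real^4 \<Rightarrow> real) \<Rightarrow> real^4 \<Rightarrow> real" where
  "gdot u v x = (\<Sum>i\<in>UNIV. pd i u x * pd i v x)"

definition lap :: "(real^4 \<Rightarrow> real) \<Rightarrow> real^4 \<Rightarrow> real" where
  "lap u x = (\<Sum>i\<in>UNIV. pd i (pd i u) x)"

definition hess :: "(real^4 \<Rightarrow> real) \<Rightarrow> (real^4 \<Rightarrow> real) \<Rightarrow> (real^4 \<Rightarrow> real) \<Rightarrow> real^4 \<Rightarrow> real" where
  "hess u v w x = (\<Sum>i\<in>UNIV. \<Sum>j\<in>UNIV. pd i (pd j u) x * pd i v x * pd j w x)"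

text \<open>The derivative along the field x: smooth at the origin, unlike the unit radial field,
  and equal to the outward normal derivative on the unit sphere.\<close>

definition rad :: "(real^4 \<Rightarrow> real) \<Rightarrow> real^4 \<Rightarrow> real" where
  "rad u x = (\<Sum>i\<in>UNIV. x $ i * pd i u x)"

text \<open>The Hessian evaluated twice on x. Iterating \<open>rad\<close> gives this plus one more
  \<open>rad u\<close>.\<close>

definition rad2 :: "(real^4 \<Rightarrow> real) \<Rightarrow> real^4 \<Rightarrow> real" where
  "rad2 u x = (\<Sum>i\<in>UNIV. \<Sum>j\<in>UNIV. x $ i * x $ j * pd i (pd j u) x)"

text \<open>On the unit sphere these are the inner product of the tangential gradients and the
  Laplacian of the sphere.\<close>

definition tdot :: "(real^4 \<Rightarrow> real) \<Rightarrow> (real^4 \<Rightarrow> real) \<Rightarrow> real^4 \<Rightarrow> real" where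
  "tdot u v x = gdot u v x - rad u x * rad v x"

definition lapS :: "(real^4 \<Rightarrow> real) \<Rightarrow> real^4 \<Rightarrow> real" where
  "lapS u x = lap u x - 3 * rad u x - rad2 u x"

lemma smooth_gdot [intro, smooth_intros]: "u \<in> smooth_B4 \<Longrightarrow> v \<in> smooth_B4 \<Longrightarrow> gdot u v \<in> smooth_B4"
  unfolding gdot_def[abs_def] by (intro smooth_intros)

lemma smooth_lap [intro, smooth_intros]: "u \<in> smooth_B4 \<Longrightarrow> lap u \<in> smooth_B4"
  unfolding lap_def[abs_def] by (intro smooth_intros)

lemma smooth_hess [intro, smooth_intros]:
  "u \<in> smooth_B4 \<Longrightarrow> v \<in> smooth_B4 \<Longrightarrow> w \<in> smooth_B4 \<Longrightarrow> hess u v w \<in> smooth_B4"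
  unfolding hess_def[abs_def] by (intro smooth_intros)

lemma smooth_rad [intro, smooth_intros]: "u \<in> smooth_B4 \<Longrightarrow> rad u \<in> smooth_B4"
  unfolding rad_def[abs_def] by (intro smooth_intros)

lemma smooth_rad2 [intro]: "u \<in> smooth_B4 \<Longrightarrow> rad2 u \<in> smooth_B4"
  unfolding rad2_def[abs_def] by (intro smooth_intros)

lemma smooth_tdot [intro, smooth_intros]: "u \<in> smooth_B4 \<Longrightarrow> v \<in> smooth_B4 \<Longrightarrow> tdot u v \<in> smooth_B4"
  unfolding tdot_def[abs_def] by (intro smooth_intros)

lemma smooth_lapS [intro]: "u \<in> smooth_B4 \<Longrightarrow> lapS u \<in> smooth_B4"
  unfolding lapS_def[abs_def] by (intro smooth_intros smooth_rad2)

lemma S3_imp_B4: "x \<in> S3 \<Longrightarrow> x \<in> B4"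
  by (simp add: mem_cball_0)

lemma S3_sum_squares: "x \<in> S3 \<Longrightarrow> (\<Sum>i\<in>UNIV. x $ i * x $ i) = 1"
  by (simp add: norm_eq_1 inner_vec_def)

lemma smooth_continuous_S3: "f \<in> smooth_B4 \<Longrightarrow> continuous_on S3 f"
  using smooth_continuous_on by (rule continuous_on_subset) (auto simp: mem_cball_0)

lemma vol_cong: "(\<And>x. x \<in> B4 \<Longrightarrow> f x = g x) \<Longrightarrow> vol f = vol g"
  unfolding vol_def by (rule set_lebesgue_integral_cong) auto

lemma vol_add:
  assumes "f \<in> smooth_B4" "g \<in> smooth_B4"
  shows "vol (\<lambda>x. f x + g x) = vol f + vol g" "vol (\<lambda>x. f x - g x) = vol f - vol g"
  using assms unfolding vol_def
  by (auto intro!: set_integral_add set_integral_diff set_integrable_B4)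

lemma vol_cmult: "vol (\<lambda>x. c * f x) = c * vol f"
  unfolding vol_def by simp

lemma vol_sum:
  assumes "\<And>k. k \<in> A \<Longrightarrow> f k \<in> smooth_B4"
  shows "vol (\<lambda>x. \<Sum>k\<in>A. f k x) = (\<Sum>k\<in>A. vol (f k))"
  using assms
proof (induction A rule: infinite_finite_induct)
  case (insert k A)
  then show ?case by (simp add: vol_add smooth_sum)
qed (auto simp: vol_def)

lemma surf_add_smooth:
  assumes "f \<in> smooth_B4" "g \<in> smooth_B4"
  shows "surf (\<lambda>x. f x + g x) = surf f + surf g" "surf (\<lambda>x. f x - g x) = surf f - surf g"
  using assms by (simp_all add: surf_add smooth_continuous_S3)

lemma divergence_theorem_field:
  assumes "\<And>i. F i \<in> smooth_B4"
  shows "vol (\<lambda>x. \<Sum>i\<in>UNIV. pd i (F i) x) = surf (\<lambda>x. \<Sum>i\<in>UNIV. x $ i * F i x)"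
  using assms
  by (simp add: vol_sum smooth_pd divergence_theorem_B4 surf_sum smooth_continuous_S3 smooth_mult)

lemma pd_lap:
  assumes "u \<in> smooth_B4" "x \<in> B4"
  shows "pd i (lap u) x = (\<Sum>k\<in>UNIV. pd k (pd k (pd i u)) x)"
proof -
  have "pd i (pd k (pd k u)) x = pd k (pd k (pd i u)) x" for k
  proof -
    have "pd i (pd k (pd k u)) x = pd k (pd i (pd k u)) x"
      using assms by (intro pd_commute smooth_pd)
    also have "\<dots> = pd k (pd k (pd i u)) x"
      using assms by (intro pd_cong pd_commute)
    finally show ?thesis .
  qed
  then show ?thesis
    unfolding lap_def[abs_def] using assms by (simp add: smooth_pd_sum smooth_pd)
qed

lemma pd_gdot:
  assumes "u \<in> smooth_B4" "v \<in> smooth_B4" "x \<in> B4"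
  shows "pd k (gdot u v) x = (\<Sum>i\<in>UNIV. pd k (pd i u) x * pd i v x + pd i u x * pd k (pd i v) x)"
  unfolding gdot_def[abs_def] using assms by (simp add: smooth_pd_sum smooth_pd_add smooth_pd smooth_mult)

lemma pd_rad:
  assumes "u \<in> smooth_B4" "x \<in> B4"
  shows "pd k (rad u) x = pd k u x + (\<Sum>i\<in>UNIV. x $ i * pd k (pd i u) x)"
proof -
  have "pd k (rad u) x = (\<Sum>i\<in>UNIV. (if k = i then 1 else 0) * pd i u x + x $ i * pd k (pd i u) x)"
    unfolding rad_def[abs_def]
    using assms by (simp add: smooth_pd_sum smooth_pd_add smooth_pd smooth_mult pd_nth)
  then show ?thesis
    by (simp add: sum.distrib if_distrib[where f = "\<lambda>a. a * _"] cong: if_cong)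
qed

text \<open>Green's formula on the sphere, obtained without charts. The antisymmetric field
  \<open>A\<close> has vanishing double divergence, because second derivatives commute, so the flux
  of its row divergences through the sphere is 0. On unit vectors the density of that flux is
  \<open>tdot p u x + p x * lapS u x\<close>.\<close>

lemma tangential_parts:
  assumes p: "p \<in> smooth_B4" and u: "u \<in> smooth_B4"
  shows "surf (\<lambda>x. p x * lapS u x) = - surf (tdot p u)"
proof -
  define A where "A i j x = p x * (x $ i * pd j u x - x $ j * pd i u x)" for i j x
  have sA: "A i j \<in> smooth_B4" for i j
    unfolding A_def[abs_def] by (intro smooth_intros p u)
  have anti: "pd k (pd l (A j i)) x = - pd k (pd l (A i j)) x" if x: "x \<in> B4" for i j k l x
  proof -
    have "A j i = (\<lambda>x. - A i j x)" by (auto simp: A_def algebra_simps)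
    then have "pd k (pd l (A j i)) x = pd k (\<lambda>y. - pd l (A i j) y) x"
      using x sA by (intro pd_cong) (simp_all add: smooth_pd_uminus)
    then show ?thesis using x sA by (simp add: smooth_pd_uminus smooth_pd)
  qed
  define S where "S x = (\<Sum>i\<in>UNIV. \<Sum>j\<in>UNIV. pd i (pd j (A i j)) x)" for x
  have "S x = 0" if x: "x \<in> B4" for x
  proof -
    have "S x = (\<Sum>j\<in>UNIV. \<Sum>i\<in>UNIV. pd i (pd j (A i j)) x)"
      unfolding S_def by (rule sum.swap)
    also have "\<dots> = (\<Sum>j\<in>UNIV. \<Sum>i\<in>UNIV. - pd j (pd i (A j i)) x)"
    proof (intro sum.cong refl)
      fix i j :: 4
      have "pd i (pd j (A i j)) x = pd j (pd i (A i j)) x" by (rule pd_commute[OF sA x])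
      then show "pd i (pd j (A i j)) x = - pd j (pd i (A j i)) x" using anti[OF x, of j i j i] by simp
    qed
    also have "\<dots> = - S x" by (simp add: S_def sum_negf)
    finally show ?thesis by simp
  qed
  then have "vol S = 0"
    using vol_cong[of S "\<lambda>_. 0"] by (simp add: vol_def)
  moreover have "vol S = surf (\<lambda>x. \<Sum>i\<in>UNIV. x $ i * (\<Sum>j\<in>UNIV. pd j (A i j) x))"
  proof -
    have "vol S = vol (\<lambda>x. \<Sum>i\<in>UNIV. pd i (\<lambda>x. \<Sum>j\<in>UNIV. pd j (A i j) x) x)"
      using sA by (intro vol_cong) (simp add: S_def smooth_pd_sum smooth_pd)
    also have "\<dots> = surf (\<lambda>x. \<Sum>i\<in>UNIV. x $ i * (\<Sum>j\<in>UNIV. pd j (A i j) x))"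
      using sA by (intro divergence_theorem_field smooth_intros)
    finally show ?thesis .
  qed
  moreover have "surf (\<lambda>x. \<Sum>i\<in>UNIV. x $ i * (\<Sum>j\<in>UNIV. pd j (A i j) x)) = surf (\<lambda>x. tdot p u x + p x * lapS u x)"
  proof (rule surf_cong)
    fix x assume xS: "x \<in> S3"
    have x: "x \<in> B4" using S3_imp_B4[OF xS] .
    define n where "n = (\<Sum>i\<in>UNIV. x $ i * x $ i)"
    have n: "n = 1" unfolding n_def by (rule S3_sum_squares[OF xS])
    have pdA: "pd j (A i j) x = pd j p x * (x $ i * pd j u x - x $ j * pd i u x)
        + p x * ((if j = i then 1 else 0) * pd j u x + x $ i * pd j (pd j u) x - (pd i u x + x $ j * pd j (pd i u) x))"
      for i j
      unfolding A_def[abs_def] using x p u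
      by (simp add: smooth_pd_add smooth_mult smooth_diff smooth_pd pd_nth)
    have comm: "pd j (pd i u) x = pd i (pd j u) x" for i j by (rule pd_commute[OF u x])
    have "(\<Sum>i\<in>UNIV. x $ i * (\<Sum>j\<in>UNIV. pd j (A i j) x)) =
        n * gdot p u x - rad p x * rad u x + p x * (n * lap u x - 3 * rad u x - rad2 u x)"
      unfolding pdA n_def gdot_def rad_def lap_def rad2_def
      by (simp add: sum_4 comm[of 1 2] comm[of 1 3] comm[of 1 4] comm[of 2 3] comm[of 2 4] comm[of 3 4] algebra_simps)
    then show "(\<Sum>i\<in>UNIV. x $ i * (\<Sum>j\<in>UNIV. pd j (A i j) x)) = tdot p u x + p x * lapS u x"
      by (simp add: n tdot_def lapS_def)
  qed
  moreover have "surf (\<lambda>x. tdot p u x + p x * lapS u x) = surf (tdot p u) + surf (\<lambda>x. p x * lapS u x)"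
    using p u by (intro surf_add_smooth smooth_intros smooth_lapS)
  ultimately show ?thesis by simp
qed


section \<open>Weak form of the first variation\<close>

text \<open>Flat-coordinate expressions of sigma2 and H2 times the volume densities: in dimension four the
  exponential factors cancel.\<close>

definition int_density :: "(real^4 \<Rightarrow> real) \<Rightarrow> real^4 \<Rightarrow> real" where
  "int_density u x = ((lap u x)\<^sup>2 - (\<Sum>i\<in>UNIV. \<Sum>j\<in>UNIV. (pd i (pd j u) x)\<^sup>2)
     + lap u x * gdot u u x + 2 * hess u u u x) / 2"

definition bd_density :: "(real^4 \<Rightarrow> real) \<Rightarrow> real^4 \<Rightarrow> real" where
  "bd_density u x = (1 + rad u x) *
     (1 - rad u x - (rad u x)\<^sup>2 / 2 - lapS u x - tdot u u x / 2)"

lemma smooth_int_density [intro]: "u \<in> smooth_B4 \<Longrightarrow> int_density u \<in> smooth_B4"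
  unfolding int_density_def[abs_def] divide_inverse
  by (intro smooth_intros smooth_power)

lemma smooth_bd_density [intro]: "u \<in> smooth_B4 \<Longrightarrow> bd_density u \<in> smooth_B4"
  unfolding bd_density_def[abs_def] divide_inverse
  by (intro smooth_intros smooth_power smooth_lapS)

text \<open>The interior density is half the divergence of \<open>Z\<close>, so one integration by
  parts moves a derivative onto v. In the sum of the flux of \<open>Z\<close> and
  \<open>bd_density\<close>, second derivatives of u survive only in \<open>lapS u\<close> and in
  \<open>tdot (rad u) u\<close>. The former is integrated by parts on the sphere against
  \<open>v * (1 + rad u / 2)\<close>, and differentiating this weight yields the very term that
  cancels the latter.\<close>

lemma weak_form:
  assumes u: "u \<in> smooth_B4" and v: "v \<in> smooth_B4"
  shows "vol (\<lambda>x. v x * int_density u x) + surf (\<lambda>x. v x * bd_density u x) =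
    surf v + surf (\<lambda>x. (1 + rad u x / 2) * tdot u v x)
    - vol (\<lambda>x. lap u x * gdot u v x - hess u u v x + gdot u u x * gdot u v x) / 2"
proof -
  define Z where "Z i x = lap u x * pd i u x - (\<Sum>j\<in>UNIV. pd i (pd j u) x * pd j u x)
    + gdot u u x * pd i u x" for i x
  have sZ: "Z i \<in> smooth_B4" for i
    unfolding Z_def[abs_def]
    by (intro smooth_intros u)
  define ZV where "ZV x = lap u x * gdot u v x - hess u u v x + gdot u u x * gdot u v x" for x
  have sZV: "ZV \<in> smooth_B4"
    unfolding ZV_def[abs_def]
    by (intro smooth_intros u v)
  define Zr where "Zr x = (\<Sum>i\<in>UNIV. x $ i * Z i x)" for x
  have sZr: "Zr \<in> smooth_B4"
    unfolding Zr_def[abs_def] by (intro smooth_intros sZ)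
  have comm: "pd j (pd i u) x = pd i (pd j u) x" if "x \<in> B4" for i j x
    by (rule pd_commute[OF u that])
  have divZ: "(\<Sum>i\<in>UNIV. pd i (Z i) x) = 2 * int_density u x" if x: "x \<in> B4" for x
  proof -
    \<comment> \<open>The third derivatives of u in the divergence of \<open>Z\<close>; they occur
      once with each sign.\<close>
    define T where "T = (\<Sum>i\<in>UNIV. \<Sum>k\<in>UNIV. pd k (pd k (pd i u)) x * pd i u x)"
    have pdZ: "pd i (Z i) x = pd i (lap u) x * pd i u x + lap u x * pd i (pd i u) x
      - (\<Sum>j\<in>UNIV. pd i (pd i (pd j u)) x * pd j u x + pd i (pd j u) x * pd i (pd j u) x)
      + (pd i (gdot u u) x * pd i u x + gdot u u x * pd i (pd i u) x)" for i
      unfolding Z_def[abs_def] using x u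
      by (simp add: smooth_pd_add smooth_add smooth_diff smooth_mult smooth_sum smooth_pd smooth_lap
          smooth_gdot smooth_pd_sum)
    have T': "(\<Sum>i\<in>UNIV. \<Sum>j\<in>UNIV. pd i (pd i (pd j u)) x * pd j u x) = T"
      unfolding T_def by (rule sum.swap)
    have T'': "(\<Sum>i\<in>UNIV. pd i (lap u) x * pd i u x) = T"
      unfolding T_def pd_lap[OF u x] by (simp add: sum_distrib_right)
    have "(\<Sum>i\<in>UNIV. pd i (Z i) x) = (\<Sum>i\<in>UNIV. pd i (lap u) x * pd i u x)
      + lap u x * (\<Sum>i\<in>UNIV. pd i (pd i u) x)
      - ((\<Sum>i\<in>UNIV. \<Sum>j\<in>UNIV. pd i (pd i (pd j u)) x * pd j u x)
        + (\<Sum>i\<in>UNIV. \<Sum>j\<in>UNIV. (pd i (pd j u) x)\<^sup>2))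
      + ((\<Sum>i\<in>UNIV. pd i (gdot u u) x * pd i u x) + gdot u u x * (\<Sum>i\<in>UNIV. pd i (pd i u) x))"
      unfolding pdZ sum.distrib sum_subtractf sum_distrib_left power2_eq_square ..
    then have "(\<Sum>i\<in>UNIV. pd i (Z i) x) = T + lap u x * lap u x
      - (T + (\<Sum>i\<in>UNIV. \<Sum>j\<in>UNIV. (pd i (pd j u) x)\<^sup>2))
      + ((\<Sum>i\<in>UNIV. pd i (gdot u u) x * pd i u x) + gdot u u x * lap u x)"
      unfolding T' T'' lap_def[symmetric] .
    moreover have "(\<Sum>i\<in>UNIV. pd i (gdot u u) x * pd i u x) = 2 * hess u u u x"
      unfolding pd_gdot[OF u u x] hess_def sum_distrib_left sum_distrib_right
      by (intro sum.cong refl) (simp add: algebra_simps sum_distrib_left)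
    ultimately show ?thesis
      by (simp add: int_density_def power2_eq_square)
  qed
  have "vol (\<lambda>x. v x * int_density u x) = (surf (\<lambda>x. v x * Zr x) - vol ZV) / 2"
  proof -
    have "vol (\<lambda>x. \<Sum>i\<in>UNIV. pd i (\<lambda>x. v x * Z i x) x) = surf (\<lambda>x. \<Sum>i\<in>UNIV. x $ i * (v x * Z i x))"
      using v sZ by (intro divergence_theorem_field smooth_mult)
    moreover have "(\<lambda>x. \<Sum>i\<in>UNIV. x $ i * (v x * Z i x)) = (\<lambda>x. v x * Zr x)"
      by (simp add: Zr_def sum_distrib_left mult_ac)
    moreover have "vol (\<lambda>x. \<Sum>i\<in>UNIV. pd i (\<lambda>x. v x * Z i x) x) = vol (\<lambda>x. ZV x + 2 * (v x * int_density u x))"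
    proof (rule vol_cong)
      fix x assume x: "x \<in> B4"
      have "(\<Sum>i\<in>UNIV. pd i (\<lambda>x. v x * Z i x) x) = (\<Sum>i\<in>UNIV. pd i v x * Z i x) + v x * (\<Sum>i\<in>UNIV. pd i (Z i) x)"
        using x v sZ by (simp add: smooth_pd_add sum.distrib sum_distrib_left)
      moreover have "(\<Sum>i\<in>UNIV. pd i v x * Z i x) = ZV x"
        unfolding Z_def ZV_def gdot_def hess_def
        by (simp add: sum_4 comm[OF x, of 1 2] comm[OF x, of 1 3] comm[OF x, of 1 4] comm[OF x, of 2 3]
            comm[OF x, of 2 4] comm[OF x, of 3 4] algebra_simps)
      ultimately show "(\<Sum>i\<in>UNIV. pd i (\<lambda>x. v x * Z i x) x) = ZV x + 2 * (v x * int_density u x)"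
        by (simp add: divZ[OF x])
    qed
    moreover have "vol (\<lambda>x. ZV x + 2 * (v x * int_density u x)) = vol ZV + 2 * vol (\<lambda>x. v x * int_density u x)"
      by (subst vol_add) (intro smooth_intros smooth_int_density u v sZV | simp add: vol_cmult)+
    ultimately show ?thesis by simp
  qed
  moreover have "surf (\<lambda>x. v x * Zr x) / 2 + surf (\<lambda>x. v x * bd_density u x) =
    surf v + surf (\<lambda>x. (1 + rad u x / 2) * tdot u v x)"
  proof -
    define c where "c = (1/2::real)"
    define p where "p x = v x * (1 + c * rad u x)" for x
    have sp: "p \<in> smooth_B4"
      unfolding p_def[abs_def] by (intro smooth_intros u v)
    have s1: "(\<lambda>x. c * (v x * tdot (rad u) u x)) \<in> smooth_B4"
      using u v by (intro smooth_intros)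
    have s2: "(\<lambda>x. (1 + c * rad u x) * tdot u v x) \<in> smooth_B4"
      using u v by (intro smooth_intros)
    have "surf (\<lambda>x. v x * Zr x) / 2 + surf (\<lambda>x. v x * bd_density u x)
        = surf (\<lambda>x. c * (v x * Zr x)) + surf (\<lambda>x. v x * bd_density u x)"
      unfolding surf_cmult by (simp add: c_def)
    also have "\<dots> = surf (\<lambda>x. c * (v x * Zr x) + v x * bd_density u x)"
      by (intro surf_add_smooth[symmetric] smooth_intros smooth_bd_density u v sZr)
    also have "\<dots> = surf (\<lambda>x. v x - p x * lapS u x - c * (v x * tdot (rad u) u x))"
    proof (rule surf_cong)
      fix x assume xS: "x \<in> S3"
      have x: "x \<in> B4" using S3_imp_B4[OF xS] .
      \<comment> \<open>The Hessian of u on x and the gradient of u. It enters both the flux of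
        \<open>Z\<close> and the gradient of \<open>rad u\<close>, which is why the two can be
        combined.\<close>
      define Y where "Y = (\<Sum>i\<in>UNIV. \<Sum>j\<in>UNIV. x $ i * pd i (pd j u) x * pd j u x)"
      have 1: "Zr x = lap u x * rad u x - Y + gdot u u x * rad u x"
        unfolding Zr_def Z_def Y_def rad_def by (simp add: sum_4 algebra_simps)
      have 2: "gdot (rad u) u x = gdot u u x + Y"
        unfolding gdot_def pd_rad[OF u x] Y_def
        by (simp add: sum_4 comm[OF x, of 1 2] comm[OF x, of 1 3] comm[OF x, of 1 4] comm[OF x, of 2 3]
            comm[OF x, of 2 4] comm[OF x, of 3 4] algebra_simps)
      have 3: "rad (rad u) x = rad u x + rad2 u x"
        unfolding rad_def[of "rad u"] pd_rad[OF u x] rad2_def rad_def[of u]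
        by (simp add: sum_4 comm[OF x, of 1 2] comm[OF x, of 1 3] comm[OF x, of 1 4] comm[OF x, of 2 3]
            comm[OF x, of 2 4] comm[OF x, of 3 4] algebra_simps)
      have "c * Zr x + bd_density u x = 1 - (1 + c * rad u x) * lapS u x - c * tdot (rad u) u x"
        unfolding 1 bd_density_def tdot_def 2 3 lapS_def c_def by (simp add: field_simps power2_eq_square)
      then have "v x * (c * Zr x + bd_density u x) =
          v x * (1 - (1 + c * rad u x) * lapS u x - c * tdot (rad u) u x)" by simp
      then show "c * (v x * Zr x) + v x * bd_density u x
          = v x - p x * lapS u x - c * (v x * tdot (rad u) u x)"
        by (simp add: p_def algebra_simps)
    qed
    also have "\<dots> = surf v + surf (tdot p u) - surf (\<lambda>x. c * (v x * tdot (rad u) u x))"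
      using u v sp s1 by (simp add: surf_add_smooth smooth_diff smooth_mult smooth_lapS tangential_parts)
    also have "surf (tdot p u) = surf (\<lambda>x. (1 + c * rad u x) * tdot u v x + c * (v x * tdot (rad u) u x))"
    proof (rule surf_cong)
      fix x assume xS: "x \<in> S3"
      have x: "x \<in> B4" using S3_imp_B4[OF xS] .
      have pdp: "pd i p x = pd i v x * (1 + c * rad u x) + v x * (c * pd i (rad u) x)" for i
        unfolding p_def[abs_def] using x u v
        by (simp add: smooth_pd_add smooth_add smooth_mult smooth_rad)
      show "tdot p u x = (1 + c * rad u x) * tdot u v x + c * (v x * tdot (rad u) u x)"
        unfolding tdot_def gdot_def rad_def[of p] rad_def[of "rad u"] pdp
        unfolding rad_def[of v] by (simp add: sum_4 algebra_simps)
    qed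
    also have "\<dots> = surf (\<lambda>x. (1 + c * rad u x) * tdot u v x) + surf (\<lambda>x. c * (v x * tdot (rad u) u x))"
      using s2 s1 by (rule surf_add_smooth)
    finally show ?thesis by (simp add: c_def)
  qed
  ultimately show ?thesis unfolding ZV_def[symmetric] by simp
qed

text \<open>The part of the first variation quadratic in u, polarised; it is symmetric in all three arguments.\<close>

definition cubic_form :: "(real^4 \<Rightarrow> real) \<Rightarrow> (real^4 \<Rightarrow> real) \<Rightarrow> (real^4 \<Rightarrow> real) \<Rightarrow> real" where
  "cubic_form u v w = surf (\<lambda>x. rad u x * tdot v w x) - vol (\<lambda>x. lap u x * gdot v w x - hess u v w x)"

lemma hess_commute:
  assumes "u \<in> smooth_B4" "x \<in> B4"
  shows "hess u v w x = hess u w v x"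
proof -
  have e: "pd i (pd j u) x * pd i v x * pd j w x = pd j (pd i u) x * pd j w x * pd i v x" for i j
    unfolding pd_commute[OF assms, of i j] by simp
  show ?thesis unfolding hess_def by (subst sum.swap, intro sum.cong refl, rule e)
qed

lemma gdot_grad_gdot:
  assumes "u \<in> smooth_B4" "w \<in> smooth_B4" "x \<in> B4"
  shows "(\<Sum>i\<in>UNIV. pd i (gdot u w) x * pd i v x) = hess u v w x + hess w v u x"
  unfolding pd_gdot[OF assms] hess_def
  by (simp add: sum_distrib_left sum_distrib_right sum.distrib algebra_simps)

lemma cubic_form_commute_right:
  assumes "u \<in> smooth_B4"
  shows "cubic_form u v w = cubic_form u w v"
proof -
  have "vol (\<lambda>x. lap u x * gdot v w x - hess u v w x) = vol (\<lambda>x. lap u x * gdot w v x - hess u w v x)"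
    using hess_commute[OF assms] by (intro vol_cong) (simp add: gdot_def mult.commute)
  then show ?thesis by (simp add: cubic_form_def tdot_def gdot_def mult.commute)
qed

text \<open>The difference of the interior terms is the divergence of \<open>F\<close>, hence a
  boundary flux. In this flux \<open>gdot\<close> may be replaced by \<open>tdot\<close>, since the
  products of three radial derivatives cancel, and the result is the difference of the boundary
  terms.\<close>

lemma cubic_form_commute_left:
  assumes u: "u \<in> smooth_B4" and v: "v \<in> smooth_B4" and w: "w \<in> smooth_B4"
  shows "cubic_form u v w = cubic_form v u w"
proof -
  define F where "F i x = gdot u w x * pd i v x - gdot v w x * pd i u x" for i x
  have sF: "F i \<in> smooth_B4" for i
    unfolding F_def[abs_def] by (intro smooth_intros u v w)
  let ?a = "\<lambda>x. lap u x * gdot v w x - hess u v w x" and ?b = "\<lambda>x. lap v x * gdot u w x - hess v u w x"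
  have s: "?a \<in> smooth_B4" "?b \<in> smooth_B4"
    by (intro smooth_intros u v w)+
  have "vol ?b - vol ?a = vol (\<lambda>x. ?b x - ?a x)" by (rule vol_add(2)[OF s(2,1), symmetric])
  also have "\<dots> = vol (\<lambda>x. \<Sum>i\<in>UNIV. pd i (F i) x)"
  proof (rule vol_cong)
    fix x assume x: "x \<in> B4"
    have pdF: "pd i (F i) x = pd i (gdot u w) x * pd i v x + gdot u w x * pd i (pd i v) x
        - (pd i (gdot v w) x * pd i u x + gdot v w x * pd i (pd i u) x)" for i
      unfolding F_def[abs_def] using x u v w
      by (simp add: smooth_pd_add smooth_mult smooth_gdot smooth_pd)
    have "(\<Sum>i\<in>UNIV. pd i (F i) x) = (hess u v w x + hess w v u x) + gdot u w x * lap v x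
        - ((hess v u w x + hess w u v x) + gdot v w x * lap u x)"
      unfolding pdF sum_subtractf sum.distrib gdot_grad_gdot[OF u w x] gdot_grad_gdot[OF v w x]
      by (simp add: lap_def sum_distrib_left)
    then show "?b x - ?a x = (\<Sum>i\<in>UNIV. pd i (F i) x)"
      using hess_commute[OF w x, of u v] by simp
  qed
  also have "\<dots> = surf (\<lambda>x. \<Sum>i\<in>UNIV. x $ i * F i x)"
    by (rule divergence_theorem_field[OF sF])
  also have "(\<lambda>x. \<Sum>i\<in>UNIV. x $ i * F i x) = (\<lambda>x. rad v x * tdot u w x - rad u x * tdot v w x)"
  proof
    fix x
    have "(\<Sum>i\<in>UNIV. x $ i * F i x) = gdot u w x * rad v x - gdot v w x * rad u x"
      by (simp add: F_def rad_def sum_distrib_left sum_subtractf algebra_simps)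
    then show "(\<Sum>i\<in>UNIV. x $ i * F i x) = rad v x * tdot u w x - rad u x * tdot v w x"
      by (simp add: tdot_def algebra_simps)
  qed
  also have "surf \<dots> = surf (\<lambda>x. rad v x * tdot u w x) - surf (\<lambda>x. rad u x * tdot v w x)"
    by (intro surf_add_smooth smooth_intros u v w)
  finally show ?thesis by (simp add: cubic_form_def)
qed


section \<open>Curvature of conformally flat metrics\<close>

abbreviation kron :: "4 \<Rightarrow> 4 \<Rightarrow> real" where
  "kron i j \<equiv> (if i = j then 1 else 0)"

lemma conformal_metric_nth: "conformal_metric u x $ i $ j = exp (2 * u x) * kron i j"
  by (simp add: conformal_metric_def flat_metric_def mat_def)

lemma matrix_inv_eq:
  fixes A B :: "real^4^4"
  assumes "A ** B = mat 1"
  shows "matrix_inv A = B"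
proof -
  have BA: "B ** A = mat 1" using assms matrix_left_right_inverse by blast
  have "\<exists>C. A ** C = mat 1 \<and> C ** A = mat 1" using assms BA by blast
  then have "A ** matrix_inv A = mat 1" unfolding matrix_inv_def by (rule someI2_ex) blast
  then have "B ** (A ** matrix_inv A) = B" by simp
  then show ?thesis by (simp add: matrix_mul_assoc BA)
qed

lemma sum_kron: "(\<Sum>k\<in>UNIV. kron i k * f k) = f i"
proof -
  have "(\<Sum>k\<in>UNIV. kron i k * f k) = (\<Sum>k\<in>UNIV. if i = k then f k else 0)"
    by (intro sum.cong refl) auto
  then show ?thesis by simp
qed

lemma sum_sum_kron: "(\<Sum>k\<in>UNIV. \<Sum>l\<in>UNIV. c * kron i k * (d * kron j l) * f k l) = c * d * f i j"
proof -
  have "(\<Sum>l\<in>UNIV. c * kron i k * (d * kron j l) * f k l) = kron i k * (c * d * f k j)" for k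
  proof -
    have "(\<Sum>l\<in>UNIV. c * kron i k * (d * kron j l) * f k l) = (\<Sum>l\<in>UNIV. kron j l * (c * kron i k * d * f k l))"
      by (intro sum.cong refl) (simp only: mult_ac)
    also have "\<dots> = c * kron i k * d * f k j" by (rule sum_kron)
    finally show ?thesis by (simp only: mult_ac)
  qed
  then show ?thesis by (simp only: sum_kron)
qed

lemma ginv_conformal_metric: "ginv (conformal_metric u) i j x = exp (- 2 * u x) * kron i j"
proof -
  let ?c = "exp (2 * u x)"
  have "matrix_inv (?c *\<^sub>R mat 1 :: real^4^4) = inverse ?c *\<^sub>R mat 1"
  proof (rule matrix_inv_eq)
    show "(?c *\<^sub>R mat 1 :: real^4^4) ** (inverse ?c *\<^sub>R mat 1) = mat 1"
      by (simp add: scalar_matrix_assoc matrix_scalar_ac)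
  qed
  then show ?thesis
    by (simp add: ginv_def conformal_metric_def flat_metric_def mat_def exp_minus)
qed

lemma pd_conformal_metric:
  assumes "u \<in> smooth_B4" "x \<in> B4"
  shows "pd k (\<lambda>y. conformal_metric u y $ i $ j) x = 2 * exp (2 * u x) * pd k u x * kron i j"
proof -
  have "pd k (\<lambda>y. exp (2 * u y)) x = exp (2 * u x) * (2 * pd k u x)"
    using assms by (simp add: smooth_pd_exp smooth_pd_add smooth_mult)
  then show ?thesis using assms by (simp add: conformal_metric_nth)
qed

lemma Christoffel_conformal_metric:
  assumes "u \<in> smooth_B4" "x \<in> B4"
  shows "Christoffel (conformal_metric u) k i j x
    = kron k j * pd i u x + kron k i * pd j u x - kron i j * pd k u x"
proof -
  have "exp (- 2 * u x) * exp (2 * u x) = 1" by (simp add: exp_minus)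
  then have e: "exp (- 2 * u x) * (2 * exp (2 * u x) * a) = 2 * a" for a
    by (metis mult.assoc mult.commute mult.left_neutral)
  have "Christoffel (conformal_metric u) k i j x = 1/2 * (\<Sum>l\<in>UNIV. if k = l then
      exp (- 2 * u x) * (2 * exp (2 * u x) * (pd i u x * kron j l + pd j u x * kron i l - pd l u x * kron i j)) else 0)"
    unfolding Christoffel_def ginv_conformal_metric pd_conformal_metric[OF assms]
    by (intro arg_cong2[where f = "(*)"] sum.cong refl) (simp add: algebra_simps)
  then show ?thesis unfolding e by (auto simp: algebra_simps)
qed

lemma pd_Christoffel_conformal_metric:
  assumes u: "u \<in> smooth_B4" and x: "x \<in> B4"
  shows "pd m (Christoffel (conformal_metric u) k i j) x
    = kron k j * pd m (pd i u) x + kron k i * pd m (pd j u) x - kron i j * pd m (pd k u) x"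
proof -
  have "pd m (Christoffel (conformal_metric u) k i j) x
    = pd m (\<lambda>y. kron k j * pd i u y + kron k i * pd j u y - kron i j * pd k u y) x"
    using assms by (intro pd_cong Christoffel_conformal_metric)
  also have "\<dots> = kron k j * pd m (pd i u) x + kron k i * pd m (pd j u) x - kron i j * pd m (pd k u) x"
    using assms by (simp add: smooth_pd_add smooth_mult smooth_add smooth_diff smooth_pd del: if_split)
  finally show ?thesis .
qed

text \<open>The classical formula for a conformal change of a flat metric, where 2 is the dimension
  minus 2. The Christoffel symbols are explicit, so all sixteen components are expanded and compared
  once mixed second derivatives have been put in one order.\<close>

lemma Ricci_conformal_metric:
  assumes u: "u \<in> smooth_B4" and x: "x \<in> B4"
  shows "Ricci (conformal_metric u) i j x = - 2 * pd i (pd j u) x - kron i j * lap u x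
    + 2 * pd i u x * pd j u x - 2 * kron i j * gdot u u x"
proof -
  have comm: "pd j (pd i u) x = pd i (pd j u) x" for i j
    by (rule pd_commute[OF u x])
  note c = comm[of 1 2] comm[of 1 3] comm[of 1 4] comm[of 2 3] comm[of 2 4] comm[of 3 4]
  have "\<forall>i j. Ricci (conformal_metric u) i j x = - 2 * pd i (pd j u) x - kron i j * lap u x
    + 2 * pd i u x * pd j u x - 2 * kron i j * gdot u u x"
    unfolding Ricci_def Christoffel_conformal_metric[OF u x] pd_Christoffel_conformal_metric[OF u x]
      lap_def gdot_def forall_4 sum_4
    by (simp add: c algebra_simps)
  then show ?thesis by blast
qed

lemma scalar_curv_conformal_metric:
  assumes u: "u \<in> smooth_B4" and x: "x \<in> B4"
  shows "scalar_curv (conformal_metric u) x = - 6 * exp (- 2 * u x) * (lap u x + gdot u u x)"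
  unfolding scalar_curv_def ginv_conformal_metric Ricci_conformal_metric[OF assms]
  by (simp add: sum_4 lap_def gdot_def algebra_simps)

text \<open>The exponential in the scalar curvature is cancelled by the one in the metric, so the
  covariant tensor is a polynomial in the derivatives of u.\<close>

lemma Schouten_conformal_metric:
  assumes u: "u \<in> smooth_B4" and x: "x \<in> B4"
  shows "Schouten (conformal_metric u) i j x =
    - pd i (pd j u) x + pd i u x * pd j u x - kron i j * gdot u u x / 2"
proof -
  have e: "exp (- 2 * u x) * exp (2 * u x) = 1" by (simp add: exp_minus)
  have "- 6 * a * s / 6 * (b * k) = - s * k * (a * b)" for a s b k :: real by simp
  then have "scalar_curv (conformal_metric u) x / 6 * conformal_metric u x $ i $ j
    = - (lap u x + gdot u u x) * kron i j * (exp (- 2 * u x) * exp (2 * u x))"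
    unfolding scalar_curv_conformal_metric[OF assms] conformal_metric_nth .
  then show ?thesis
    unfolding Schouten_def Ricci_conformal_metric[OF assms] e by (auto simp: field_simps)
qed

lemma sigma1_conformal_metric:
  assumes u: "u \<in> smooth_B4" and x: "x \<in> B4"
  shows "sigma1 (conformal_metric u) x = - exp (- 2 * u x) * (lap u x + gdot u u x)"
  by (simp add: sigma1_def scalar_curv_conformal_metric[OF assms])

lemma Schouten_norm_sq_conformal_metric:
  assumes u: "u \<in> smooth_B4" and x: "x \<in> B4"
  shows "Schouten_norm_sq (conformal_metric u) x = exp (- 4 * u x) *
    (\<Sum>i\<in>UNIV. \<Sum>j\<in>UNIV. (- pd i (pd j u) x + pd i u x * pd j u x - kron i j * gdot u u x / 2)\<^sup>2)"
proof -
  let ?A = "\<lambda>i j. - pd i (pd j u) x + pd i u x * pd j u x - kron i j * gdot u u x / 2"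
  have e: "exp (- 2 * u x) * (exp (- 2 * u x) * a) = exp (- 4 * u x) * a" for a
    by (simp add: exp_add[symmetric] mult.assoc[symmetric])
  show ?thesis
    unfolding Schouten_norm_sq_def ginv_conformal_metric Schouten_conformal_metric[OF assms]
    unfolding mult.assoc[of "_ * (_ * kron _ _)" "?A _ _"] sum_sum_kron
    by (simp only: mult.assoc e sum_distrib_left power2_eq_square)
qed

lemma sigma2_conformal_metric:
  assumes u: "u \<in> smooth_B4" and x: "x \<in> B4"
  shows "sigma2 (conformal_metric u) x = exp (- 4 * u x) * int_density u x"
proof -
  have e: "(exp (- 2 * u x))\<^sup>2 = exp (- 4 * u x)"
    by (simp add: power2_eq_square exp_add[symmetric])
  \<comment> \<open>The terms quartic in the gradient add up to a single square: 1 from the product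
    of gradients, 1 from four diagonal entries of 1/4 each, and -1 from the cross term.\<close>
  have S: "(\<Sum>i\<in>UNIV. \<Sum>j\<in>UNIV. (- pd i (pd j u) x + pd i u x * pd j u x - kron i j * gdot u u x / 2)\<^sup>2)
    = (\<Sum>i\<in>UNIV. \<Sum>j\<in>UNIV. (pd i (pd j u) x)\<^sup>2) + (gdot u u x)\<^sup>2 - 2 * hess u u u x + lap u x * gdot u u x"
  proof -
    define G where "G = gdot u u x"
    have sq: "(- pd i (pd j u) x + pd i u x * pd j u x - kron i j * G / 2)\<^sup>2 =
      (pd i (pd j u) x)\<^sup>2 + (pd i u x * pd i u x) * (pd j u x * pd j u x) + kron i j * (G\<^sup>2 / 4)
      - 2 * (pd i (pd j u) x * pd i u x * pd j u x) + kron i j * (G * pd i (pd j u) x)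
      - kron i j * (G * (pd i u x * pd j u x))" for i j
      by (simp add: power2_eq_square algebra_simps)
    have k: "(\<Sum>i\<in>UNIV. \<Sum>j\<in>UNIV. kron i j * a i j) = (\<Sum>i\<in>UNIV. a i i)" for a :: "4 \<Rightarrow> 4 \<Rightarrow> real"
      by (simp add: if_distrib[where f = "\<lambda>c. c * _"] cong: if_cong)
    have gg: "(\<Sum>i\<in>UNIV. \<Sum>j\<in>UNIV. (pd i u x * pd i u x) * (pd j u x * pd j u x)) = G\<^sup>2"
      by (simp add: G_def gdot_def sum_product power2_eq_square)
    have "(\<Sum>i\<in>UNIV. \<Sum>j\<in>UNIV. (- pd i (pd j u) x + pd i u x * pd j u x - kron i j * G / 2)\<^sup>2) =
      (\<Sum>i\<in>UNIV. \<Sum>j\<in>UNIV. (pd i (pd j u) x)\<^sup>2) + G\<^sup>2 + (\<Sum>i\<in>(UNIV::4 set). G\<^sup>2 / 4)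
      - 2 * hess u u u x + (\<Sum>i\<in>UNIV. G * pd i (pd i u) x) - (\<Sum>i\<in>UNIV. G * (pd i u x * pd i u x))"
      by (simp only: sq sum.distrib sum_subtractf k gg hess_def sum_distrib_left)
    also have "(\<Sum>i\<in>UNIV. G * pd i (pd i u) x) = lap u x * G"
      unfolding lap_def sum_distrib_left[symmetric] by (rule mult.commute)
    also have "(\<Sum>i\<in>UNIV. G * (pd i u x * pd i u x)) = G\<^sup>2"
      unfolding sum_distrib_left[symmetric] power2_eq_square by (simp add: G_def gdot_def)
    also have "(\<Sum>i\<in>(UNIV::4 set). G\<^sup>2 / 4) = G\<^sup>2" by simp
    finally show ?thesis by (simp add: G_def)
  qed
  have "(- exp (- 2 * u x) * (lap u x + gdot u u x))\<^sup>2 = exp (- 4 * u x) * (lap u x + gdot u u x)\<^sup>2"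
    unfolding power_mult_distrib power2_minus e ..
  then show ?thesis
    unfolding sigma2_def sigma1_conformal_metric[OF assms] Schouten_norm_sq_conformal_metric[OF assms]
      int_density_def S by (simp add: power2_sum field_simps)
qed

section \<open>Boundary geometry of the conformal metrics\<close>

lemma normal_conformal_metric:
  "normal (conformal_metric u) k y = exp (- u y) * (y $ k / norm y)"
proof -
  have 1: "(\<Sum>j\<in>UNIV. ginv (conformal_metric u) k j y * y $ j) = exp (- 2 * u y) * y $ k"
  proof -
    have "(\<Sum>j\<in>UNIV. ginv (conformal_metric u) k j y * y $ j) = (\<Sum>j\<in>UNIV. kron k j * (exp (- 2 * u y) * y $ j))"
      unfolding ginv_conformal_metric by (simp only: mult_ac)
    then show ?thesis by (simp only: sum_kron)
  qed
  have "(\<Sum>j\<in>UNIV. ginv (conformal_metric u) i j y * y $ i * y $ j) = exp (- 2 * u y) * (y $ i * y $ i)" for i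
  proof -
    have "(\<Sum>j\<in>UNIV. ginv (conformal_metric u) i j y * y $ i * y $ j)
      = (\<Sum>j\<in>UNIV. kron i j * (exp (- 2 * u y) * (y $ i * y $ j)))"
      unfolding ginv_conformal_metric by (simp only: mult_ac)
    then show ?thesis by (simp only: sum_kron)
  qed
  then have "(\<Sum>i\<in>UNIV. \<Sum>j\<in>UNIV. ginv (conformal_metric u) i j y * y $ i * y $ j) = exp (- 2 * u y) * (y \<bullet> y)"
    by (simp add: inner_vec_def sum_distrib_left)
  moreover have e: "exp (- 2 * u y) = (exp (- u y))\<^sup>2" by (simp add: exp_double[symmetric])
  ultimately have 2: "sqrt (\<Sum>i\<in>UNIV. \<Sum>j\<in>UNIV. ginv (conformal_metric u) i j y * y $ i * y $ j) = exp (- u y) * norm y"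
    by (simp add: real_sqrt_mult norm_eq_sqrt_inner)
  show ?thesis
    unfolding normal_def 1 2 e by (simp add: power2_eq_square)
qed

text \<open>On the unit sphere the derivative of \<open>y / norm y\<close> is the tangential
  projection \<open>kron i k - x $ i * x $ k\<close>; the last term comes from the conformal
  factor.\<close>

lemma pd_normal_conformal_metric:
  assumes u: "u \<in> smooth_B4" and xS: "x \<in> S3"
  shows "pd i (normal (conformal_metric u) k) x = exp (- u x) * (kron i k - x $ i * x $ k - pd i u x * x $ k)"
proof -
  have x: "x \<in> B4" using S3_imp_B4[OF xS] .
  have n: "norm x = 1" using xS by simp
  have D: "((\<lambda>y. y $ k / norm y) has_derivative (\<lambda>h. h $ k - x $ k * (h \<bullet> x))) (at x within B4)"
  proof -
    have "((\<lambda>y. y $ k) has_derivative (\<lambda>h. h $ k)) (at x within B4)"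
      by (intro bounded_linear_imp_has_derivative bounded_linear_vec_nth)
    moreover have "(norm has_derivative (\<lambda>h. h \<bullet> x)) (at x within B4)"
    proof (rule has_derivative_at_withinI)
      have "x \<noteq> 0" using n by auto
      from has_derivative_norm[OF this] show "(norm has_derivative (\<lambda>h. h \<bullet> x)) (at x)"
        using n by (simp add: sgn_div_norm)
    qed
    ultimately have "((\<lambda>y. y $ k / norm y) has_derivative
        (\<lambda>h. (h $ k * norm x - x $ k * (h \<bullet> x)) / (norm x * norm x))) (at x within B4)"
      using n by (intro has_derivative_divide') auto
    then show ?thesis using n by simp
  qed
  have "pd i (normal (conformal_metric u) k) x = pd i (\<lambda>y. exp (- u y) * (y $ k / norm y)) x"
    using normal_conformal_metric by (intro pd_cong x)
  also have "\<dots> = pd i (\<lambda>y. exp (- u y)) x * (x $ k / norm x) + exp (- u x) * pd i (\<lambda>y. y $ k / norm y) x"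
  proof (rule pd_add_diff(3)[OF x])
    show "(\<lambda>y. exp (- u y)) differentiable (at x within B4)"
      by (intro smooth_differentiable smooth_exp smooth_minus u x)
    show "(\<lambda>y. y $ k / norm y) differentiable (at x within B4)"
      using D by (auto simp: differentiable_def)
  qed
  also have "pd i (\<lambda>y. y $ k / norm y) x = kron i k - x $ k * x $ i"
    using pd_eqI[OF x D, of i] unfolding inner_axis' by (auto simp: axis_def)
  also have "pd i (\<lambda>y. exp (- u y)) x = - exp (- u x) * pd i u x"
    using x u by (simp add: smooth_pd_exp smooth_minus smooth_pd_uminus)
  finally show ?thesis using n by (simp add: algebra_simps)
qed

lemma bdry_trace_conformal_metric:
  assumes xS: "x \<in> S3"
  shows "bdry_trace (conformal_metric u) T x
    = exp (- 2 * u x) * ((\<Sum>i\<in>UNIV. T i i x) - (\<Sum>i\<in>UNIV. \<Sum>j\<in>UNIV. x $ i * x $ j * T i j x))"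
proof -
  have e: "exp (- u x) * exp (- u x) = exp (- 2 * u x)" by (simp add: exp_add[symmetric])
  have "(ginv (conformal_metric u) i j x - normal (conformal_metric u) i x * normal (conformal_metric u) j x) * T i j x
    = kron i j * (exp (- 2 * u x) * T i j x) - exp (- 2 * u x) * (x $ i * x $ j * T i j x)" for i j
    using xS unfolding ginv_conformal_metric normal_conformal_metric e[symmetric]
    by (simp add: algebra_simps)
  then show ?thesis
    unfolding bdry_trace_def by (simp only: sum_subtractf sum_kron sum_distrib_left right_diff_distrib)
qed

text \<open>The two terms with the factor \<open>x $ i\<close> are normal in the first index and
  disappear in a tangential trace. On tangent vectors a multiple of the identity is left, which is
  the umbilicity of the boundary.\<close>

lemma nabla_normal_conformal_metric:
  assumes u: "u \<in> smooth_B4" and xS: "x \<in> S3"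
  shows "nabla_normal (conformal_metric u) i j x
    = exp (u x) * (kron i j * (1 + rad u x) - x $ i * x $ j - x $ i * pd j u x)"
proof -
  let ?g = "conformal_metric u"
  have x: "x \<in> B4" using S3_imp_B4[OF xS] .
  have n: "norm x = 1" using xS by simp
  have G: "(\<Sum>l\<in>UNIV. Christoffel ?g j i l x * normal ?g l x)
    = exp (- u x) * (pd i u x * x $ j + kron j i * rad u x - pd j u x * x $ i)"
  proof -
    have "Christoffel ?g j i l x * normal ?g l x = kron j l * (exp (- u x) * (pd i u x * x $ l))
      + exp (- u x) * kron j i * (x $ l * pd l u x) - kron i l * (exp (- u x) * (pd j u x * x $ l))" for l
      unfolding Christoffel_conformal_metric[OF u x] normal_conformal_metric n by (simp add: algebra_simps)
    then have "(\<Sum>l\<in>UNIV. Christoffel ?g j i l x * normal ?g l x) =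
      exp (- u x) * (pd i u x * x $ j) + exp (- u x) * kron j i * rad u x - exp (- u x) * (pd j u x * x $ i)"
      by (simp only: sum.distrib sum_subtractf sum_kron sum_distrib_left[symmetric] rad_def)
    then show ?thesis by (simp add: algebra_simps)
  qed
  have "nabla_normal ?g i j x = (\<Sum>k\<in>UNIV. kron j k * (exp (2 * u x) *
     (pd i (normal ?g k) x + (\<Sum>l\<in>UNIV. Christoffel ?g k i l x * normal ?g l x))))"
    unfolding nabla_normal_def conformal_metric_nth by (intro sum.cong refl) auto
  also have "\<dots> = exp (2 * u x) * (pd i (normal ?g j) x + (\<Sum>l\<in>UNIV. Christoffel ?g j i l x * normal ?g l x))"
    by (rule sum_kron)
  also have "\<dots> = exp (2 * u x) * (exp (- u x) * (kron i j * (1 + rad u x) - x $ i * x $ j - x $ i * pd j u x))"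
    unfolding G pd_normal_conformal_metric[OF u xS] by (simp add: algebra_simps)
  also have "\<dots> = exp (u x) * (kron i j * (1 + rad u x) - x $ i * x $ j - x $ i * pd j u x)"
    by (simp add: mult.assoc[symmetric] exp_add[symmetric])
  finally show ?thesis .
qed

lemma mean_curv_conformal_metric:
  assumes u: "u \<in> smooth_B4" and xS: "x \<in> S3"
  shows "mean_curv (conformal_metric u) x = exp (- u x) * (1 + rad u x)"
proof -
  define n where "n = (\<Sum>i\<in>UNIV. x $ i * x $ i)"
  have n: "n = 1" unfolding n_def by (rule S3_sum_squares[OF xS])
  let ?T = "\<lambda>i j. kron i j * (1 + rad u x) - x $ i * x $ j - x $ i * pd j u x"
  have 1: "(\<Sum>i\<in>UNIV. ?T i i) = 4 * (1 + rad u x) - n - rad u x"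
    by (simp add: sum.distrib sum_subtractf n_def rad_def)
  have "(\<Sum>j\<in>UNIV. x $ i * x $ j * ?T i j) = (x $ i * x $ i) * (1 + rad u x - n - rad u x)" for i
  proof -
    have "x $ i * x $ j * ?T i j = kron i j * (x $ i * x $ j * (1 + rad u x))
      - (x $ i * x $ i) * (x $ j * x $ j) - (x $ i * x $ i) * (x $ j * pd j u x)" for j
      by (simp add: algebra_simps)
    then have "(\<Sum>j\<in>UNIV. x $ i * x $ j * ?T i j) = x $ i * x $ i * (1 + rad u x)
      - (x $ i * x $ i) * n - (x $ i * x $ i) * rad u x"
      by (simp only: sum_subtractf sum_kron sum_distrib_left[symmetric] n_def rad_def)
    then show ?thesis by (simp add: algebra_simps)
  qed
  then have 2: "(\<Sum>i\<in>UNIV. \<Sum>j\<in>UNIV. x $ i * x $ j * ?T i j) = n * (1 + rad u x - n - rad u x)"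
    by (simp only: sum_distrib_right[symmetric] n_def)
  have "bdry_trace (conformal_metric u) (nabla_normal (conformal_metric u)) x =
    exp (- 2 * u x) * (exp (u x) * ((\<Sum>i\<in>UNIV. ?T i i) - (\<Sum>i\<in>UNIV. \<Sum>j\<in>UNIV. x $ i * x $ j * ?T i j)))"
    unfolding bdry_trace_conformal_metric[OF xS] nabla_normal_conformal_metric[OF u xS]
    by (simp only: right_diff_distrib sum_distrib_left mult.left_commute[of "exp (u x)"])
  also have "\<dots> = exp (- u x) * (3 * (1 + rad u x))"
    unfolding 1 2 n by (simp add: mult.assoc[symmetric] exp_add[symmetric])
  finally show ?thesis by (simp add: mean_curv_def)
qed

text \<open>The product of mean curvature and Schouten trace scales like the cube of the mean
  curvature, so the same exponential factors out of both terms.\<close>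

lemma H2_conformal_metric:
  assumes u: "u \<in> smooth_B4" and xS: "x \<in> S3"
  shows "H2 (conformal_metric u) x = exp (- 3 * u x) * bd_density u x"
proof -
  define n where "n = (\<Sum>i\<in>UNIV. x $ i * x $ i)"
  have n: "n = 1" unfolding n_def by (rule S3_sum_squares[OF xS])
  have x: "x \<in> B4" using S3_imp_B4[OF xS] .
  let ?A = "\<lambda>i j. - pd i (pd j u) x + pd i u x * pd j u x - kron i j * gdot u u x / 2"
  have 1: "(\<Sum>i\<in>UNIV. ?A i i) = - lap u x - gdot u u x"
    by (simp add: sum.distrib sum_subtractf sum_negf lap_def gdot_def)
  have "(\<Sum>j\<in>UNIV. x $ i * x $ j * ?A i j) = - (\<Sum>j\<in>UNIV. x $ i * x $ j * pd i (pd j u) x)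
    + x $ i * pd i u x * rad u x - x $ i * x $ i * (gdot u u x / 2)" for i
  proof -
    have "x $ i * x $ j * ?A i j = - (x $ i * x $ j * pd i (pd j u) x)
      + x $ i * pd i u x * (x $ j * pd j u x) - kron i j * (x $ i * x $ j * (gdot u u x / 2))" for j
      by (simp add: algebra_simps)
    then show ?thesis
      by (simp only: sum_subtractf sum.distrib sum_negf sum_kron sum_distrib_left[symmetric] rad_def)
  qed
  then have 2: "(\<Sum>i\<in>UNIV. \<Sum>j\<in>UNIV. x $ i * x $ j * ?A i j) = - rad2 u x + rad u x * rad u x - n * (gdot u u x / 2)"
    by (simp only: sum_subtractf sum.distrib sum_negf sum_distrib_right[symmetric] n_def rad2_def rad_def)
  have "bdry_trace (conformal_metric u) (Schouten (conformal_metric u)) x =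
    exp (- 2 * u x) * (- lap u x - gdot u u x - (- rad2 u x + rad u x * rad u x - gdot u u x / 2))"
    unfolding bdry_trace_conformal_metric[OF xS] Schouten_conformal_metric[OF u x] 1 2 n by simp
  moreover have e3: "exp (- u x) * exp (- 2 * u x) = exp (- 3 * u x)" and "exp (- u x) ^ 3 = exp (- 3 * u x)"
    by (simp_all add: exp_add[symmetric] exp_of_nat_mult[symmetric])
  moreover have factor: "a * r * (b * t) + c * r ^ 3 = c * (r * t + r ^ 3)" if "a * b = c" for a b c r t :: real
    using that by (auto simp: algebra_simps)
  ultimately have "H2 (conformal_metric u) x = exp (- 3 * u x) *
    ((1 + rad u x) * (- lap u x - gdot u u x - (- rad2 u x + rad u x * rad u x - gdot u u x / 2)) + (1 + rad u x) ^ 3)"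
    unfolding H2_def mean_curv_conformal_metric[OF u xS] power_mult_distrib
    using factor[OF e3] by simp
  also have "(1 + rad u x) * (- lap u x - gdot u u x - (- rad2 u x + rad u x * rad u x - gdot u u x / 2)) + (1 + rad u x) ^ 3
    = bd_density u x"
    by (simp add: bd_density_def lapS_def tdot_def field_simps power2_eq_square power3_eq_cube)
  finally show ?thesis .
qed

text \<open>An orthogonal matrix with first column x conjugates the projection \<open>X\<close> to
  the diagonal matrix \<open>E\<close>. The determinant is therefore that of the diagonal matrix
  with entries 1, c, c, c, where \<open>c = exp (2 * u x)\<close>.\<close>

lemma bdry_density_conformal_metric:
  assumes xS: "x \<in> S3"
  shows "bdry_density (conformal_metric u) x = exp (3 * u x)"
proof -
  define c where "c = exp (2 * u x)"
  define X :: "real^4^4" where "X = (\<chi> i j. x $ i * x $ j)"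
  define E :: "real^4^4" where "E = (\<chi> i j. if i = 1 \<and> j = 1 then 1 else 0)"
  define D :: "real^4^4" where "D = c *\<^sub>R (mat 1 - E) + E"
  have n: "norm x = 1" using xS by simp
  have add_l: "A ** (B + C) = A ** B + A ** C" and add_r: "(B + C) ** A = B ** A + C ** A"
    and diff_l: "A ** (B - C) = A ** B - A ** C" and diff_r: "(B - C) ** A = B ** A - C ** A"
    for A B C :: "real^4^4"
    by (simp_all add: matrix_matrix_mult_def vec_eq_iff sum.distrib sum_subtractf algebra_simps)
  obtain P :: "real^4^4" where P: "orthogonal_matrix P" "P *v axis 1 1 = x"
    using orthogonal_matrix_exists_basis[OF n] by metis
  have Pi1: "P $ i $ 1 = x $ i" for i
    using P(2) by (simp add: matrix_vector_mult_basis column_def vec_eq_iff)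
  have PP: "P ** transpose P = mat 1" using P(1) by (simp add: orthogonal_matrix_def)
  have PE: "P ** E ** transpose P = X"
  proof -
    have "(P ** E) $ i $ k = (if k = 1 then x $ i else 0)" for i k
      by (simp add: matrix_matrix_mult_def E_def Pi1 if_distrib[where f = "\<lambda>a. _ * a"] cong: if_cong)
    then have "(P ** E ** transpose P) $ i $ j = x $ i * x $ j" for i j
      by (simp add: matrix_matrix_mult_def[of "P ** E"] transpose_def Pi1
          if_distrib[where f = "\<lambda>a. a * _"] cong: if_cong)
    then show ?thesis by (simp add: vec_eq_iff X_def)
  qed
  have XX: "X ** X = X"
  proof -
    have "(X ** X) $ i $ j = x $ i * (\<Sum>k\<in>UNIV. x $ k * x $ k) * x $ j" for i j
      by (simp add: matrix_matrix_mult_def X_def sum_distrib_left sum_distrib_right mult_ac)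
    then show ?thesis by (simp add: vec_eq_iff X_def S3_sum_squares[OF xS])
  qed
  have "(mat 1 - X) ** conformal_metric u x ** (mat 1 - X) = c *\<^sub>R ((mat 1 - X) ** (mat 1 - X))"
    by (simp add: conformal_metric_def flat_metric_def c_def scalar_matrix_assoc matrix_scalar_ac)
  also have "(mat 1 - X) ** (mat 1 - X) = mat 1 - X"
    using XX by (simp add: diff_l diff_r)
  finally have "(mat 1 - X) ** conformal_metric u x ** (mat 1 - X) + X = c *\<^sub>R (mat 1 - X) + X" by simp
  also have "\<dots> = P ** D ** transpose P"
    unfolding D_def
    by (simp add: add_l add_r diff_l diff_r
        scalar_matrix_assoc[symmetric] matrix_scalar_ac PE PP scaleR_diff_right)
  finally have "det ((mat 1 - X) ** conformal_metric u x ** (mat 1 - X) + X) = det P * det D * det (transpose P)"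
    by (simp add: det_mul)
  also have "\<dots> = det D" using det_orthogonal_matrix[OF P(1)] by (auto simp: det_transpose)
  also have "det D = (\<Prod>i\<in>UNIV. D $ i $ i)"
    by (rule det_diagonal) (auto simp: D_def E_def mat_def)
  also have "\<dots> = c ^ 3"
    unfolding UNIV_4 by (simp add: D_def E_def mat_def power3_eq_cube)
  also have "c ^ 3 = (exp (3 * u x))\<^sup>2"
    by (simp add: c_def exp_of_nat_mult[symmetric])
  finally show ?thesis by (simp add: bdry_density_def X_def[symmetric] Let_def)
qed

section \<open>The functional in flat coordinates\<close>

lemma integral_B4_conformal_metric: "integral_B4 (conformal_metric u) f = vol (\<lambda>x. f x * exp (4 * u x))"
proof -
  have "sqrt (det (conformal_metric u x)) = exp (4 * u x)" for x
  proof -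
    have "det (conformal_metric u x) = (\<Prod>i\<in>(UNIV::4 set). exp (2 * u x))"
      by (subst det_diagonal) (simp_all add: conformal_metric_nth)
    also have "\<dots> = (exp (4 * u x))\<^sup>2" by (simp add: exp_of_nat_mult[symmetric])
    finally show ?thesis by simp
  qed
  then show ?thesis by (simp add: integral_B4_def vol_def)
qed

lemma integral_S3_conformal_metric: "integral_S3 (conformal_metric u) f = surf (\<lambda>x. f x * exp (3 * u x))"
  unfolding integral_S3_def surf_def[symmetric]
  by (intro surf_cong) (simp add: bdry_density_conformal_metric)

lemma F2_eq_path_integral:
  assumes u: "u \<in> smooth_B4"
  shows "F2 u = (LINT s:{0..1}|lborel. vol (\<lambda>x. u x * int_density (\<lambda>x. s * u x) x)
    + surf (\<lambda>x. u x * bd_density (\<lambda>x. s * u x) x))"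
proof -
  have 1: "integral_B4 (conformal_metric (\<lambda>x. s * u x)) (\<lambda>x. u x * sigma2 (conformal_metric (\<lambda>x. s * u x)) x)
    = vol (\<lambda>x. u x * int_density (\<lambda>x. s * u x) x)" for s
  proof -
    have su: "(\<lambda>x. s * u x) \<in> smooth_B4" by (intro smooth_intros u)
    show ?thesis
      unfolding integral_B4_conformal_metric
      by (intro vol_cong) (simp add: sigma2_conformal_metric[OF su] exp_minus field_simps)
  qed
  have 2: "integral_S3 (conformal_metric (\<lambda>x. s * u x)) (\<lambda>x. u x * H2 (conformal_metric (\<lambda>x. s * u x)) x)
    = surf (\<lambda>x. u x * bd_density (\<lambda>x. s * u x) x)" for s
  proof -
    have su: "(\<lambda>x. s * u x) \<in> smooth_B4" by (intro smooth_intros u)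
    show ?thesis
      unfolding integral_S3_conformal_metric
      by (intro surf_cong) (simp add: H2_conformal_metric[OF su] exp_minus field_simps)
  qed
  show ?thesis unfolding F2_def Let_def 1 2 ..
qed


section \<open>The functional as a quartic energy\<close>

text \<open>The integral over s from 0 to 1 of the weak form at \<open>s * u\<close>, tested with u.
  Its terms have degree 0, 1, 2, 3 in s; with the factor 1/2 in front of the last two this gives the
  coefficients 1, 1/2, 1/6 and -1/8.\<close>

definition energy :: "(real^4 \<Rightarrow> real) \<Rightarrow> real" where
  "energy u = surf u + surf (tdot u u) / 2 + cubic_form u u u / 6 - vol (\<lambda>x. (gdot u u x)\<^sup>2) / 8"

lemma pd_linear:
  assumes "u \<in> smooth_B4" "v \<in> smooth_B4" "x \<in> B4"
  shows "pd i (\<lambda>x. u x + t * v x) x = pd i u x + t * pd i v x"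
  using assms by (simp add: smooth_pd_add smooth_mult)

lemma pd_pd_linear:
  assumes "u \<in> smooth_B4" "v \<in> smooth_B4" "x \<in> B4"
  shows "pd i (pd j (\<lambda>x. u x + t * v x)) x = pd i (pd j u) x + t * pd i (pd j v) x"
proof -
  have "pd i (pd j (\<lambda>x. u x + t * v x)) x = pd i (\<lambda>x. pd j u x + t * pd j v x) x"
    using assms by (intro pd_cong pd_linear)
  then show ?thesis using assms by (simp add: pd_linear smooth_pd)
qed

lemma differential_linear:
  assumes "u \<in> smooth_B4" "v \<in> smooth_B4" "x \<in> B4"
  shows "rad (\<lambda>x. u x + t * v x) x = rad u x + t * rad v x"
    and "lap (\<lambda>x. u x + t * v x) x = lap u x + t * lap v x"
    and "gdot (\<lambda>x. u x + t * v x) w x = gdot u w x + t * gdot v w x"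
    and "gdot w (\<lambda>x. u x + t * v x) x = gdot w u x + t * gdot w v x"
    and "hess (\<lambda>x. u x + t * v x) w w' x = hess u w w' x + t * hess v w w' x"
    and "tdot (\<lambda>x. u x + t * v x) w x = tdot u w x + t * tdot v w x"
    and "tdot w (\<lambda>x. u x + t * v x) x = tdot w u x + t * tdot w v x"
proof -
  note p = pd_linear[OF assms] pd_pd_linear[OF assms]
  show 1: "rad (\<lambda>x. u x + t * v x) x = rad u x + t * rad v x"
    and "lap (\<lambda>x. u x + t * v x) x = lap u x + t * lap v x"
    and 2: "gdot (\<lambda>x. u x + t * v x) w x = gdot u w x + t * gdot v w x"
    and 3: "gdot w (\<lambda>x. u x + t * v x) x = gdot w u x + t * gdot w v x" for w
    unfolding rad_def lap_def gdot_def p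
    by (simp_all add: sum.distrib sum_distrib_left algebra_simps)
  show "hess (\<lambda>x. u x + t * v x) w w' x = hess u w w' x + t * hess v w w' x"
    unfolding hess_def p by (simp add: sum.distrib sum_distrib_left algebra_simps)
  show "tdot (\<lambda>x. u x + t * v x) w x = tdot u w x + t * tdot v w x"
    and "tdot w (\<lambda>x. u x + t * v x) x = tdot w u x + t * tdot w v x"
    unfolding tdot_def 1 2 3 by (simp_all add: algebra_simps)
qed

lemma homogeneous:
  assumes u: "u \<in> smooth_B4" and x: "x \<in> B4"
  shows "rad (\<lambda>x. s * u x) x = s * rad u x" "lap (\<lambda>x. s * u x) x = s * lap u x"
    "gdot (\<lambda>x. s * u x) w x = s * gdot u w x" "gdot w (\<lambda>x. s * u x) x = s * gdot w u x"
    "hess (\<lambda>x. s * u x) w w' x = s * hess u w w' x" "hess w (\<lambda>x. s * u x) w' x = s * hess w u w' x"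
    "tdot (\<lambda>x. s * u x) w x = s * tdot u w x"
proof -
  have z: "(\<lambda>_. 0) \<in> smooth_B4" by simp
  have p0: "pd i (pd j (\<lambda>_. 0)) x = 0" for i j
    using x pd_cong[OF x, of "pd j (\<lambda>_. 0)" "\<lambda>_. 0" i] by simp
  note d = differential_linear[where t = s, OF z u x]
  have p: "pd i (\<lambda>x. s * u x) x = s * pd i u x" for i
    using pd_linear[OF z u x, of i s] x by simp
  show 1: "rad (\<lambda>x. s * u x) x = s * rad u x" using d(1) x by (simp add: rad_def)
  show "lap (\<lambda>x. s * u x) x = s * lap u x" using d(2) p0 by (simp add: lap_def)
  show 2: "gdot (\<lambda>x. s * u x) w x = s * gdot u w x" using d(3) x by (simp add: gdot_def)
  show "gdot w (\<lambda>x. s * u x) x = s * gdot w u x" using d(4) x by (simp add: gdot_def)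
  show "hess (\<lambda>x. s * u x) w w' x = s * hess u w w' x" using d(5) p0 by (simp add: hess_def)
  show "hess w (\<lambda>x. s * u x) w' x = s * hess w u w' x"
    unfolding hess_def p by (simp add: sum_distrib_left algebra_simps)
  show "tdot (\<lambda>x. s * u x) w x = s * tdot u w x" unfolding tdot_def 1 2 by (simp add: algebra_simps)
qed

lemma F2_eq_energy:
  assumes u: "u \<in> smooth_B4"
  shows "F2 u = energy u"
proof -
  define A where "A = surf u"
  define B where "B = surf (tdot u u)"
  define C where "C = cubic_form u u u"
  define D where "D = vol (\<lambda>x. (gdot u u x)\<^sup>2)"
  have I: "vol (\<lambda>x. u x * int_density (\<lambda>x. s * u x) x) + surf (\<lambda>x. u x * bd_density (\<lambda>x. s * u x) x)
    = A + s * B + s\<^sup>2 / 2 * C - s^3 / 2 * D" for s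
  proof -
    let ?su = "\<lambda>x. s * u x"
    have su: "?su \<in> smooth_B4" by (intro smooth_intros u)
    let ?r = "\<lambda>x. rad u x * tdot u u x" and ?l = "\<lambda>x. lap u x * gdot u u x - hess u u u x"
    have "surf (\<lambda>x. (1 + rad ?su x / 2) * tdot ?su u x) = surf (\<lambda>x. s * tdot u u x + s\<^sup>2 / 2 * ?r x)"
      by (rule surf_cong)
        (simp add: homogeneous[OF u S3_imp_B4] power2_eq_square algebra_simps del: mem_sphere_0 mem_sphere)
    also have "\<dots> = surf (\<lambda>x. s * tdot u u x) + surf (\<lambda>x. s\<^sup>2 / 2 * ?r x)"
      by (intro surf_add_smooth smooth_intros u)
    also have "\<dots> = s * B + s\<^sup>2 / 2 * surf ?r" unfolding surf_cmult B_def ..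
    finally have 1: "surf (\<lambda>x. (1 + rad ?su x / 2) * tdot ?su u x) = s * B + s\<^sup>2 / 2 * surf ?r" .
    have "vol (\<lambda>x. lap ?su x * gdot ?su u x - hess ?su ?su u x + gdot ?su ?su x * gdot ?su u x)
      = vol (\<lambda>x. s\<^sup>2 * ?l x + s^3 * (gdot u u x)\<^sup>2)"
      by (rule vol_cong) (simp add: homogeneous[OF u] power2_eq_square power3_eq_cube algebra_simps)
    also have "\<dots> = vol (\<lambda>x. s\<^sup>2 * ?l x) + vol (\<lambda>x. s^3 * (gdot u u x)\<^sup>2)"
      by (intro vol_add smooth_intros smooth_power u)
    also have "\<dots> = s\<^sup>2 * vol ?l + s^3 * D" unfolding vol_cmult D_def ..
    finally have 2: "vol (\<lambda>x. lap ?su x * gdot ?su u x - hess ?su ?su u x + gdot ?su ?su x * gdot ?su u x)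
      = s\<^sup>2 * vol ?l + s^3 * D" .
    show ?thesis
      unfolding weak_form[OF su u] 1 2 A_def[symmetric] C_def cubic_form_def by (simp add: field_simps)
  qed
  let ?P = "\<lambda>s. s * A + s\<^sup>2 / 2 * B + s^3 / 6 * C - s^4 / 8 * D"
  have "F2 u = (LINT s|lborel. (A + s * B + s\<^sup>2 / 2 * C - s^3 / 2 * D) * indicator {0..1} s)"
    unfolding F2_eq_path_integral[OF u] I set_lebesgue_integral_def by (simp add: mult.commute)
  also have "\<dots> = ?P 1 - ?P 0"
  proof (rule integral_FTC_Icc_real)
    show "(?P has_real_derivative A + s * B + s\<^sup>2 / 2 * C - s ^ 3 / 2 * D) (at s)" for s
      by (auto intro!: derivative_eq_intros simp: power2_eq_square power3_eq_cube algebra_simps)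
  qed (auto intro!: continuous_intros)
  finally show ?thesis by (simp add: energy_def A_def B_def C_def D_def)
qed

lemma cubic_form_linear_left:
  assumes u: "u \<in> smooth_B4" and v: "v \<in> smooth_B4" and w: "w \<in> smooth_B4" "w' \<in> smooth_B4"
  shows "cubic_form (\<lambda>x. u x + t * v x) w w' = cubic_form u w w' + t * cubic_form v w w'"
proof -
  have "surf (\<lambda>x. rad (\<lambda>x. u x + t * v x) x * tdot w w' x)
    = surf (\<lambda>x. rad u x * tdot w w' x + t * (rad v x * tdot w w' x))"
    by (rule surf_cong)
      (simp add: differential_linear[OF u v S3_imp_B4] algebra_simps del: mem_sphere_0 mem_sphere)
  also have "\<dots> = surf (\<lambda>x. rad u x * tdot w w' x) + surf (\<lambda>x. t * (rad v x * tdot w w' x))"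
    by (intro surf_add_smooth smooth_intros u v w)
  finally have 1: "surf (\<lambda>x. rad (\<lambda>x. u x + t * v x) x * tdot w w' x)
    = surf (\<lambda>x. rad u x * tdot w w' x) + t * surf (\<lambda>x. rad v x * tdot w w' x)"
    unfolding surf_cmult .
  let ?l = "\<lambda>u x. lap u x * gdot w w' x - hess u w w' x"
  have "vol (?l (\<lambda>x. u x + t * v x)) = vol (\<lambda>x. ?l u x + t * ?l v x)"
    by (rule vol_cong) (simp add: differential_linear[OF u v] algebra_simps)
  also have "\<dots> = vol (?l u) + vol (\<lambda>x. t * ?l v x)"
    by (intro vol_add smooth_intros u v w)
  finally have 2: "vol (?l (\<lambda>x. u x + t * v x)) = vol (?l u) + t * vol (?l v)"
    unfolding vol_cmult .
  show ?thesis unfolding cubic_form_def 1 2 by (simp add: algebra_simps)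
qed

text \<open>Linearity in the first argument passes to the other two by symmetry, and the mixed
  values collect in the binomial pattern.\<close>

lemma cubic_form_expand:
  assumes u: "u \<in> smooth_B4" and v: "v \<in> smooth_B4"
  defines "w t \<equiv> \<lambda>x. u x + t * v x"
  shows "cubic_form (w t) (w t) (w t) = cubic_form u u u + 3 * t * cubic_form u u v
    + 3 * t\<^sup>2 * cubic_form u v v + t^3 * cubic_form v v v"
proof -
  have w: "w t \<in> smooth_B4" unfolding w_def by (intro smooth_intros u v)
  note l = cubic_form_commute_left and r = cubic_form_commute_right
  have 1: "cubic_form (w t) a b = cubic_form u a b + t * cubic_form v a b"
    if "a \<in> smooth_B4" "b \<in> smooth_B4" for a b
    unfolding w_def by (rule cubic_form_linear_left[OF u v that])
  have 2: "cubic_form a (w t) b = cubic_form a u b + t * cubic_form a v b"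
    if a: "a \<in> smooth_B4" and b: "b \<in> smooth_B4" for a b
    unfolding l[OF a w b] 1[OF a b] l[OF u a b] l[OF v a b] ..
  have 3: "cubic_form a b (w t) = cubic_form a b u + t * cubic_form a b v"
    if a: "a \<in> smooth_B4" and b: "b \<in> smooth_B4" for a b
    unfolding r[OF a, of b] 2[OF a b] ..
  have s: "cubic_form u v u = cubic_form u u v" "cubic_form v u u = cubic_form u u v"
    "cubic_form v u v = cubic_form u v v" "cubic_form v v u = cubic_form u v v"
    using l[OF v u u] l[OF v u v] r[OF u, of v u] r[OF v, of v u] by simp_all
  show ?thesis
    unfolding 1[OF w w] 2[OF u w] 2[OF v w] 3[OF u u] 3[OF u v] 3[OF v u] 3[OF v v] s
    by (simp add: power2_eq_square power3_eq_cube algebra_simps)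
qed

text \<open>Twice the coefficient of t^2 in \<open>energy (\<lambda>x. u x + t * v x)\<close>. The
  boundary part of \<open>cubic_form u v v\<close> combines with the first term to the weight
  \<open>1 + rad u\<close>.\<close>

definition second_variation :: "(real^4 \<Rightarrow> real) \<Rightarrow> (real^4 \<Rightarrow> real) \<Rightarrow> real" where
  "second_variation u v = surf (tdot v v) + cubic_form u v v
     - vol (\<lambda>x. (gdot u v x)\<^sup>2 + gdot u u x * gdot v v x / 2)"

lemma energy_expand:
  assumes u: "u \<in> smooth_B4" and v: "v \<in> smooth_B4"
  obtains a b c where "\<And>t. energy (\<lambda>x. u x + t * v x) =
    energy u + a * t + second_variation u v / 2 * t\<^sup>2 + b * t^3 + c * t^4"
proof -
  let ?w = "\<lambda>t x. u x + t * v x"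
  have 1: "surf (?w t) = surf u + t * surf v" for t
    unfolding surf_cmult[symmetric]
    by (intro surf_add_smooth smooth_intros u v)
  have 2: "surf (tdot (?w t) (?w t)) = surf (tdot u u) + 2 * t * surf (tdot u v) + t\<^sup>2 * surf (tdot v v)" for t
  proof -
    have "surf (tdot (?w t) (?w t)) = surf (\<lambda>x. (tdot u u x + (2 * t) * tdot u v x) + t\<^sup>2 * tdot v v x)"
    proof (rule surf_cong)
      fix x assume "x \<in> S3"
      then have x: "x \<in> B4" by (rule S3_imp_B4)
      have "tdot v u x = tdot u v x" by (simp add: tdot_def gdot_def mult.commute)
      then show "tdot (?w t) (?w t) x = (tdot u u x + (2 * t) * tdot u v x) + t\<^sup>2 * tdot v v x"
        by (simp add: differential_linear[OF u v x] power2_eq_square algebra_simps)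
    qed
    also have "\<dots> = surf (\<lambda>x. tdot u u x + (2 * t) * tdot u v x) + surf (\<lambda>x. t\<^sup>2 * tdot v v x)"
      by (intro surf_add_smooth smooth_intros u v)
    also have "surf (\<lambda>x. tdot u u x + (2 * t) * tdot u v x) = surf (tdot u u) + surf (\<lambda>x. (2 * t) * tdot u v x)"
      by (intro surf_add_smooth smooth_intros u v)
    finally show ?thesis unfolding surf_cmult .
  qed
  let ?a = "\<lambda>x. gdot u u x" and ?b = "\<lambda>x. gdot u v x" and ?c = "\<lambda>x. gdot v v x"
  have 3: "vol (\<lambda>x. (gdot (?w t) (?w t) x)\<^sup>2) = vol (\<lambda>x. (?a x)\<^sup>2) + (4 * t) * vol (\<lambda>x. ?a x * ?b x)
    + (4 * t\<^sup>2) * vol (\<lambda>x. (?b x)\<^sup>2 + ?a x * ?c x / 2) + (4 * t^3) * vol (\<lambda>x. ?b x * ?c x)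
    + t^4 * vol (\<lambda>x. (?c x)\<^sup>2)" for t
  proof -
    have sm: "(\<lambda>x. (?a x)\<^sup>2) \<in> smooth_B4" "(\<lambda>x. ?a x * ?b x) \<in> smooth_B4"
      "(\<lambda>x. (?b x)\<^sup>2 + ?a x * ?c x / 2) \<in> smooth_B4" "(\<lambda>x. ?b x * ?c x) \<in> smooth_B4"
      "(\<lambda>x. (?c x)\<^sup>2) \<in> smooth_B4"
      unfolding divide_inverse
      by (intro smooth_intros smooth_power u v)+
    have vadd: "vol (\<lambda>x. f x + k * g x) = vol f + k * vol g" if "f \<in> smooth_B4" "g \<in> smooth_B4" for f g k
      unfolding vol_cmult[symmetric] using that by (intro vol_add smooth_intros)
    have "gdot v u x = gdot u v x" for x by (simp add: gdot_def mult.commute)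
    then have "vol (\<lambda>x. (gdot (?w t) (?w t) x)\<^sup>2) = vol (\<lambda>x. (((?a x)\<^sup>2 + (4 * t) * (?a x * ?b x))
      + (4 * t\<^sup>2) * ((?b x)\<^sup>2 + ?a x * ?c x / 2)) + (4 * t^3) * (?b x * ?c x) + t^4 * (?c x)\<^sup>2)"
      by (intro vol_cong) (simp add: differential_linear[OF u v] power2_eq_square power3_eq_cube power4_eq_xxxx algebra_simps)
    also have "\<dots> = vol (\<lambda>x. (?a x)\<^sup>2) + (4 * t) * vol (\<lambda>x. ?a x * ?b x)
    + (4 * t\<^sup>2) * vol (\<lambda>x. (?b x)\<^sup>2 + ?a x * ?c x / 2) + (4 * t^3) * vol (\<lambda>x. ?b x * ?c x)
    + t^4 * vol (\<lambda>x. (?c x)\<^sup>2)"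
    proof -
      have S2: "(\<lambda>x. (?a x)\<^sup>2 + (4 * t) * (?a x * ?b x)) \<in> smooth_B4"
        by (intro smooth_intros smooth_mult[OF ] sm)
      have S3: "(\<lambda>x. ((?a x)\<^sup>2 + (4 * t) * (?a x * ?b x))
        + (4 * t\<^sup>2) * ((?b x)\<^sup>2 + ?a x * ?c x / 2)) \<in> smooth_B4"
        by (intro smooth_add[OF S2] smooth_mult[OF smooth_const] sm)
      have S4: "(\<lambda>x. (((?a x)\<^sup>2 + (4 * t) * (?a x * ?b x))
        + (4 * t\<^sup>2) * ((?b x)\<^sup>2 + ?a x * ?c x / 2)) + (4 * t^3) * (?b x * ?c x)) \<in> smooth_B4"
        by (intro smooth_add[OF S3] smooth_mult[OF smooth_const] sm)
      show ?thesis
        unfolding vadd[OF S4 sm(5)] vadd[OF S3 sm(4)] vadd[OF S2 sm(3)] vadd[OF sm(1,2)] ..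
    qed
    finally show ?thesis .
  qed
  show ?thesis
    by (rule that[of "surf v + surf (tdot u v) + cubic_form u u v / 2 - vol (\<lambda>x. ?a x * ?b x) / 2"
          "cubic_form v v v / 6 - vol (\<lambda>x. ?b x * ?c x) / 2" "- vol (\<lambda>x. (?c x)\<^sup>2) / 8"])
      (simp add: energy_def 1 2 3 cubic_form_expand[OF u v] second_variation_def field_simps)
qed

text \<open>All terms except \<open>surf u\<close> depend on derivatives only. The slope
  \<open>omega3\<close> is the sum of the total interior and boundary curvatures, which has the same
  value for every u, as in the Gauss-Bonnet formula.\<close>

lemma energy_add_const:
  assumes u: "u \<in> smooth_B4"
  shows "energy (\<lambda>x. u x + c) = energy u + c * omega3"
proof -
  have p: "pd i (\<lambda>x. u x + c) x = pd i u x" if "x \<in> B4" for i x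
    using u that by (simp add: smooth_pd_add)
  have pp: "pd i (pd j (\<lambda>x. u x + c)) x = pd i (pd j u) x" if "x \<in> B4" for i j x
    using pd_cong[OF that, of "pd j (\<lambda>x. u x + c)" "pd j u" i] p by simp
  have g: "gdot (\<lambda>x. u x + c) (\<lambda>x. u x + c) x = gdot u u x" "rad (\<lambda>x. u x + c) x = rad u x"
    "lap (\<lambda>x. u x + c) x = lap u x"
    "hess (\<lambda>x. u x + c) (\<lambda>x. u x + c) (\<lambda>x. u x + c) x = hess u u u x" if "x \<in> B4" for x
    using that by (simp_all add: gdot_def rad_def lap_def hess_def p pp)
  have t: "tdot (\<lambda>x. u x + c) (\<lambda>x. u x + c) x = tdot u u x" if "x \<in> B4" for x
    using that by (simp add: tdot_def g)
  have 1: "surf (\<lambda>x. u x + c) = surf u + c * omega3"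
    unfolding surf_const[symmetric] by (intro surf_add_smooth smooth_const u)
  have 2: "surf (tdot (\<lambda>x. u x + c) (\<lambda>x. u x + c)) = surf (tdot u u)"
    by (intro surf_cong t S3_imp_B4)
  have 3: "cubic_form (\<lambda>x. u x + c) (\<lambda>x. u x + c) (\<lambda>x. u x + c) = cubic_form u u u"
    unfolding cubic_form_def
    by (intro arg_cong2[where f = "(-)"] surf_cong vol_cong) (simp_all add: g t S3_imp_B4 del: mem_sphere_0 mem_sphere)
  have 4: "vol (\<lambda>x. (gdot (\<lambda>x. u x + c) (\<lambda>x. u x + c) x)\<^sup>2) = vol (\<lambda>x. (gdot u u x)\<^sup>2)"
    by (intro vol_cong) (simp add: g)
  show ?thesis unfolding energy_def 1 2 3 4 by simp
qed


section \<open>The second variation inequality\<close>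

lemma vol_nonneg: "(\<And>x. x \<in> B4 \<Longrightarrow> 0 \<le> f x) \<Longrightarrow> 0 \<le> vol f"
  unfolding vol_def set_lebesgue_integral_def
  by (rule Bochner_Integration.integral_nonneg) (simp add: indicator_def)

lemma vol_1_pos: "vol (\<lambda>_. 1) > 0"
proof -
  have "vol (\<lambda>_. 1) = measure lborel (cball (0::real^4) 1)"
    by (simp add: vol_def set_lebesgue_integral_def)
  then show ?thesis using content_cball_pos[of 1 "0::real^4"] by simp
qed

text \<open>The divergence theorem for the position field equates \<open>omega3\<close> with 4 times
  the volume of the ball.\<close>

lemma omega3_pos: "omega3 > 0"
proof -
  have "(\<Sum>i\<in>UNIV. vol (pd i (\<lambda>x. x $ i))) = (\<Sum>i\<in>UNIV. surf (\<lambda>x. x $ i * x $ i))"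
    by (intro sum.cong refl divergence_theorem_B4 smooth_nth)
  also have "\<dots> = surf (\<lambda>x. \<Sum>i\<in>UNIV. x $ i * x $ i)"
    by (intro surf_sum[symmetric] smooth_continuous_S3 smooth_intros)
  also have "\<dots> = surf (\<lambda>_. 1)"
    by (intro surf_cong S3_sum_squares)
  also have "\<dots> = omega3" using surf_const[of 1] by simp
  finally have "omega3 = (\<Sum>i\<in>(UNIV::4 set). vol (pd i (\<lambda>x. x $ i)))" ..
  moreover have "vol (pd i (\<lambda>x. x $ i)) = vol (\<lambda>_. 1)" for i
    by (intro vol_cong) (simp add: pd_nth)
  ultimately show ?thesis using vol_1_pos by simp
qed

text \<open>The Taylor remainder of the even order 4 is nonnegative. This bounds the boundary volume
  along \<open>u + t * v\<close> from below by a polynomial in t, without differentiation under the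
  integral.\<close>

lemma exp_ge_cubic: "1 + y + y\<^sup>2 / 2 + y^3 / 6 \<le> exp y" for y :: real
proof -
  obtain t where "exp y = (\<Sum>m<4. y ^ m / fact m) + exp t / fact 4 * y ^ 4"
    using Maclaurin_exp_le[of y 4] by auto
  moreover have "(\<Sum>m<4. y ^ m / fact m) = 1 + y + y\<^sup>2 / 2 + y^3 / 6"
    by (simp add: eval_nat_numeral)
  ultimately show ?thesis by simp
qed

lemma bdry_vol_conformal_metric: "bdry_vol (conformal_metric u) = surf (\<lambda>x. exp (3 * u x))"
  by (simp add: bdry_vol_def integral_S3_conformal_metric)

lemma iter_pd_linear:
  assumes "u \<in> smooth_B4" "v \<in> smooth_B4" "x \<in> B4"
  shows "iter_pd js (\<lambda>x. u x + t * v x) x = iter_pd js u x + t * iter_pd js v x"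
  using assms(3)
proof (induction js arbitrary: x)
  case (Cons i js)
  have sm: "iter_pd js f \<in> smooth_B4" if "f \<in> smooth_B4" for f
    using that by (induction js) (auto intro: smooth_pd)
  have "pd i (iter_pd js (\<lambda>x. u x + t * v x)) x = pd i (\<lambda>x. iter_pd js u x + t * iter_pd js v x) x"
    by (intro pd_cong Cons)
  then show ?case using sm assms(1,2) Cons.prems by (simp add: pd_linear)
qed simp

lemma smooth_iter_pd: "f \<in> smooth_B4 \<Longrightarrow> iter_pd js f \<in> smooth_B4"
  by (induction js) (auto intro: smooth_pd)

text \<open>A single bound serves all derivatives up to order k because there are finitely many
  index lists of length at most k.\<close>

lemma iter_pd_bounded:
  assumes v: "v \<in> smooth_B4"
  obtains M where "M > 0" "\<And>js x. length js \<le> k \<Longrightarrow> x \<in> B4 \<Longrightarrow> \<bar>iter_pd js v x\<bar> \<le> M"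
proof -
  have "\<exists>M. \<forall>x\<in>B4. \<bar>iter_pd js v x\<bar> \<le> M" for js
  proof -
    obtain M where "\<And>x. x \<in> B4 \<Longrightarrow> \<bar>iter_pd js v x\<bar> \<le> M"
      by (rule smooth_bounded[OF smooth_iter_pd[OF v, of js]]) blast
    then show ?thesis by blast
  qed
  then obtain N where N: "\<And>js x. x \<in> B4 \<Longrightarrow> \<bar>iter_pd js v x\<bar> \<le> N js"
    using choice[of "\<lambda>js M. \<forall>x\<in>B4. \<bar>iter_pd js v x\<bar> \<le> M"] by blast
  have fin: "finite {js :: 4 list. length js \<le> k}"
    using finite_lists_length_le[of "UNIV :: 4 set" k] by simp
  define M where "M = 1 + (\<Sum>js | length js \<le> k. \<bar>N js\<bar>)"
  have "\<bar>iter_pd js v x\<bar> \<le> M" if "length js \<le> k" "x \<in> B4" for js x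
  proof -
    have "\<bar>N js\<bar> \<le> (\<Sum>js | length js \<le> k. \<bar>N js\<bar>)"
      using that fin by (intro member_le_sum) auto
    with N[OF that(2), of js] show ?thesis unfolding M_def by linarith
  qed
  moreover have "M > 0" unfolding M_def by (intro add_pos_nonneg sum_nonneg) auto
  ultimately show ?thesis by (rule that[rotated])
qed

text \<open>The logarithm is the cost of returning to the constraint set by adding a constant.\<close>

lemma energy_minimal_nearby:
  assumes u: "u \<in> smooth_B4" and min: "local_minimizer_F2 u"
    and vol: "surf (\<lambda>x. exp (3 * u x)) = omega3" and v: "v \<in> smooth_B4"
  obtains \<delta> where "\<delta> > 0" "\<And>t. \<bar>t\<bar> < \<delta> \<Longrightarrow>
    energy u + omega3 / 3 * ln (surf (\<lambda>x. exp (3 * (u x + t * v x))) / omega3) \<le> energy (\<lambda>x. u x + t * v x)"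
proof -
  obtain U where U: "openin Cinf_topology U" "u \<in> U" "\<And>w. w \<in> U \<Longrightarrow> conformal_metric w \<in> V \<Longrightarrow> F2 u \<le> F2 w"
    using min by (auto simp: local_minimizer_F2_def)
  obtain k e where e: "e > 0" "Cinf_ball u k e \<subseteq> U"
    using U(1,2) unfolding openin_Cinf_topology by blast
  obtain M where M: "M > 0" "\<And>js x. length js \<le> k \<Longrightarrow> x \<in> B4 \<Longrightarrow> \<bar>iter_pd js v x\<bar> \<le> M"
    using iter_pd_bounded[OF v, of k] by blast
  have vM: "\<bar>v x\<bar> \<le> M" if "x \<in> B4" for x using M(2)[of "[]" x] that by simp
  \<comment> \<open>The variation \<open>t * v\<close> and the correcting constant each change any
    derivative of order at most k by at most \<open>\<bar>t\<bar> * M\<close>, hence the 2.\<close>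
  define \<delta> where "\<delta> = e / (2 * M)"
  show thesis
  proof (rule that[of \<delta>])
    show "\<delta> > 0" using e M by (simp add: \<delta>_def)
    fix t :: real assume t: "\<bar>t\<bar> < \<delta>"
    define w where "w x = u x + t * v x" for x
    define I where "I = surf (\<lambda>x. exp (3 * w x))"
    have w: "w \<in> smooth_B4" unfolding w_def[abs_def] by (intro smooth_intros u v)
    have eu: "(\<lambda>x. exp (3 * u x)) \<in> smooth_B4" by (intro smooth_exp smooth_intros u)
    have ew: "(\<lambda>x. exp (3 * w x)) \<in> smooth_B4" by (intro smooth_exp smooth_intros w)
    have tv: "\<bar>t * v x\<bar> \<le> \<bar>t\<bar> * M" if "x \<in> B4" for x
      unfolding abs_mult using vM[OF that] by (intro mult_left_mono) auto
    have up: "I \<le> exp (3 * (\<bar>t\<bar> * M)) * omega3"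
      unfolding I_def vol[symmetric] surf_cmult[symmetric]
    proof (rule surf_mono)
      fix x assume "x \<in> S3"
      from tv[OF S3_imp_B4[OF this]] show "exp (3 * w x) \<le> exp (3 * (\<bar>t\<bar> * M)) * exp (3 * u x)"
        unfolding exp_add[symmetric] w_def by (simp add: algebra_simps)
    qed (intro smooth_continuous_S3 smooth_intros eu ew)+
    have low: "exp (- (3 * (\<bar>t\<bar> * M))) * omega3 \<le> I"
      unfolding I_def vol[symmetric] surf_cmult[symmetric]
    proof (rule surf_mono)
      fix x assume "x \<in> S3"
      from tv[OF S3_imp_B4[OF this]] show "exp (- (3 * (\<bar>t\<bar> * M))) * exp (3 * u x) \<le> exp (3 * w x)"
        unfolding exp_add[symmetric] w_def by (simp add: algebra_simps)
    qed (intro smooth_continuous_S3 smooth_intros eu ew)+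
    have Ipos: "I > 0" using low omega3_pos by (smt (verit) exp_gt_zero mult_pos_pos)
    \<comment> \<open>Adding c multiplies the boundary volume by \<open>exp (3 * c)\<close>, and
      this choice brings it back to \<open>omega3\<close>.\<close>
    define c where "c = - ln (I / omega3) / 3"
    have "\<bar>ln (I / omega3)\<bar> \<le> 3 * (\<bar>t\<bar> * M)"
    proof -
      have "ln (I / omega3) \<le> 3 * (\<bar>t\<bar> * M)"
      proof -
        have "ln (I / omega3) \<le> ln (exp (3 * (\<bar>t\<bar> * M)))"
          using up omega3_pos Ipos by (intro ln_mono) (auto simp: pos_divide_le_eq)
        then show ?thesis by simp
      qed
      moreover have "- (3 * (\<bar>t\<bar> * M)) \<le> ln (I / omega3)"
        using low omega3_pos Ipos by (subst ln_ge_iff) (auto simp: pos_le_divide_eq)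
      ultimately show ?thesis by linarith
    qed
    then have c: "\<bar>c\<bar> \<le> \<bar>t\<bar> * M" by (simp add: c_def)
    define z where "z x = w x + c" for x
    have z: "z \<in> smooth_B4" unfolding z_def[abs_def] by (intro smooth_intros w)
    have "surf (\<lambda>x. exp (3 * z x)) = exp (3 * c) * I"
      unfolding I_def surf_cmult[symmetric] by (simp add: z_def algebra_simps exp_add)
    also have "\<dots> = omega3" using omega3_pos Ipos by (simp add: c_def exp_minus)
    finally have zV: "conformal_metric z \<in> V"
      unfolding V_def using z by (auto simp: bdry_vol_conformal_metric)
    have "z \<in> Cinf_ball u k e"
      unfolding Cinf_ball_def
    proof (intro CollectI conjI z allI impI ballI)
      fix js :: "4 list" and x assume js: "length js \<le> k" and x: "x \<in> B4"
      have "iter_pd js z x = iter_pd js (\<lambda>x. w x + c * 1) x" by (simp add: z_def[abs_def])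
      also have "\<dots> = iter_pd js w x + c * iter_pd js (\<lambda>_. 1) x"
        by (rule iter_pd_linear[OF w _ x]) simp
      also have "iter_pd js w x = iter_pd js u x + t * iter_pd js v x"
        unfolding w_def[abs_def] by (rule iter_pd_linear[OF u v x])
      finally have eq: "iter_pd js z x - iter_pd js u x = t * iter_pd js v x + c * iter_pd js (\<lambda>_. 1) x" by simp
      have one: "\<bar>iter_pd js (\<lambda>_. 1) x\<bar> \<le> 1"
      proof (cases js)
        case (Cons i ks)
        have "iter_pd ks (\<lambda>_. 1) y = (if ks = [] then 1 else 0)" if "y \<in> B4" for y ks
          using that
        proof (induction ks arbitrary: y)
          case (Cons i ks)
          have "pd i (iter_pd ks (\<lambda>_. 1)) y = pd i (\<lambda>_. if ks = [] then 1 else 0) y"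
            by (intro pd_cong Cons)
          then show ?case using Cons.prems by simp
        qed simp
        from this[OF x, of js] show ?thesis by simp
      qed simp
      have "\<bar>t * iter_pd js v x + c * iter_pd js (\<lambda>_. 1) x\<bar> \<le> \<bar>t\<bar> * \<bar>iter_pd js v x\<bar> + \<bar>c\<bar> * \<bar>iter_pd js (\<lambda>_. 1) x\<bar>"
        by (metis abs_mult abs_triangle_ineq)
      also have "\<dots> \<le> \<bar>t\<bar> * M + (\<bar>t\<bar> * M) * 1"
        using M(2)[OF js x] one c M(1) by (intro add_mono mult_mono) auto
      also have "\<dots> < e" using t M(1) by (simp add: \<delta>_def pos_less_divide_eq mult_ac)
      finally show "\<bar>iter_pd js z x - iter_pd js u x\<bar> < e" unfolding eq .
    qed
    then have "F2 u \<le> F2 z" using e(2) zV U(3) by blast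
    then have "energy u \<le> energy w + c * omega3"
      unfolding F2_eq_energy[OF u] F2_eq_energy[OF z] using energy_add_const[OF w, of c] by (simp add: z_def[abs_def])
    then show "energy u + omega3 / 3 * ln (surf (\<lambda>x. exp (3 * (u x + t * v x))) / omega3) \<le> energy (\<lambda>x. u x + t * v x)"
      unfolding w_def[symmetric] I_def[symmetric] c_def by (simp add: algebra_simps)
  qed
qed

text \<open>Orthogonality to \<open>exp (3 * u)\<close> removes the term linear in t from the
  boundary volume, whose logarithm then starts at order t^2. Adding the inequalities for t and -t
  removes the odd powers from the energy; division by t^2 and passage to t = 0 give the
  claim.\<close>

lemma second_variation_ge:
  assumes u: "u \<in> smooth_B4" and min: "local_minimizer_F2 u"
    and vol: "surf (\<lambda>x. exp (3 * u x)) = omega3" and v: "v \<in> smooth_B4"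
    and mean: "surf (\<lambda>x. v x * exp (3 * u x)) = 0"
  shows "3 * surf (\<lambda>x. (v x)\<^sup>2 * exp (3 * u x)) \<le> second_variation u v"
proof -
  define A where "A = surf (\<lambda>x. (v x)\<^sup>2 * exp (3 * u x))"
  define B where "B = surf (\<lambda>x. (v x)^3 * exp (3 * u x))"
  obtain \<delta> where \<delta>: "\<delta> > 0" "\<And>t. \<bar>t\<bar> < \<delta> \<Longrightarrow>
    energy u + omega3 / 3 * ln (surf (\<lambda>x. exp (3 * (u x + t * v x))) / omega3) \<le> energy (\<lambda>x. u x + t * v x)"
    by (rule energy_minimal_nearby[OF u min vol v]) blast
  obtain a b c where E: "\<And>t. energy (\<lambda>x. u x + t * v x) =
    energy u + a * t + second_variation u v / 2 * t\<^sup>2 + b * t^3 + c * t^4"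
    by (rule energy_expand[OF u v]) blast
  \<comment> \<open>Lower bound for the relative growth of the boundary volume, from the terms of
    order two and three of the exponential of \<open>3 * t * v\<close>: both 3^2 / 2 and 3^3 / 6
    equal 9/2.\<close>
  define z where "z t = (9/2 * t\<^sup>2 * A + 9/2 * t^3 * B) / omega3" for t
  have eu: "(\<lambda>x. exp (3 * u x)) \<in> smooth_B4" by (intro smooth_exp smooth_intros u)
  have I: "omega3 * (1 + z t) \<le> surf (\<lambda>x. exp (3 * (u x + t * v x)))" for t
  proof -
    let ?e = "\<lambda>x. exp (3 * u x)"
    have sm: "(\<lambda>x. (v x)^n * ?e x) \<in> smooth_B4" for n by (intro smooth_mult smooth_power v eu)
    have sadd: "surf (\<lambda>x. f x + k * g x) = surf f + k * surf g" if "f \<in> smooth_B4" "g \<in> smooth_B4" for f g k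
      unfolding surf_cmult[symmetric] using that by (intro surf_add_smooth smooth_intros)
    have S1: "(\<lambda>x. ?e x + (3 * t) * (v x * ?e x)) \<in> smooth_B4"
      by (intro smooth_intros eu v)
    have S2: "(\<lambda>x. (?e x + (3 * t) * (v x * ?e x)) + (9/2 * t\<^sup>2) * ((v x)\<^sup>2 * ?e x)) \<in> smooth_B4"
      by (intro smooth_add[OF S1] smooth_mult[OF smooth_const] sm)
    have 1: "surf (\<lambda>x. ((?e x + (3 * t) * (v x * ?e x)) + (9/2 * t\<^sup>2) * ((v x)\<^sup>2 * ?e x))
        + (9/2 * t^3) * ((v x)^3 * ?e x)) = omega3 + 9/2 * t\<^sup>2 * A + 9/2 * t^3 * B"
      unfolding sadd[OF S2 sm[of 3]] sadd[OF S1 sm[of 2]] sadd[OF eu sm[of 1, simplified]]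
      by (simp add: vol mean A_def B_def)
    have 2: "surf (\<lambda>x. ((?e x + (3 * t) * (v x * ?e x)) + (9/2 * t\<^sup>2) * ((v x)\<^sup>2 * ?e x))
        + (9/2 * t^3) * ((v x)^3 * ?e x)) \<le> surf (\<lambda>x. exp (3 * (u x + t * v x)))"
    proof (rule surf_mono)
      fix x
      have "?e x * (1 + 3 * t * v x + (3 * t * v x)\<^sup>2 / 2 + (3 * t * v x)^3 / 6) \<le> ?e x * exp (3 * t * v x)"
        by (intro mult_left_mono exp_ge_cubic) auto
      also have "\<dots> = exp (3 * (u x + t * v x))" by (simp add: exp_add[symmetric] algebra_simps)
      finally show "((?e x + (3 * t) * (v x * ?e x)) + (9/2 * t\<^sup>2) * ((v x)\<^sup>2 * ?e x))
        + (9/2 * t^3) * ((v x)^3 * ?e x) \<le> exp (3 * (u x + t * v x))"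
        by (simp add: algebra_simps power2_eq_square power3_eq_cube)
    qed (intro smooth_continuous_S3 smooth_add[OF S2] smooth_mult[OF smooth_const] sm
        smooth_exp smooth_add smooth_mult smooth_const u v)+
    have 3: "omega3 * (1 + z t) = omega3 + 9/2 * t\<^sup>2 * A + 9/2 * t^3 * B"
      using omega3_pos by (simp add: z_def field_simps)
    show ?thesis unfolding 3 1[symmetric] by (rule 2)
  qed
  have z0: "(z \<longlongrightarrow> 0) (at 0)"
    unfolding z_def using omega3_pos by (auto intro!: tendsto_eq_intros)
  have ev: "\<forall>\<^sub>F t in at 0. \<bar>t\<bar> < \<delta> \<and> \<bar>z t\<bar> < 1/2"
  proof (rule eventually_conj)
    show "\<forall>\<^sub>F t in at 0. \<bar>t\<bar> < \<delta>" using \<delta>(1) by (auto simp: eventually_at)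
    show "\<forall>\<^sub>F t in at 0. \<bar>z t\<bar> < 1/2" using tendstoD[OF z0, of "1/2"] by simp
  qed
  have key: "omega3 / 3 * (z t - 2 * (z t)\<^sup>2) \<le> a * t + second_variation u v / 2 * t\<^sup>2 + b * t^3 + c * t^4"
    if "\<bar>t\<bar> < \<delta>" "\<bar>z t\<bar> < 1/2" for t
  proof -
    \<comment> \<open>As z is of order t^2, the quadratic error of the logarithm is of order t^4 and
      does not affect the limit.\<close>
    have "z t - 2 * (z t)\<^sup>2 \<le> ln (1 + z t)"
      using abs_ln_one_plus_x_minus_x_bound[of "z t"] that by linarith
    also have "\<dots> \<le> ln (surf (\<lambda>x. exp (3 * (u x + t * v x))) / omega3)"
      using I[of t] omega3_pos that by (intro ln_mono) (auto simp: pos_le_divide_eq mult.commute)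
    finally have "omega3 / 3 * (z t - 2 * (z t)\<^sup>2) \<le> omega3 / 3 * ln (surf (\<lambda>x. exp (3 * (u x + t * v x))) / omega3)"
      using omega3_pos by (intro mult_left_mono) auto
    with \<delta>(2)[OF that(1)] show ?thesis unfolding E by linarith
  qed
  have "3 * A \<le> second_variation u v"
  proof (rule tendsto_le[of "at (0::real)"])
    \<comment> \<open>The quotient of \<open>(z t)\<^sup>2\<close> by t^2, extended by 0 to t = 0;
      81/4 is the square of 9/2.\<close>
    let ?q = "\<lambda>t. 81/4 * t\<^sup>2 * (A + t * B)\<^sup>2 / omega3\<^sup>2"
    have q: "(z t)\<^sup>2 = t\<^sup>2 * ?q t" for t
      using omega3_pos by (simp add: z_def power2_eq_square power3_eq_cube field_simps)
    show "((\<lambda>t. 3 * A - 2 * omega3 / 3 * (?q t + ?q (- t))) \<longlongrightarrow> 3 * A) (at 0)"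
      using omega3_pos by (auto intro!: tendsto_eq_intros)
    show "((\<lambda>t. second_variation u v + 2 * c * t\<^sup>2) \<longlongrightarrow> second_variation u v) (at 0)"
      by (auto intro!: tendsto_eq_intros)
    have "\<forall>\<^sub>F t in at 0. \<bar>- t\<bar> < \<delta> \<and> \<bar>z (- t)\<bar> < 1/2"
      using ev unfolding eventually_at by (metis add.inverse_neutral dist_minus minus_equation_iff UNIV_I)
    with ev show "\<forall>\<^sub>F t in at 0. 3 * A - 2 * omega3 / 3 * (?q t + ?q (- t)) \<le> second_variation u v + 2 * c * t\<^sup>2"
      using eventually_neq_at_within[of 0 0 UNIV]
    proof eventually_elim
      case (elim t)
      have "omega3 / 3 * (z t - 2 * (z t)\<^sup>2) + omega3 / 3 * (z (- t) - 2 * (z (- t))\<^sup>2)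
        \<le> second_variation u v * t\<^sup>2 + 2 * c * t^4"
        using key[of t] key[of "- t"] elim by simp
      moreover have "omega3 / 3 * (z t + z (- t)) = 3 * A * t\<^sup>2"
        using omega3_pos by (simp add: z_def field_simps)
      ultimately have "t\<^sup>2 * (3 * A - 2 * omega3 / 3 * (?q t + ?q (- t))) \<le> t\<^sup>2 * (second_variation u v + 2 * c * t\<^sup>2)"
        unfolding q by (simp add: algebra_simps power2_eq_square power4_eq_xxxx)
      then show ?case using elim by (simp add: mult_le_cancel_left_pos)
    qed
  qed simp
  then show ?thesis by (simp add: A_def)
qed


section \<open>Moebius transformations of the ball\<close>

text \<open>For nonzero x this is |x|^2 times the squared distance from a to the inverted point x /
  |x|^2. On the unit sphere it is the squared distance from a to x.\<close>

definition mden :: "real^4 \<Rightarrow> real^4 \<Rightarrow> real" where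
  "mden a x = 1 - 2 * (a \<bullet> x) + (a \<bullet> a) * (x \<bullet> x)"

text \<open>The Moebius map of the ball sending a to 0, with conformal factor exp (2 mfac a).\<close>

definition moebius :: "real^4 \<Rightarrow> real^4 \<Rightarrow> real^4" where
  "moebius a x = (1 / mden a x) *\<^sub>R ((1 - a \<bullet> a) *\<^sub>R x - (1 + x \<bullet> x - 2 * (a \<bullet> x)) *\<^sub>R a)"

definition mfac :: "real^4 \<Rightarrow> real^4 \<Rightarrow> real" where
  "mfac a x = ln ((1 - a \<bullet> a) / mden a x)"

lemma inner_self_less_1: "norm a < 1 \<Longrightarrow> a \<bullet> a < 1" for a :: "real^4"
  by (simp add: dot_square_norm power_less_one_iff abs_square_less_1)

lemma inner_self_le_1: "x \<in> B4 \<Longrightarrow> x \<bullet> x \<le> 1" for x :: "real^4"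
  by (simp add: dot_square_norm mem_cball_0 abs_square_le_1)

text \<open>The Cauchy-Schwarz inequality gives the lower bound
  \<open>(1 - norm a * norm x)\<^sup>2\<close>.\<close>

lemma mden_pos:
  assumes a: "norm a < 1" and x: "x \<in> B4"
  shows "mden a x > 0"
proof -
  have "a \<bullet> x \<le> norm a * norm x" by (rule norm_cauchy_schwarz)
  then have "(1 - norm a * norm x)\<^sup>2 \<le> mden a x"
    by (simp add: mden_def dot_square_norm power2_eq_square algebra_simps)
  moreover have "norm a * norm x < 1"
    using a x mult_left_mono[of "norm x" 1 "norm a"] by (simp add: mem_cball_0)
  ultimately show ?thesis by (smt (verit) zero_less_power2)
qed

text \<open>The first and third are the scalars that occur when \<open>moebius (- a)\<close> is
  applied to the image; the second decides whether the image lies in the ball or on the sphere. All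
  rest on the factorisation \<open>N \<bullet> N = Q * D\<close> for the numerator of the map, by
  which one power of the denominator cancels.\<close>

lemma mden_moebius:
  assumes "mden a x \<noteq> 0"
  shows "mden (- a) (moebius a x) = (1 - a \<bullet> a)\<^sup>2 / mden a x"
    and "1 - moebius a x \<bullet> moebius a x = (1 - a \<bullet> a) * (1 - x \<bullet> x) / mden a x"
    and "1 + moebius a x \<bullet> moebius a x + 2 * (a \<bullet> moebius a x)
      = (1 - a \<bullet> a) * (1 + x \<bullet> x - 2 * (a \<bullet> x)) / mden a x"
proof -
  define \<alpha> \<beta> \<gamma> D where "\<alpha> = a \<bullet> a" and "\<beta> = a \<bullet> x" and "\<gamma> = x \<bullet> x" and "D = mden a x"
  have D0: "D \<noteq> 0" and D: "D = 1 - 2 * \<beta> + \<alpha> * \<gamma>"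
    using assms by (simp_all add: D_def mden_def \<alpha>_def \<beta>_def \<gamma>_def)
  define P Q where "P = (1 - \<alpha>) * \<beta> - (1 + \<gamma> - 2 * \<beta>) * \<alpha>" and "Q = \<gamma> - 2 * \<beta> + \<alpha>"
  have 1: "a \<bullet> moebius a x = P / D"
    by (simp add: moebius_def inner_simps P_def \<alpha>_def \<beta>_def \<gamma>_def D_def)
  define N where "N = (1 - \<alpha>) *\<^sub>R x - (1 + \<gamma> - 2 * \<beta>) *\<^sub>R a"
  have "N \<bullet> N = (1 - \<alpha>)\<^sup>2 * \<gamma> - 2 * (1 - \<alpha>) * (1 + \<gamma> - 2 * \<beta>) * \<beta> + (1 + \<gamma> - 2 * \<beta>)\<^sup>2 * \<alpha>"
    by (simp add: N_def inner_simps inner_commute[of x a] \<alpha>_def[symmetric] \<beta>_def[symmetric]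
        \<gamma>_def[symmetric] power2_eq_square algebra_simps)
  also have "\<dots> = Q * D"
    unfolding D Q_def by (simp add: power2_eq_square algebra_simps)
  finally have "N \<bullet> N = Q * D" .
  moreover have "moebius a x \<bullet> moebius a x = (N \<bullet> N) / (D * D)"
    by (simp add: moebius_def N_def \<alpha>_def \<beta>_def \<gamma>_def D_def)
  ultimately have 2: "moebius a x \<bullet> moebius a x = Q / D" using D0 by simp
  note fold = \<alpha>_def[symmetric] \<beta>_def[symmetric] \<gamma>_def[symmetric] D_def[symmetric]
  have "1 - Q / D = (D - Q) / D" using D0 by (simp add: diff_divide_distrib)
  also have "D - Q = (1 - \<alpha>) * (1 - \<gamma>)" unfolding D Q_def by (simp add: algebra_simps)
  finally show "1 - moebius a x \<bullet> moebius a x = (1 - a \<bullet> a) * (1 - x \<bullet> x) / mden a x"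
    unfolding 2 fold .
  have "1 + 2 * (P / D) + \<alpha> * (Q / D) = (D + 2 * P + \<alpha> * Q) / D" using D0 by (simp add: add_divide_distrib)
  also have "D + 2 * P + \<alpha> * Q = (1 - \<alpha>)\<^sup>2" unfolding D P_def Q_def by (simp add: power2_eq_square algebra_simps)
  finally show "mden (- a) (moebius a x) = (1 - a \<bullet> a)\<^sup>2 / mden a x"
    unfolding fold by (simp add: mden_def 1 2 fold)
  have "1 + Q / D + 2 * (P / D) = (D + Q + 2 * P) / D" using D0 by (simp add: add_divide_distrib)
  also have "D + Q + 2 * P = (1 - \<alpha>) * (1 + \<gamma> - 2 * \<beta>)" unfolding D P_def Q_def by (simp add: algebra_simps)
  finally show "1 + moebius a x \<bullet> moebius a x + 2 * (a \<bullet> moebius a x)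
      = (1 - a \<bullet> a) * (1 + x \<bullet> x - 2 * (a \<bullet> x)) / mden a x"
    unfolding 1 2 fold .
qed

lemma moebius_inverse:
  assumes a: "norm a < 1" and x: "x \<in> B4"
  shows "moebius (- a) (moebius a x) = x"
proof -
  let ?r = "1 - a \<bullet> a" and ?C = "1 + x \<bullet> x - 2 * (a \<bullet> x)" and ?z = "moebius a x" and ?D = "mden a x"
  have D: "?D \<noteq> 0" using mden_pos[OF a x] by simp
  have r: "?r \<noteq> 0" using inner_self_less_1[OF a] by simp
  note m = mden_moebius[OF D]
  have "moebius (- a) ?z = (1 / mden (- a) ?z) *\<^sub>R (?r *\<^sub>R ?z + (1 + ?z \<bullet> ?z + 2 * (a \<bullet> ?z)) *\<^sub>R a)"
    by (simp add: moebius_def)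
  also have "\<dots> = (?D / ?r\<^sup>2) *\<^sub>R (?r *\<^sub>R ?z + (?r * ?C / ?D) *\<^sub>R a)"
    unfolding m by simp
  also have "?r *\<^sub>R ?z + (?r * ?C / ?D) *\<^sub>R a = (?r\<^sup>2 / ?D) *\<^sub>R x"
    unfolding moebius_def[of a x] by (simp add: scaleR_diff_right power2_eq_square)
  also have "(?D / ?r\<^sup>2) *\<^sub>R (?r\<^sup>2 / ?D) *\<^sub>R x = x" using D r by simp
  finally show ?thesis .
qed

lemma moebius_in_B4:
  assumes a: "norm a < 1" and x: "x \<in> B4"
  shows "moebius a x \<in> B4"
proof -
  have D: "mden a x > 0" using mden_pos[OF a x] .
  then have "1 - moebius a x \<bullet> moebius a x \<ge> 0"
    using inner_self_less_1[OF a] inner_self_le_1[OF x]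
    by (subst mden_moebius(2)) (auto intro!: divide_nonneg_pos mult_nonneg_nonneg)
  then show ?thesis by (simp add: mem_cball_0 dot_square_norm abs_square_le_1)
qed

lemma moebius_in_S3:
  assumes a: "norm a < 1" and x: "x \<in> S3"
  shows "moebius a x \<in> S3"
proof -
  have D: "mden a x > 0" using mden_pos[OF a S3_imp_B4[OF x]] .
  have "x \<bullet> x = 1" using x by (simp add: norm_eq_1[symmetric])
  then have "1 - moebius a x \<bullet> moebius a x = 0" using D by (subst mden_moebius(2)) auto
  then show ?thesis by (simp add: norm_eq_1)
qed

lemma moebius_bij:
  assumes a: "norm a < 1"
  shows "bij_betw (moebius a) B4 B4" "moebius a ` S3 = S3"
    "\<And>y. y \<in> B4 \<Longrightarrow> inv_into B4 (moebius a) y = moebius (- a) y"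
proof -
  have a': "norm (- a) < 1" using a by simp
  have inv: "moebius a (moebius (- a) y) = y" if "y \<in> B4" for y
    using moebius_inverse[OF a' that] by simp
  show b: "bij_betw (moebius a) B4 B4"
    by (rule bij_betw_byWitness[where f' = "moebius (- a)"])
      (use moebius_inverse[OF a] inv moebius_in_B4[OF a] moebius_in_B4[OF a'] in auto)
  show "moebius a ` S3 = S3"
  proof
    show "moebius a ` S3 \<subseteq> S3" using moebius_in_S3[OF a] by blast
    show "S3 \<subseteq> moebius a ` S3"
      using moebius_in_S3[OF a'] inv[OF S3_imp_B4] by (metis imageI subsetI)
  qed
  show "inv_into B4 (moebius a) y = moebius (- a) y" if "y \<in> B4" for y
    using that moebius_in_B4[OF a' that] inv[OF that] b
    by (intro inv_into_f_eq) (auto simp: bij_betw_def)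
qed

lemma smooth_inner [intro]: "(\<lambda>x. a \<bullet> x) \<in> smooth_B4" "(\<lambda>x. x \<bullet> x) \<in> smooth_B4"
  unfolding inner_vec_def inner_real_def by (intro smooth_intros)+

lemma smooth_mden [intro]: "mden a \<in> smooth_B4"
  unfolding mden_def[abs_def] by (intro smooth_intros smooth_inner)

lemma moebius_nth:
  "moebius a x $ k = ((1 - a \<bullet> a) * x $ k - (1 + x \<bullet> x - 2 * (a \<bullet> x)) * a $ k) * inverse (mden a x)"
  by (simp add: moebius_def divide_inverse mult.commute)

lemma smooth_moebius:
  assumes "norm a < 1"
  shows "(\<lambda>x. moebius a x $ k) \<in> smooth_B4"
proof -
  have D: "mden a x \<noteq> 0" if "x \<in> B4" for x using mden_pos[OF assms that] by simp
  show ?thesis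
    unfolding moebius_nth
    by (intro smooth_intros smooth_inverse smooth_mden smooth_inner D)
qed

lemma smooth_mfac:
  assumes "norm a < 1"
  shows "mfac a \<in> smooth_B4"
proof -
  have D: "mden a x \<noteq> 0" if "x \<in> B4" for x using mden_pos[OF assms that] by simp
  have "(\<lambda>x. (1 - a \<bullet> a) / mden a x) \<in> smooth_B4"
    by (intro smooth_divide smooth_const smooth_mden D)
  then show ?thesis
    unfolding mfac_def[abs_def]
    by (rule smooth_ln) (use mden_pos[OF assms] inner_self_less_1[OF assms] in simp)
qed

lemma exp_mfac:
  assumes "norm a < 1" "x \<in> B4"
  shows "exp (mfac a x) = (1 - a \<bullet> a) / mden a x"
  unfolding mfac_def using mden_pos[OF assms] inner_self_less_1[OF assms(1)] by (intro exp_ln) simp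

lemma pd_inner:
  assumes "x \<in> B4"
  shows "pd i (\<lambda>x. a \<bullet> x) x = a $ i" "pd i (\<lambda>x. x \<bullet> x) x = 2 * x $ i"
proof -
  have "((\<lambda>x. a \<bullet> x) has_derivative (\<lambda>h. a \<bullet> h)) (at x within B4)"
    by (auto intro!: derivative_eq_intros)
  from pd_eqI[OF assms this] show "pd i (\<lambda>x. a \<bullet> x) x = a $ i" by (simp add: inner_axis)
  have "((\<lambda>x. x \<bullet> x) has_derivative (\<lambda>h. x \<bullet> h + h \<bullet> x)) (at x within B4)"
    by (auto intro!: derivative_eq_intros)
  from pd_eqI[OF assms this] show "pd i (\<lambda>x. x \<bullet> x) x = 2 * x $ i" by (simp add: inner_axis inner_axis')
qed

lemma pd_mden:
  assumes "x \<in> B4"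
  shows "pd i (mden a) x = 2 * ((a \<bullet> a) * x $ i - a $ i)"
  unfolding mden_def[abs_def] using assms
  by (simp add: smooth_pd_add smooth_mult smooth_add smooth_diff smooth_inner pd_inner algebra_simps)

lemma pd_moebius:
  assumes a: "norm a < 1" and x: "x \<in> B4"
  shows "pd i (\<lambda>x. moebius a x $ k) x =
    ((1 - a \<bullet> a) * kron i k - 2 * (x $ i - a $ i) * a $ k) / mden a x
    - ((1 - a \<bullet> a) * x $ k - (1 + x \<bullet> x - 2 * (a \<bullet> x)) * a $ k) * pd i (mden a) x / (mden a x)\<^sup>2"
proof -
  let ?N = "\<lambda>x. (1 - a \<bullet> a) * x $ k - (1 + x \<bullet> x - 2 * (a \<bullet> x)) * a $ k"
  have N: "?N \<in> smooth_B4"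
    by (intro smooth_intros smooth_inner)
  have D: "mden a y \<noteq> 0" if "y \<in> B4" for y using mden_pos[OF a that] by simp
  have iD: "(\<lambda>x. inverse (mden a x)) \<in> smooth_B4" using D by (intro smooth_inverse smooth_mden)
  have "pd i ?N x = (1 - a \<bullet> a) * kron i k - 2 * (x $ i - a $ i) * a $ k"
    using x by (simp add: smooth_pd_add smooth_mult smooth_add smooth_diff smooth_inner pd_inner pd_nth algebra_simps)
  moreover have "pd i (\<lambda>x. moebius a x $ k) x = pd i ?N x * inverse (mden a x) + ?N x * pd i (\<lambda>x. inverse (mden a x)) x"
    unfolding moebius_nth by (rule smooth_pd_add(3)[OF x N iD])
  moreover have "pd i (\<lambda>x. inverse (mden a x)) x = - pd i (mden a) x / (mden a x)\<^sup>2"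
    using x smooth_mden D by (intro smooth_pd_inverse) auto
  ultimately show ?thesis by (simp only: divide_inverse mult_minus_left mult_minus_right
      mult.assoc diff_conv_add_uminus)
qed

text \<open>The map is \<open>N / D\<close>, with \<open>M\<close> the derivative of the numerator
  and \<open>E\<close> that of the denominator. Since \<open>N \<bullet> N = Y * D\<close>, the sum
  of \<open>M i k * N k\<close> over k is half the derivative of \<open>Y * D\<close>. Hence all
  terms containing \<open>Y\<close> cancel in the Gram matrix of the Jacobian, and the remaining
  ones reduce to the multiple \<open>\<rho>\<^sup>2\<close> of the identity over the square of
  \<open>D\<close>.\<close>

lemma moebius_conformal:
  assumes a: "norm a < 1" and x: "x \<in> B4"
  shows "(\<Sum>k\<in>UNIV. pd i (\<lambda>x. moebius a x $ k) x * pd j (\<lambda>x. moebius a x $ k) x)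
    = kron i j * exp (2 * mfac a x)"
proof -
  define \<alpha> \<beta> \<gamma> D where "\<alpha> = a \<bullet> a" and "\<beta> = a \<bullet> x" and "\<gamma> = x \<bullet> x" and "D = mden a x"
  have D: "D = 1 - 2 * \<beta> + \<alpha> * \<gamma>" by (simp add: D_def mden_def \<alpha>_def \<beta>_def \<gamma>_def)
  have D0: "D \<noteq> 0" using mden_pos[OF a x] by (simp add: D_def)
  define \<rho> C Y where "\<rho> = 1 - \<alpha>" and "C = 1 + \<gamma> - 2 * \<beta>" and "Y = \<gamma> - 2 * \<beta> + \<alpha>"
  define y where "y i = x $ i - a $ i" for i
  define E where "E i = 2 * (\<alpha> * x $ i - a $ i)" for i
  define M where "M i k = \<rho> * kron i k - 2 * y i * a $ k" for i k
  define N where "N k = \<rho> * x $ k - C * a $ k" for k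
  have pdm: "pd i (\<lambda>x. moebius a x $ k) x = M i k / D - N k * E i / D\<^sup>2" for i k
    unfolding pd_moebius[OF a x] pd_mden[OF x] M_def N_def E_def \<rho>_def C_def y_def D_def \<alpha>_def \<beta>_def \<gamma>_def by simp
  have aa: "(\<Sum>k\<in>UNIV. a $ k * a $ k) = \<alpha>" and ax: "(\<Sum>k\<in>UNIV. a $ k * x $ k) = \<beta>"
    and xx: "(\<Sum>k\<in>UNIV. x $ k * x $ k) = \<gamma>" by (simp_all add: \<alpha>_def \<beta>_def \<gamma>_def inner_vec_def)
  have MM: "(\<Sum>k\<in>UNIV. M i k * M j k) = \<rho>\<^sup>2 * kron i j - 2 * \<rho> * (y i * a $ j + y j * a $ i) + 4 * \<alpha> * (y i * y j)" for i j
  proof -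
    have "M i k * M j k = kron i k * (\<rho>\<^sup>2 * kron j k - 2 * \<rho> * y j * a $ k)
      - kron j k * (2 * \<rho> * y i * a $ k) + 4 * y i * y j * (a $ k * a $ k)" for k
      by (simp add: M_def power2_eq_square algebra_simps)
    then have "(\<Sum>k\<in>UNIV. M i k * M j k) = (\<rho>\<^sup>2 * kron j i - 2 * \<rho> * y j * a $ i)
      - (2 * \<rho> * y i * a $ j) + 4 * y i * y j * \<alpha>"
      by (simp only: sum.distrib sum_subtractf sum_kron sum_distrib_left[symmetric] aa)
    then show ?thesis by (simp add: algebra_simps)
  qed
  have MN: "(\<Sum>k\<in>UNIV. M i k * N k) = y i * D + Y * E i / 2" for i
  proof -
    have "M i k * N k = kron i k * (\<rho> * N k) - 2 * y i * (\<rho> * (a $ k * x $ k) - C * (a $ k * a $ k))" for k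
      by (simp add: M_def N_def algebra_simps)
    then have "(\<Sum>k\<in>UNIV. M i k * N k) = \<rho> * N i - 2 * y i * (\<rho> * \<beta> - C * \<alpha>)"
      by (simp only: sum_subtractf sum_kron sum_distrib_left[symmetric] aa ax)
    then show ?thesis
      by (simp add: N_def E_def y_def \<rho>_def C_def Y_def D field_simps)
  qed
  have NN: "(\<Sum>k\<in>UNIV. N k * N k) = Y * D"
  proof -
    have "N k * N k = \<rho>\<^sup>2 * (x $ k * x $ k) - 2 * \<rho> * C * (a $ k * x $ k) + C\<^sup>2 * (a $ k * a $ k)" for k
      by (simp add: N_def power2_eq_square algebra_simps)
    then have "(\<Sum>k\<in>UNIV. N k * N k) = \<rho>\<^sup>2 * \<gamma> - 2 * \<rho> * C * \<beta> + C\<^sup>2 * \<alpha>"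
      by (simp only: sum.distrib sum_subtractf sum_distrib_left[symmetric] aa ax xx)
    then show ?thesis by (simp add: \<rho>_def C_def Y_def D power2_eq_square algebra_simps)
  qed
  have split: "(\<Sum>k\<in>UNIV. (M i k / D - N k * E i / D\<^sup>2) * (M j k / D - N k * E j / D\<^sup>2)) =
    (\<Sum>k\<in>UNIV. M i k * M j k) / D\<^sup>2 - E j * (\<Sum>k\<in>UNIV. M i k * N k) / D^3
    - E i * (\<Sum>k\<in>UNIV. M j k * N k) / D^3 + E i * E j * (\<Sum>k\<in>UNIV. N k * N k) / D^4"
  proof -
    have "(M i k / D - N k * E i / D\<^sup>2) * (M j k / D - N k * E j / D\<^sup>2) =
      (M i k * M j k) / D\<^sup>2 - E j * (M i k * N k) / D^3 - E i * (M j k * N k) / D^3 + E i * E j * (N k * N k) / D^4" for k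
      using D0 by (simp add: field_simps power2_eq_square power3_eq_cube power4_eq_xxxx)
    then show ?thesis
      by (simp only: sum.distrib sum_subtractf sum_distrib_left[symmetric] sum_divide_distrib[symmetric])
  qed
  have "(\<Sum>k\<in>UNIV. pd i (\<lambda>x. moebius a x $ k) x * pd j (\<lambda>x. moebius a x $ k) x) =
    (\<rho>\<^sup>2 * kron i j - 2 * \<rho> * (y i * a $ j + y j * a $ i) + 4 * \<alpha> * (y i * y j) - E j * y i - E i * y j) / D\<^sup>2"
    unfolding pdm split MM MN NN using D0
    by (simp add: field_simps power2_eq_square power3_eq_cube power4_eq_xxxx)
  also have "\<rho>\<^sup>2 * kron i j - 2 * \<rho> * (y i * a $ j + y j * a $ i) + 4 * \<alpha> * (y i * y j) - E j * y i - E i * y j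
    = \<rho>\<^sup>2 * kron i j"
    by (simp add: y_def E_def \<rho>_def algebra_simps)
  also have "\<rho>\<^sup>2 * kron i j / D\<^sup>2 = kron i j * (exp (mfac a x))\<^sup>2"
    unfolding exp_mfac[OF a x] \<rho>_def \<alpha>_def D_def by (simp add: power_divide)
  finally show ?thesis by (simp add: exp_double)
qed


section \<open>Balancing\<close>

text \<open>The restriction of the Moebius map to the sphere, which extends continuously to |a| = 1
  (away from x = a), where it becomes the constant map to -a.\<close>

definition sphere_moebius :: "real^4 \<Rightarrow> real^4 \<Rightarrow> real^4" where
  "sphere_moebius a x = ((1 - a \<bullet> a) / (norm (x - a))\<^sup>2) *\<^sub>R (x - a) - a"

lemma norm_diff_S3:
  assumes "x \<in> S3"
  shows "(norm (x - a))\<^sup>2 = 1 - 2 * (a \<bullet> x) + a \<bullet> a"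
proof -
  have "x \<bullet> x = 1" using assms by (simp add: norm_eq_1[symmetric])
  then show ?thesis by (simp add: dot_square_norm[symmetric] inner_simps inner_commute)
qed

lemma moebius_eq_sphere_moebius:
  assumes a: "norm a < 1" and x: "x \<in> S3"
  shows "moebius a x = sphere_moebius a x"
proof -
  have xx: "x \<bullet> x = 1" using x by (simp add: norm_eq_1[symmetric])
  define D where "D = mden a x"
  have D: "D > 0" unfolding D_def by (rule mden_pos[OF a S3_imp_B4[OF x]])
  have n: "(norm (x - a))\<^sup>2 = D" using norm_diff_S3[OF x, of a] by (simp add: D_def mden_def xx)
  have C: "1 + x \<bullet> x - 2 * (a \<bullet> x) = D + (1 - a \<bullet> a)" by (simp add: D_def mden_def xx)
  have "\<rho> *\<^sub>R x - (D + \<rho>) *\<^sub>R a = \<rho> *\<^sub>R (x - a) - D *\<^sub>R a" for \<rho>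
    by (simp add: algebra_simps)
  then have "moebius a x = (1 / D) *\<^sub>R ((1 - a \<bullet> a) *\<^sub>R (x - a) - D *\<^sub>R a)"
    unfolding moebius_def D_def[symmetric] C by simp
  also have "\<dots> = ((1 - a \<bullet> a) / D) *\<^sub>R (x - a) - a"
    using D by (simp add: scaleR_diff_right[of "1 / D" "(1 - a \<bullet> a) *\<^sub>R (x - a)" "D *\<^sub>R a"] del: scaleR_diff_right)
  finally show ?thesis by (simp add: sphere_moebius_def n)
qed

text \<open>At \<open>x = a\<close> the quotient is 0 by the convention for division by 0, and the
  value is \<open>- a\<close>, a unit vector since x is one. So the norm is 1 at every point of the
  sphere, which serves as a uniform bound for dominated convergence.\<close>

lemma norm_sphere_moebius:
  assumes a: "norm a \<le> 1" and x: "x \<in> S3"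
  shows "norm (sphere_moebius a x) = 1"
proof (cases "x = a")
  case True
  then show ?thesis using x by (simp add: sphere_moebius_def)
next
  case False
  define D where "D = (norm (x - a))\<^sup>2"
  define \<alpha> \<beta> where "\<alpha> = a \<bullet> a" and "\<beta> = a \<bullet> x"
  have D0: "D \<noteq> 0" using False by (simp add: D_def)
  have D: "D = 1 - 2 * \<beta> + \<alpha>" using norm_diff_S3[OF x, of a] by (simp add: D_def \<alpha>_def \<beta>_def)
  have xa: "(x - a) \<bullet> (x - a) = D" "(x - a) \<bullet> a = \<beta> - \<alpha>"
    by (simp_all add: D_def dot_square_norm inner_simps \<alpha>_def \<beta>_def inner_commute)
  define c where "c = (1 - \<alpha>) / D"
  have "sphere_moebius a x \<bullet> sphere_moebius a x = c\<^sup>2 * ((x - a) \<bullet> (x - a)) - 2 * c * ((x - a) \<bullet> a) + \<alpha>"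
    unfolding sphere_moebius_def D_def[symmetric] \<alpha>_def[symmetric] c_def[symmetric]
    by (simp add: inner_diff_left inner_diff_right inner_commute[of a x] power2_eq_square \<alpha>_def algebra_simps)
  also have "\<dots> = c * (c * D) - 2 * c * (\<beta> - \<alpha>) + \<alpha>" unfolding xa by (simp add: power2_eq_square)
  also have "c * D = 1 - \<alpha>" using D0 by (simp add: c_def)
  also have "c * (1 - \<alpha>) - 2 * c * (\<beta> - \<alpha>) + \<alpha> = c * D + \<alpha>" unfolding D by (simp add: algebra_simps)
  also have "\<dots> = 1" using \<open>c * D = 1 - \<alpha>\<close> by simp
  finally show ?thesis by (simp add: norm_eq_1)
qed

text \<open>Almost every point of the sphere differs from a: the cone over a single point lies on a
  line through the origin, a null set. At such points \<open>sphere_moebius\<close> is continuous in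
  its parameter.\<close>

lemma AE_sphere_measure_neq:
  assumes a: "norm a \<le> 1"
  shows "AE x in sphere_measure. indicator S3 x *\<^sub>R (x - a) = 0 \<longrightarrow> x \<notin> S3"
proof (rule AE_I[where N = "{a} \<inter> S3"])
  show "{x \<in> space sphere_measure. \<not> (indicator S3 x *\<^sub>R (x - a) = 0 \<longrightarrow> x \<notin> S3)} \<subseteq> {a} \<inter> S3"
    by (auto simp: indicator_def split: if_splits)
  show "{a} \<inter> S3 \<in> sets sphere_measure" by (simp add: sets_sphere_measure)
  show "emeasure sphere_measure ({a} \<inter> S3) = 0"
  proof (cases "a \<in> S3")
    case True
    let ?T = "\<lambda>x::real^4. x /\<^sub>R norm x"
    have T: "?T \<in> restrict_space lborel B4 \<rightarrow>\<^sub>M borel" by (rule measurable_restrict_space1) auto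
    have "negligible (span {a})"
      by (rule negligible_lowdim) (use dim_le_card[of "{a}" "{a}"] in \<open>simp add: dim_span\<close>)
    then have null: "span {a} \<in> null_sets lborel"
      by (simp add: negligible_iff_null_sets null_sets_completion_iff closed_subspace borel_closed)
    have "emeasure (distr (restrict_space lborel B4) borel ?T) {a} = emeasure (restrict_space lborel B4) (?T -` {a} \<inter> B4)"
      by (subst emeasure_distr[OF T]) (auto simp: space_restrict_space)
    also have "\<dots> = emeasure lborel (?T -` {a} \<inter> B4)"
      by (rule emeasure_restrict_space) auto
    also have "\<dots> = 0"
    proof (rule emeasure_eq_0[OF null_setsD2[OF null] null_setsD1[OF null]])
      show "?T -` {a} \<inter> B4 \<subseteq> span {a}"
      proof
        fix x assume "x \<in> ?T -` {a} \<inter> B4"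
        then have "x = norm x *\<^sub>R a" using True by (cases "x = 0") auto
        then show "x \<in> span {a}" by (metis span_base span_mul singletonI)
      qed
    qed
    finally show ?thesis using True by (simp add: sphere_measure_def)
  qed simp
qed

text \<open>The averaged map is continuous on the closed parameter ball by dominated convergence.
  For |a| = 1 it averages the constant \<open>- a\<close>, with result
  \<open>- surf f *\<^sub>R a\<close>. By Brouwer's theorem this forces a zero in the closed ball,
  and since \<open>surf f > 0\<close> the zero is not on the boundary.\<close>

lemma balancing:
  assumes f: "f \<in> smooth_B4" and pos: "surf f > 0" and nn: "\<And>x. x \<in> S3 \<Longrightarrow> f x \<ge> 0"
  obtains a where "norm a < 1" "\<And>k. surf (\<lambda>x. moebius a x $ k * f x) = 0"
proof -
  define B :: "real^4 \<Rightarrow> real^4" where "B a = (\<chi> k. surf (\<lambda>x. sphere_moebius a x $ k * f x))" for a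
  obtain M where M: "M > 0" "\<And>x. x \<in> B4 \<Longrightarrow> \<bar>f x\<bar> \<le> M" by (rule smooth_bounded[OF f]) blast
  have [measurable]: "(\<lambda>x. indicator S3 x * f x) \<in> borel_measurable borel"
    using set_borel_measurable_S3[OF smooth_continuous_S3[OF f]] by simp
  have cont: "continuous_on (cball 0 1) (\<lambda>a. surf (\<lambda>x. sphere_moebius a x $ k * f x))" for k
  proof (unfold continuous_on_sequentially, intro allI ballI impI)
    fix A and a :: "real^4" assume a: "a \<in> cball 0 1" and A: "(\<forall>n. A n \<in> cball 0 1) \<and> A \<longlonglongrightarrow> a"
    have na: "norm a \<le> 1" using a by (simp add: mem_cball_0)
    have nA: "norm (A n) \<le> 1" for n using A by (simp add: mem_cball_0)
    have meas: "(\<lambda>x. indicator S3 x *\<^sub>R (sphere_moebius b x $ k * f x)) \<in> borel_measurable sphere_measure" for b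
    proof -
      have "(\<lambda>x. sphere_moebius b x $ k * (indicator S3 x * f x)) \<in> borel_measurable borel"
        unfolding sphere_moebius_def[abs_def] vector_minus_component vector_scaleR_component by measurable
      then show ?thesis unfolding measurable_cong_sets[OF sets_sphere_measure refl] by (simp add: mult_ac)
    qed
    have "(\<lambda>n. surf (\<lambda>x. sphere_moebius (A n) x $ k * f x)) \<longlonglongrightarrow> surf (\<lambda>x. sphere_moebius a x $ k * f x)"
      unfolding surf_def set_lebesgue_integral_def
    proof (rule integral_dominated_convergence[where w = "\<lambda>_. M"])
      interpret finite_measure sphere_measure by (rule finite_measure_sphere_measure)
      show "integrable sphere_measure (\<lambda>_. M)" by simp
      show "AE x in sphere_measure. norm (indicator S3 x *\<^sub>R (sphere_moebius (A n) x $ k * f x)) \<le> M" for n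
      proof (rule AE_I2)
        fix x
        have "\<bar>sphere_moebius (A n) x $ k * f x\<bar> \<le> 1 * M" if x: "x \<in> S3"
          unfolding abs_mult
          using component_le_norm_cart[of "sphere_moebius (A n) x" k] norm_sphere_moebius[OF nA x] M(2)[OF S3_imp_B4[OF x]]
          by (intro mult_mono) auto
        then show "norm (indicator S3 x *\<^sub>R (sphere_moebius (A n) x $ k * f x)) \<le> M"
          using M(1) by (auto simp: indicator_def)
      qed
      show "AE x in sphere_measure. (\<lambda>n. indicator S3 x *\<^sub>R (sphere_moebius (A n) x $ k * f x))
          \<longlonglongrightarrow> indicator S3 x *\<^sub>R (sphere_moebius a x $ k * f x)"
        using AE_sphere_measure_neq[OF na]
      proof eventually_elim
        case (elim x)
        show ?case
        proof (cases "x \<in> S3")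
          case True
          then have "norm (x - a) \<noteq> 0" using elim by auto
          moreover have "A \<longlonglongrightarrow> a" using A by simp
          ultimately have "(\<lambda>n. sphere_moebius (A n) x) \<longlonglongrightarrow> sphere_moebius a x"
            unfolding sphere_moebius_def by (intro tendsto_intros) auto
          then show ?thesis by (intro tendsto_intros)
        qed simp
      qed
    qed (rule meas)+
    then show "((\<lambda>a. surf (\<lambda>x. sphere_moebius a x $ k * f x)) \<circ> A) \<longlonglongrightarrow> surf (\<lambda>x. sphere_moebius a x $ k * f x)"
      by (simp add: comp_def)
  qed
  have contB: "continuous_on (cball 0 1) B"
    unfolding B_def[abs_def] by (intro continuous_on_vec_lambda cont)
  have bd: "B a = - surf f *\<^sub>R a" if "norm a = 1" for a
  proof -
    have "sphere_moebius a x = - a" for x using that by (simp add: sphere_moebius_def dot_square_norm)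
    then have "B a $ k = surf (\<lambda>x. - a $ k * f x)" for k by (simp add: B_def)
    then show ?thesis unfolding surf_cmult by (simp add: vec_eq_iff)
  qed
  \<comment> \<open>otherwise normalising -B retracts the ball onto the sphere\<close>
  have "\<exists>a\<in>cball 0 1. B a = 0"
  proof (rule ccontr)
    assume "\<not> ?thesis"
    then have nz: "\<And>a. a \<in> cball 0 1 \<Longrightarrow> B a \<noteq> 0" by blast
    define r where "r a = - ((1 / norm (B a)) *\<^sub>R B a)" for a
    have "retraction (cball 0 1) (sphere 0 1) r"
      unfolding retraction_def
    proof (intro conjI ballI)
      show "continuous_on (cball 0 1) r"
        unfolding r_def[abs_def] using nz by (intro continuous_intros contB) auto
      show "r \<in> cball 0 1 \<rightarrow> sphere 0 1" using nz by (auto simp: r_def)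
      show "r a = a" if "a \<in> sphere 0 1" for a
        using that pos by (simp add: r_def bd)
    qed (auto simp: mem_cball_0)
    then have "sphere 0 1 retract_of (cball (0::real^4) 1)" unfolding retract_of_def by blast
    then show False using no_retraction_cball[of 1 "0::real^4"] by simp
  qed
  then obtain a where a: "norm a \<le> 1" "B a = 0" by (auto simp: mem_cball_0)
  have "norm a \<noteq> 1"
  proof
    assume "norm a = 1"
    then have "surf f *\<^sub>R a = 0" "a \<noteq> 0" using bd[of a] a by auto
    then show False using pos by simp
  qed
  with a have a1: "norm a < 1" by simp
  have "surf (\<lambda>x. moebius a x $ k * f x) = 0" for k
  proof -
    have "surf (\<lambda>x. moebius a x $ k * f x) = B a $ k"
      unfolding B_def by (auto intro!: surf_cong simp: moebius_eq_sphere_moebius[OF a1])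
    then show ?thesis by (simp add: a)
  qed
  with a1 show ?thesis by (rule that)
qed


section \<open>Rigidity\<close>

lemma vol_zero_imp_zero:
  assumes f: "f \<in> smooth_B4" and nn: "\<And>x. x \<in> B4 \<Longrightarrow> f x \<ge> 0" and v: "vol f \<le> 0" and x: "x \<in> B4"
  shows "f x = 0"
proof (rule has_integral_0_closure_imp_0[where S = "ball 0 1" and f = f and x = x])
  show "continuous_on (closure (ball 0 1)) f" using smooth_continuous_on[OF f] by simp
  have "vol f = 0" by (rule order_antisym[OF v vol_nonneg[OF nn]])
  moreover have "f integrable_on B4" "vol f = integral B4 f"
    using set_borel_integral_eq_integral[OF set_integrable_B4[OF smooth_continuous_on[OF f]]]
    by (simp_all add: vol_def)
  ultimately show "(f has_integral 0) (closure (ball 0 1))"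
    by (simp add: has_integral_iff)
  show "x \<in> closure (ball 0 1)" using x by simp
  show "f y \<ge> 0" if "y \<in> ball 0 1" for y using that by (intro nn) (simp add: mem_cball_0)
  show "emeasure lborel (closure (ball (0::real^4) 1)) = emeasure lborel (ball (0::real^4) 1)"
    by (simp add: emeasure_cball emeasure_ball)
  show "0 < emeasure lborel (ball (0::real^4) 1)"
    using emeasure_ball[of 1 "0::real^4"] unit_ball_vol_pos[of 4] by simp
  show "emeasure lborel (ball (0::real^4) 1) < \<infinity>" by (rule emeasure_lborel_ball_finite)
qed simp

section \<open>Pull-backs of the flat metric\<close>

lemma pd_mfac:
  assumes a: "norm a < 1" and x: "x \<in> B4"
  shows "pd i (mfac a) x = - (pd i (mden a) x / mden a x)"
proof -
  have r: "1 - a \<bullet> a > 0" using inner_self_less_1[OF a] by simp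
  have "pd i (mfac a) x = pd i (\<lambda>x. ln (1 - a \<bullet> a) - ln (mden a x)) x"
    using x
  proof (rule pd_cong)
    fix y assume "y \<in> B4"
    from mden_pos[OF a this] r show "mfac a y = ln (1 - a \<bullet> a) - ln (mden a y)"
      by (simp add: mfac_def ln_div)
  qed
  also have "\<dots> = - pd i (\<lambda>x. ln (mden a x)) x"
    using x mden_pos[OF a] by (simp add: smooth_pd_add smooth_ln smooth_mden)
  also have "pd i (\<lambda>x. ln (mden a x)) x = pd i (mden a) x / mden a x"
    using x mden_pos[OF a x] by (intro smooth_pd_ln smooth_mden)
  finally show ?thesis .
qed

text \<open>\<open>mden a\<close> is a quadratic polynomial whose squared gradient is
  \<open>4 * (a \<bullet> a)\<close> times itself.\<close>

lemma gdot_mfac: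
  assumes a: "norm a < 1" and x: "x \<in> B4"
  shows "gdot (mfac a) (mfac a) x = 4 * (a \<bullet> a) / mden a x"
proof -
  have D: "mden a x \<noteq> 0" using mden_pos[OF a x] by simp
  define \<alpha> where "\<alpha> = a \<bullet> a"
  have S: "(\<Sum>i\<in>UNIV. pd i (mden a) x * pd i (mden a) x) = 4 * \<alpha> * mden a x"
  proof -
    have "pd i (mden a) x * pd i (mden a) x =
      4 * \<alpha> * \<alpha> * (x $ i * x $ i) - 8 * \<alpha> * (a $ i * x $ i) + 4 * (a $ i * a $ i)" for i
      unfolding pd_mden[OF x] \<alpha>_def[symmetric] by (simp add: algebra_simps)
    then have "(\<Sum>i\<in>UNIV. pd i (mden a) x * pd i (mden a) x) =
      4 * \<alpha> * \<alpha> * (x \<bullet> x) - 8 * \<alpha> * (a \<bullet> x) + 4 * \<alpha>"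
      by (simp only: sum.distrib sum_subtractf sum_distrib_left[symmetric] inner_vec_def inner_real_def \<alpha>_def)
    then show ?thesis
      unfolding mden_def \<alpha>_def[symmetric] by (simp add: algebra_simps)
  qed
  have "gdot (mfac a) (mfac a) x = (\<Sum>i\<in>UNIV. pd i (mden a) x * pd i (mden a) x) / (mden a x * mden a x)"
    unfolding gdot_def pd_mfac[OF a x] sum_divide_distrib by simp
  then show ?thesis unfolding S using D by (simp add: \<alpha>_def)
qed

text \<open>Equivalently, the Schouten tensor of the metric with conformal factor mfac vanishes.\<close>

lemma hessian_mfac:
  assumes a: "norm a < 1" and x: "x \<in> B4"
  shows "pd i (pd j (mfac a)) x = pd i (mfac a) x * pd j (mfac a) x
    - kron i j * gdot (mfac a) (mfac a) x / 2"
proof -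
  have D: "mden a y \<noteq> 0" if "y \<in> B4" for y using mden_pos[OF a that] by simp
  have iD: "(\<lambda>x. inverse (mden a x)) \<in> smooth_B4" using D by (intro smooth_inverse smooth_mden)
  have "pd i (pd j (mden a)) x = pd i (\<lambda>x. 2 * ((a \<bullet> a) * x $ j - a $ j)) x"
    using x by (intro pd_cong pd_mden)
  also have "\<dots> = 2 * (a \<bullet> a) * kron i j"
    using x by (simp add: smooth_pd_add smooth_mult smooth_diff pd_nth)
  finally have dd: "pd i (pd j (mden a)) x = 2 * (a \<bullet> a) * kron i j" .
  have "pd i (pd j (mfac a)) x = pd i (\<lambda>x. - (pd j (mden a) x * inverse (mden a x))) x"
    using x pd_mfac[OF a] by (intro pd_cong) (auto simp: divide_inverse)
  also have "\<dots> = - (pd i (pd j (mden a)) x * inverse (mden a x)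
      + pd j (mden a) x * (- pd i (mden a) x / (mden a x)\<^sup>2))"
    using x iD smooth_mden D
    by (simp add: smooth_pd_uminus smooth_mult smooth_pd smooth_pd_add smooth_pd_inverse)
  also have "\<dots> = pd i (mfac a) x * pd j (mfac a) x - kron i j * gdot (mfac a) (mfac a) x / 2"
    unfolding dd gdot_mfac[OF a x] pd_mfac[OF a x]
    using D[OF x] by (simp add: field_simps power2_eq_square)
  finally show ?thesis .
qed

text \<open>Trace of the Hessian identity, with 1 - 4/2 = -1. It expresses that the metric is
  scalar-flat.\<close>

lemma lap_mfac:
  assumes a: "norm a < 1" and x: "x \<in> B4"
  shows "lap (mfac a) x = - gdot (mfac a) (mfac a) x"
  unfolding lap_def hessian_mfac[OF a x] sum_subtractf by (simp add: gdot_def)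

text \<open>This is the statement that the pulled-back metric has boundary mean curvature 1, in view
  of the formula \<open>exp (- u x) * (1 + rad u x)\<close> for the mean curvature.\<close>

lemma rad_mfac:
  assumes a: "norm a < 1" and xS: "x \<in> S3"
  shows "1 + rad (mfac a) x = exp (mfac a x)"
proof -
  have x: "x \<in> B4" using S3_imp_B4[OF xS] .
  have xx: "x \<bullet> x = 1" using xS by (simp add: norm_eq_1[symmetric])
  have D: "mden a x \<noteq> 0" using mden_pos[OF a x] by simp
  have "rad (mfac a) x = - (\<Sum>i\<in>UNIV. x $ i * pd i (mden a) x) / mden a x"
    unfolding rad_def pd_mfac[OF a x] by (simp add: sum_negf sum_divide_distrib)
  also have "(\<Sum>i\<in>UNIV. x $ i * pd i (mden a) x) = 2 * (a \<bullet> a) * (x \<bullet> x) - 2 * (a \<bullet> x)"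
  proof -
    define \<alpha> where "\<alpha> = a \<bullet> a"
    have "x $ i * pd i (mden a) x = 2 * \<alpha> * (x $ i * x $ i) - 2 * (a $ i * x $ i)" for i
      unfolding pd_mden[OF x] \<alpha>_def[symmetric] by (simp add: algebra_simps)
    then show ?thesis
      by (simp only: sum_subtractf sum_distrib_left[symmetric] inner_vec_def[of x x] inner_vec_def[of a x]
          inner_real_def \<alpha>_def)
  qed
  finally have "1 + rad (mfac a) x = (mden a x - (2 * (a \<bullet> a) - 2 * (a \<bullet> x))) / mden a x"
    using D by (simp add: xx diff_divide_distrib)
  also have "mden a x - (2 * (a \<bullet> a) - 2 * (a \<bullet> x)) = 1 - a \<bullet> a"
    by (simp add: mden_def xx)
  finally show ?thesis unfolding exp_mfac[OF a x] .
qed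

text \<open>Since the pulled-back flat metric has vanishing Schouten tensor, the weak form tested against
  the constant 1 computes the boundary volume.\<close>

lemma surf_exp_mfac:
  assumes a: "norm a < 1"
  shows "surf (\<lambda>x. exp (3 * mfac a x)) = omega3"
proof -
  let ?w = "mfac a"
  have w: "?w \<in> smooth_B4" by (rule smooth_mfac[OF a])
  have one: "(\<lambda>_. 1) \<in> smooth_B4" by simp
  have 1: "int_density ?w x = 0" if x: "x \<in> B4" for x
  proof -
    define G where "G = gdot ?w ?w x"
    have k: "(\<Sum>i\<in>UNIV. \<Sum>j\<in>UNIV. kron i j * f i j) = (\<Sum>i\<in>UNIV. f i i)" for f
      by (simp only: sum_kron)
    have gg: "(\<Sum>i\<in>UNIV. \<Sum>j\<in>UNIV. (pd i ?w x * pd i ?w x) * (pd j ?w x * pd j ?w x)) = G\<^sup>2"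
      by (simp add: G_def gdot_def sum_product power2_eq_square)
    have g1: "(\<Sum>i\<in>UNIV. G * (pd i ?w x * pd i ?w x)) = G\<^sup>2"
      unfolding sum_distrib_left[symmetric] power2_eq_square by (simp add: G_def gdot_def)
    have h1: "(pd i (pd j ?w) x)\<^sup>2 = (pd i ?w x * pd i ?w x) * (pd j ?w x * pd j ?w x)
      - kron i j * (G * (pd i ?w x * pd j ?w x)) + kron i j * (G\<^sup>2 / 4)" for i j
      unfolding hessian_mfac[OF a x] G_def[symmetric] by (simp add: power2_eq_square algebra_simps)
    have h2: "pd i (pd j ?w) x * pd i ?w x * pd j ?w x = (pd i ?w x * pd i ?w x) * (pd j ?w x * pd j ?w x)
      - kron i j * (G * (pd i ?w x * pd j ?w x) / 2)" for i j
      unfolding hessian_mfac[OF a x] G_def[symmetric] by (simp add: algebra_simps)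
    have H: "hess ?w ?w ?w x = G\<^sup>2 / 2"
      unfolding hess_def h2 sum_subtractf k gg sum_divide_distrib[symmetric] g1 by simp
    have S: "(\<Sum>i\<in>UNIV. \<Sum>j\<in>UNIV. (pd i (pd j ?w) x)\<^sup>2) = G\<^sup>2"
      unfolding h1 sum.distrib sum_subtractf k gg g1 by simp
    show ?thesis unfolding int_density_def H S lap_mfac[OF a x] G_def[symmetric]
      by (simp add: power2_eq_square)
  qed
  have 2: "bd_density ?w x = exp (3 * ?w x)" if xS: "x \<in> S3" for x
  proof -
    have x: "x \<in> B4" using S3_imp_B4[OF xS] .
    define r where "r = rad ?w x"
    define G where "G = gdot ?w ?w x"
    have "x $ i * x $ j * pd i (pd j ?w) x = (x $ i * pd i ?w x) * (x $ j * pd j ?w x)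
      - kron i j * (x $ i * x $ j * (G / 2))" for i j
      unfolding hessian_mfac[OF a x] G_def[symmetric] by (simp add: algebra_simps)
    then have R: "rad2 ?w x = r * r - G / 2"
      unfolding rad2_def
      by (simp only: sum_subtractf sum_kron sum_distrib_right[symmetric] sum_distrib_left[symmetric] S3_sum_squares[OF xS])
        (simp add: r_def rad_def)
    \<comment> \<open>With vanishing Schouten tensor the boundary curvature is the cube of the mean
      curvature.\<close>
    have "bd_density ?w x = (1 + r) ^ 3"
      unfolding bd_density_def lapS_def tdot_def lap_mfac[OF a x] R r_def[symmetric] G_def[symmetric]
      by (simp add: field_simps power2_eq_square power3_eq_cube)
    then show ?thesis
      unfolding r_def rad_mfac[OF a xS] by (simp add: exp_of_nat_mult[symmetric])
  qed
  have z: "gdot ?w (\<lambda>_. 1) x = 0" "hess ?w ?w (\<lambda>_. 1) x = 0" "tdot ?w (\<lambda>_. 1) x = 0" if "x \<in> B4" for x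
    using that by (simp_all add: gdot_def hess_def tdot_def rad_def)
  have "vol (\<lambda>x. 1 * int_density ?w x) = vol (\<lambda>_. 0)" using 1 by (intro vol_cong) simp
  moreover have "surf (\<lambda>x. 1 * bd_density ?w x) = surf (\<lambda>x. exp (3 * ?w x))" using 2 by (intro surf_cong) simp
  moreover have "surf (\<lambda>x. (1 + rad ?w x / 2) * tdot ?w (\<lambda>_. 1) x) = surf (\<lambda>_. 0)"
    by (intro surf_cong) (simp add: z S3_imp_B4 del: mem_sphere_0 mem_sphere)
  moreover have "vol (\<lambda>x. lap ?w x * gdot ?w (\<lambda>_. 1) x - hess ?w ?w (\<lambda>_. 1) x + gdot ?w ?w x * gdot ?w (\<lambda>_. 1) x)
    = vol (\<lambda>_. 0)" by (intro vol_cong) (simp add: z)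
  ultimately show ?thesis
    using weak_form[OF w one] surf_const[of 0] surf_const[of 1] by (simp add: vol_def)
qed

text \<open>In dimension four, the divergence of \<open>exp (2 * w)\<close> times the gradient of u
  is the Laplacian of the metric with conformal factor \<open>exp (2 * w)\<close>, multiplied by its
  volume density.\<close>

lemma divergence_weighted:
  assumes w: "w \<in> smooth_B4" and u: "u \<in> smooth_B4"
  shows "vol (\<lambda>x. exp (2 * w x) * (lap u x + 2 * gdot w u x)) = surf (\<lambda>x. exp (2 * w x) * rad u x)"
proof -
  have e: "(\<lambda>x. exp (2 * w x)) \<in> smooth_B4" by (intro smooth_exp smooth_intros w)
  have "vol (\<lambda>x. exp (2 * w x) * (lap u x + 2 * gdot w u x)) = vol (\<lambda>x. \<Sum>i\<in>UNIV. pd i (\<lambda>x. exp (2 * w x) * pd i u x) x)"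
  proof (rule vol_cong)
    fix x assume x: "x \<in> B4"
    have "pd i (\<lambda>x. exp (2 * w x) * pd i u x) x = exp (2 * w x) * (2 * (pd i w x * pd i u x)) + exp (2 * w x) * pd i (pd i u) x" for i
      using x u w e by (simp add: smooth_pd_add smooth_pd smooth_pd_exp smooth_mult)
    then show "exp (2 * w x) * (lap u x + 2 * gdot w u x) = (\<Sum>i\<in>UNIV. pd i (\<lambda>x. exp (2 * w x) * pd i u x) x)"
      by (simp only: sum.distrib sum_distrib_left[symmetric] lap_def gdot_def distrib_left add.commute)
  qed
  also have "\<dots> = surf (\<lambda>x. \<Sum>i\<in>UNIV. x $ i * (exp (2 * w x) * pd i u x))"
    using u e by (intro divergence_theorem_field smooth_intros)
  finally show ?thesis by (simp add: rad_def sum_distrib_left mult_ac)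
qed

text \<open>Summed over k, the products of first derivatives of the components form
  \<open>exp (2 * mfac a x)\<close> times the identity, so contraction with them is a trace. Every
  coefficient comes out as 3: the tangential trace is 4 - 1, the Laplacian term loses the trace of
  the Hessian and gives 4 - 1, and the quartic part gives 1 + 4/2.\<close>

lemma sum_second_variation_moebius:
  assumes a: "norm a < 1" and u: "u \<in> smooth_B4"
  shows "(\<Sum>k\<in>UNIV. second_variation u (\<lambda>x. moebius a x $ k)) =
    3 * (surf (\<lambda>x. exp (2 * mfac a x) * (1 + rad u x)) - vol (\<lambda>x. exp (2 * mfac a x) * (lap u x + gdot u u x)))"
proof -
  let ?v = "\<lambda>k x. moebius a x $ k" and ?e = "\<lambda>x. exp (2 * mfac a x)"
  have v: "?v k \<in> smooth_B4" for k by (rule smooth_moebius[OF a])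
  have e: "?e \<in> smooth_B4" by (intro smooth_exp smooth_intros smooth_mfac[OF a])
  have contract: "(\<Sum>k\<in>UNIV. \<Sum>i\<in>UNIV. \<Sum>j\<in>UNIV. T i j * pd i (?v k) x * pd j (?v k) x) = (\<Sum>i\<in>UNIV. T i i) * ?e x"
    if x: "x \<in> B4" for x T
  proof -
    have "(\<Sum>k\<in>UNIV. \<Sum>i\<in>UNIV. \<Sum>j\<in>UNIV. T i j * pd i (?v k) x * pd j (?v k) x)
      = (\<Sum>i\<in>UNIV. \<Sum>k\<in>UNIV. \<Sum>j\<in>UNIV. T i j * pd i (?v k) x * pd j (?v k) x)"
      by (rule sum.swap)
    also have "\<dots> = (\<Sum>i\<in>UNIV. \<Sum>j\<in>UNIV. \<Sum>k\<in>UNIV. T i j * pd i (?v k) x * pd j (?v k) x)"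
      by (intro sum.cong refl sum.swap)
    also have "\<dots> = (\<Sum>i\<in>UNIV. \<Sum>j\<in>UNIV. kron i j * (T i j * ?e x))"
      using moebius_conformal[OF a x]
      by (simp only: mult.assoc sum_distrib_left[symmetric]) (simp only: mult_ac)
    finally show ?thesis by (simp only: sum_kron sum_distrib_right)
  qed
  have G: "(\<Sum>k\<in>UNIV. gdot (?v k) (?v k) x) = 4 * ?e x" if x: "x \<in> B4" for x
  proof -
    have "(\<Sum>j\<in>UNIV. kron i j * pd i (?v k) x * pd j (?v k) x) = pd i (?v k) x * pd i (?v k) x" for i k
      using sum_kron[of i "\<lambda>j. pd i (?v k) x * pd j (?v k) x"] by (simp only: mult.assoc)
    then have "(\<Sum>k\<in>UNIV. gdot (?v k) (?v k) x) = (\<Sum>k\<in>UNIV. \<Sum>i\<in>UNIV. \<Sum>j\<in>UNIV. kron i j * pd i (?v k) x * pd j (?v k) x)"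
      by (simp only: gdot_def)
    also have "\<dots> = 4 * ?e x" unfolding contract[OF x] by simp
    finally show ?thesis .
  qed
  have prod: "(\<Sum>k\<in>UNIV. (\<Sum>i\<in>UNIV. b i * pd i (?v k) x) * (\<Sum>j\<in>UNIV. b j * pd j (?v k) x)) = (\<Sum>i\<in>UNIV. b i * b i) * ?e x"
    if x: "x \<in> B4" for x b
  proof -
    have "(\<Sum>k\<in>UNIV. (\<Sum>i\<in>UNIV. b i * pd i (?v k) x) * (\<Sum>j\<in>UNIV. b j * pd j (?v k) x))
      = (\<Sum>k\<in>UNIV. \<Sum>i\<in>UNIV. \<Sum>j\<in>UNIV. (b i * b j) * pd i (?v k) x * pd j (?v k) x)"
      unfolding sum_product by (intro sum.cong refl) (simp only: mult_ac)
    then show ?thesis unfolding contract[OF x] .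
  qed
  have R: "(\<Sum>k\<in>UNIV. tdot (?v k) (?v k) x) = 3 * ?e x" if xS: "x \<in> S3" for x
  proof -
    have x: "x \<in> B4" using S3_imp_B4[OF xS] .
    show ?thesis
      unfolding tdot_def sum_subtractf G[OF x] rad_def prod[OF x] S3_sum_squares[OF xS] by simp
  qed
  have U: "(\<Sum>k\<in>UNIV. (gdot u (?v k) x)\<^sup>2) = gdot u u x * ?e x" if x: "x \<in> B4" for x
    unfolding gdot_def power2_eq_square prod[OF x] ..
  have H: "(\<Sum>k\<in>UNIV. hess u (?v k) (?v k) x) = lap u x * ?e x" if x: "x \<in> B4" for x
    unfolding hess_def contract[OF x] lap_def ..
  have 1: "(\<Sum>k\<in>UNIV. surf (tdot (?v k) (?v k))) = surf (\<lambda>x. 3 * ?e x)"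
  proof -
    have "(\<Sum>k\<in>UNIV. surf (tdot (?v k) (?v k))) = surf (\<lambda>x. \<Sum>k\<in>UNIV. tdot (?v k) (?v k) x)"
      by (intro surf_sum[symmetric] smooth_continuous_S3 smooth_tdot v)
    also have "\<dots> = surf (\<lambda>x. 3 * ?e x)" by (intro surf_cong R)
    finally show ?thesis .
  qed
  have 2: "(\<Sum>k\<in>UNIV. surf (\<lambda>x. rad u x * tdot (?v k) (?v k) x)) = surf (\<lambda>x. 3 * (?e x * rad u x))"
  proof -
    have "(\<Sum>k\<in>UNIV. surf (\<lambda>x. rad u x * tdot (?v k) (?v k) x)) = surf (\<lambda>x. \<Sum>k\<in>UNIV. rad u x * tdot (?v k) (?v k) x)"
      by (intro surf_sum[symmetric] smooth_continuous_S3 smooth_intros u v)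
    also have "\<dots> = surf (\<lambda>x. 3 * (?e x * rad u x))"
      by (intro surf_cong) (simp only: sum_distrib_left[symmetric] R, simp)
    finally show ?thesis .
  qed
  have 3: "(\<Sum>k\<in>UNIV. vol (\<lambda>x. lap u x * gdot (?v k) (?v k) x - hess u (?v k) (?v k) x)) = vol (\<lambda>x. 3 * (?e x * lap u x))"
  proof -
    have "(\<Sum>k\<in>UNIV. vol (\<lambda>x. lap u x * gdot (?v k) (?v k) x - hess u (?v k) (?v k) x))
      = vol (\<lambda>x. \<Sum>k\<in>UNIV. lap u x * gdot (?v k) (?v k) x - hess u (?v k) (?v k) x)"
      by (intro vol_sum[symmetric] smooth_intros u v)
    also have "\<dots> = vol (\<lambda>x. 3 * (?e x * lap u x))"
      by (intro vol_cong) (simp only: sum_subtractf sum_distrib_left[symmetric] G H, simp)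
    finally show ?thesis .
  qed
  have 4: "(\<Sum>k\<in>UNIV. vol (\<lambda>x. (gdot u (?v k) x)\<^sup>2 + gdot u u x * gdot (?v k) (?v k) x / 2)) = vol (\<lambda>x. 3 * (?e x * gdot u u x))"
  proof -
    have "(\<Sum>k\<in>UNIV. vol (\<lambda>x. (gdot u (?v k) x)\<^sup>2 + gdot u u x * gdot (?v k) (?v k) x / 2))
      = vol (\<lambda>x. \<Sum>k\<in>UNIV. (gdot u (?v k) x)\<^sup>2 + gdot u u x * gdot (?v k) (?v k) x / 2)"
      unfolding divide_inverse
      by (intro vol_sum[symmetric] smooth_intros smooth_power u v)
    also have "\<dots> = vol (\<lambda>x. 3 * (?e x * gdot u u x))"
      by (intro vol_cong)
        (simp only: sum.distrib sum_divide_distrib[symmetric] sum_distrib_left[symmetric] G U, simp)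
    finally show ?thesis .
  qed
  have "surf (\<lambda>x. ?e x * (1 + rad u x)) = surf ?e + surf (\<lambda>x. ?e x * rad u x)"
    unfolding distrib_left mult_1_right by (intro surf_add_smooth smooth_intros u e)
  moreover have "vol (\<lambda>x. ?e x * (lap u x + gdot u u x)) = vol (\<lambda>x. ?e x * lap u x) + vol (\<lambda>x. ?e x * gdot u u x)"
    unfolding distrib_left by (intro vol_add smooth_intros u e)
  ultimately show ?thesis
    unfolding second_variation_def cubic_form_def sum.distrib sum_subtractf 1 2 3 4 surf_cmult vol_cmult
    by (simp add: algebra_simps)
qed

text \<open>The left-hand side of the summed inequality is exactly \<open>3 * omega3\<close>, the
  components of the map having square sum 1 on the sphere. By parts, the right-hand side is
  \<open>3 * omega3\<close> minus 3 times the weighted Dirichlet integral of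
  \<open>u - mfac a\<close>, which therefore vanishes.\<close>

lemma local_minimizer_eq_mfac:
  assumes u: "u \<in> smooth_B4" and min: "local_minimizer_F2 u"
    and bv: "surf (\<lambda>x. exp (3 * u x)) = omega3"
  obtains a where "norm a < 1" "\<And>x. x \<in> B4 \<Longrightarrow> u x = mfac a x"
proof -
  have e3: "(\<lambda>x. exp (3 * u x)) \<in> smooth_B4" by (intro smooth_exp smooth_intros u)
  obtain a where a: "norm a < 1" and bal: "\<And>k. surf (\<lambda>x. moebius a x $ k * exp (3 * u x)) = 0"
    by (rule balancing[OF e3]) (use bv omega3_pos in auto)
  let ?v = "\<lambda>k x. moebius a x $ k" and ?e = "\<lambda>x. exp (2 * mfac a x)" and ?w = "mfac a"
  have v: "?v k \<in> smooth_B4" for k by (rule smooth_moebius[OF a])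
  have w: "?w \<in> smooth_B4" by (rule smooth_mfac[OF a])
  have e: "?e \<in> smooth_B4" by (intro smooth_exp smooth_intros w)
  have "3 * omega3 = (\<Sum>k\<in>UNIV. 3 * surf (\<lambda>x. (?v k x)\<^sup>2 * exp (3 * u x)))"
  proof -
    have "(\<Sum>k\<in>UNIV. surf (\<lambda>x. (?v k x)\<^sup>2 * exp (3 * u x))) = surf (\<lambda>x. \<Sum>k\<in>UNIV. (?v k x)\<^sup>2 * exp (3 * u x))"
      by (intro surf_sum[symmetric] smooth_continuous_S3 smooth_mult smooth_power v e3)
    also have "\<dots> = surf (\<lambda>x. exp (3 * u x))"
    proof (rule surf_cong)
      fix x assume "x \<in> S3"
      from S3_sum_squares[OF moebius_in_S3[OF a this]]
      show "(\<Sum>k\<in>UNIV. (?v k x)\<^sup>2 * exp (3 * u x)) = exp (3 * u x)"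
        by (simp add: sum_distrib_right[symmetric] power2_eq_square)
    qed
    finally show ?thesis by (simp add: bv sum_distrib_left[symmetric])
  qed
  also have "\<dots> \<le> (\<Sum>k\<in>UNIV. second_variation u (?v k))"
    by (intro sum_mono second_variation_ge u min bv v bal)
  finally have main: "omega3 \<le> surf (\<lambda>x. ?e x * (1 + rad u x)) - vol (\<lambda>x. ?e x * (lap u x + gdot u u x))"
    unfolding sum_second_variation_moebius[OF a u] by simp
  have Vu: "vol (\<lambda>x. ?e x * lap u x) + 2 * vol (\<lambda>x. ?e x * gdot ?w u x) = surf (\<lambda>x. ?e x * rad u x)"
  proof -
    have "vol (\<lambda>x. ?e x * lap u x) + 2 * vol (\<lambda>x. ?e x * gdot ?w u x)
      = vol (\<lambda>x. ?e x * lap u x + 2 * (?e x * gdot ?w u x))"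
      unfolding vol_cmult[symmetric]
      by (intro vol_add[symmetric] smooth_intros u w e)
    then show ?thesis using divergence_weighted[OF w u] by (simp add: algebra_simps)
  qed
  \<comment> \<open>For \<open>mfac a\<close> the weighted divergence is its own energy density, by
    scalar-flatness; boundary mean curvature 1 and the boundary volume evaluate the flux.\<close>
  have Vw: "vol (\<lambda>x. ?e x * gdot ?w ?w x) = omega3 - surf ?e"
  proof -
    have "vol (\<lambda>x. ?e x * gdot ?w ?w x) = vol (\<lambda>x. ?e x * (lap ?w x + 2 * gdot ?w ?w x))"
      by (intro vol_cong) (simp add: lap_mfac[OF a])
    also have "\<dots> = surf (\<lambda>x. ?e x * rad ?w x)" by (rule divergence_weighted[OF w w])
    also have "\<dots> = surf (\<lambda>x. exp (3 * ?w x) - ?e x)"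
    proof (rule surf_cong)
      fix x assume "x \<in> S3"
      from rad_mfac[OF a this] have "rad ?w x = exp (?w x) - 1" by simp
      then show "?e x * rad ?w x = exp (3 * ?w x) - ?e x"
        by (simp add: right_diff_distrib exp_add[symmetric])
    qed
    also have "\<dots> = surf (\<lambda>x. exp (3 * ?w x)) - surf ?e"
      by (intro surf_add_smooth smooth_exp smooth_intros w)
    finally show ?thesis by (simp add: surf_exp_mfac[OF a])
  qed
  define d where "d x = u x + (- 1) * ?w x" for x
  have d: "d \<in> smooth_B4" unfolding d_def[abs_def] by (intro smooth_intros u w)
  have "surf (\<lambda>x. ?e x * (1 + rad u x)) = surf ?e + surf (\<lambda>x. ?e x * rad u x)"
    unfolding distrib_left mult_1_right by (intro surf_add_smooth smooth_intros u e)
  moreover have "vol (\<lambda>x. ?e x * (lap u x + gdot u u x)) = vol (\<lambda>x. ?e x * lap u x) + vol (\<lambda>x. ?e x * gdot u u x)"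
    unfolding distrib_left by (intro vol_add smooth_intros u e)
  moreover have "vol (\<lambda>x. ?e x * gdot d d x) = vol (\<lambda>x. ?e x * gdot u u x) - 2 * vol (\<lambda>x. ?e x * gdot ?w u x)
    + vol (\<lambda>x. ?e x * gdot ?w ?w x)"
  proof -
    have "vol (\<lambda>x. ?e x * gdot d d x) = vol (\<lambda>x. (?e x * gdot u u x - 2 * (?e x * gdot ?w u x)) + ?e x * gdot ?w ?w x)"
    proof (rule vol_cong)
      fix x assume x: "x \<in> B4"
      have "gdot u ?w x = gdot ?w u x" by (simp add: gdot_def mult.commute)
      then show "?e x * gdot d d x = (?e x * gdot u u x - 2 * (?e x * gdot ?w u x)) + ?e x * gdot ?w ?w x"
        unfolding d_def[abs_def] differential_linear(3,4)[OF u w x] by (simp add: algebra_simps)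
    qed
    also have "\<dots> = vol (\<lambda>x. ?e x * gdot u u x - 2 * (?e x * gdot ?w u x)) + vol (\<lambda>x. ?e x * gdot ?w ?w x)"
      by (intro vol_add smooth_intros u w e)
    also have "vol (\<lambda>x. ?e x * gdot u u x - 2 * (?e x * gdot ?w u x)) = vol (\<lambda>x. ?e x * gdot u u x) - vol (\<lambda>x. 2 * (?e x * gdot ?w u x))"
      by (intro vol_add smooth_intros u w e)
    finally show ?thesis unfolding vol_cmult .
  qed
  ultimately have le: "vol (\<lambda>x. ?e x * gdot d d x) \<le> 0"
    using main Vu Vw by linarith
  have pd0: "pd i d x = 0" if x: "x \<in> B4" for i x
  proof -
    have "?e x * gdot d d x = 0"
    proof (rule vol_zero_imp_zero[OF _ _ le x])
      show "(\<lambda>x. ?e x * gdot d d x) \<in> smooth_B4" by (intro smooth_intros e d)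
      show "?e x * gdot d d x \<ge> 0" for x
        unfolding gdot_def by (intro mult_nonneg_nonneg[OF exp_ge_zero] sum_nonneg zero_le_square)
    qed
    then have "(\<Sum>i\<in>UNIV. pd i d x * pd i d x) = 0" by (simp add: gdot_def)
    then have "pd i d x * pd i d x = 0"
      using sum_nonneg_eq_0_iff[of UNIV "\<lambda>i. pd i d x * pd i d x"] by simp
    then show ?thesis by simp
  qed
  have "\<exists>c. \<forall>x\<in>B4. d x = c"
  proof (rule has_derivative_zero_constant[OF convex_cball, where f = d])
    show "(d has_derivative (\<lambda>h. 0)) (at x within B4)" if "x \<in> B4" for x
      using has_derivative_pd[OF smooth_differentiable[OF d that] that] that by (simp add: pd0)
  qed
  then obtain c where c: "\<And>x. x \<in> B4 \<Longrightarrow> d x = c" by blast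
  \<comment> \<open>Both potentials satisfy the volume constraint, which fixes the additive
    constant.\<close>
  have "omega3 = surf (\<lambda>x. exp (3 * c) * exp (3 * ?w x))"
    unfolding bv[symmetric]
  proof (rule surf_cong)
    fix x assume "x \<in> S3"
    from c[OF S3_imp_B4[OF this]] have "u x = c + ?w x" by (simp add: d_def)
    then show "exp (3 * u x) = exp (3 * c) * exp (3 * ?w x)" by (simp add: exp_add[symmetric] algebra_simps)
  qed
  then have "omega3 = exp (3 * c) * omega3" unfolding surf_cmult surf_exp_mfac[OF a] .
  then have "c = 0" using omega3_pos by simp
  then have "u x = ?w x" if "x \<in> B4" for x using c[OF that] by (simp add: d_def)
  with a show ?thesis by (rule that)
qed

lemma pullback_moebius:
  assumes a: "norm a < 1" and x: "x \<in> B4" and g: "g (moebius a x) = c *\<^sub>R mat 1"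
  shows "pullback (moebius a) g x = (c * exp (2 * mfac a x)) *\<^sub>R mat 1"
proof -
  let ?J = "jacobian (moebius a) x"
  have "(transpose ?J ** ?J) $ i $ j = kron i j * exp (2 * mfac a x)" for i j
    unfolding matrix_matrix_mult_def transpose_def jacobian_def
    using moebius_conformal[OF a x, of i j] by simp
  then have "transpose ?J ** ?J = exp (2 * mfac a x) *\<^sub>R mat 1"
    by (simp add: vec_eq_iff mat_def)
  then show ?thesis
    unfolding pullback_def g
    by (simp add: scalar_matrix_assoc[symmetric] matrix_scalar_ac)
qed

lemma conformal_diffeo_moebius:
  assumes a: "norm a < 1"
  shows "conformal_diffeo (moebius a)"
proof -
  have a': "norm (- a) < 1" using a by simp
  have "(\<lambda>y. inv_into B4 (moebius a) y $ k) \<in> smooth_B4" for k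
  proof -
    have "(\<lambda>y. inv_into B4 (moebius a) y $ k) \<in> smooth_B4 \<longleftrightarrow> (\<lambda>y. moebius (- a) y $ k) \<in> smooth_B4"
      by (rule smooth_cong) (simp add: moebius_bij(3)[OF a])
    then show ?thesis using smooth_moebius[OF a'] by simp
  qed
  moreover have "pullback (moebius a) flat_metric x = conformal_metric (mfac a) x" if "x \<in> B4" for x
    using pullback_moebius[OF a that, of flat_metric 1] by (simp add: flat_metric_def conformal_metric_def)
  ultimately show ?thesis
    unfolding conformal_diffeo_def smooth_map_B4_def
    by (intro conjI allI bexI[of _ "mfac a"] ballI moebius_bij(1,2)[OF a] smooth_moebius[OF a] smooth_mfac[OF a])
qed

theorem theorem1p4:
  fixes u :: "real^4 \<Rightarrow> real" and g :: metric
  assumes "g = conformal_metric u"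
    and "g \<in> V"
    and "local_minimizer_F2 u"
    and "g \<in> C1"
  shows "\<exists>\<Phi>. conformal_diffeo \<Phi> \<and> (\<forall>x\<in>B4. pullback \<Phi> g x = flat_metric x)"
proof -
  \<comment> \<open>Membership in \<open>V\<close> supplies some smooth potential; the (1,1)
    component of the metric identifies it with u.\<close>
  obtain u' where u': "g = conformal_metric u'" "u' \<in> smooth_B4" "bdry_vol (conformal_metric u') = omega3"
    using assms(2) by (auto simp: V_def)
  have "u' x = u x" for x
  proof -
    have "conformal_metric u x $ 1 $ 1 = conformal_metric u' x $ 1 $ 1" using assms(1) u'(1) by simp
    then show ?thesis by (simp add: conformal_metric_nth)
  qed
  then have "u' = u" by (rule ext)
  then have u: "u \<in> smooth_B4" and bv: "surf (\<lambda>x. exp (3 * u x)) = omega3"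
    using u'(2,3) unfolding bdry_vol_conformal_metric by simp_all
  obtain a where a: "norm a < 1" and ua: "\<And>x. x \<in> B4 \<Longrightarrow> u x = mfac a x"
    by (rule local_minimizer_eq_mfac[OF u assms(3) bv]) blast
  have a': "norm (- a) < 1" using a by simp
  have "pullback (moebius (- a)) g x = flat_metric x" if x: "x \<in> B4" for x
  proof -
    let ?y = "moebius (- a) x"
    have y: "?y \<in> B4" by (rule moebius_in_B4[OF a' x])
    have D: "mden (- a) x > 0" by (rule mden_pos[OF a' x])
    have r: "1 - a \<bullet> a > 0" using inner_self_less_1[OF a] by simp
    \<comment> \<open>The conformal factors of two mutually inverse maps multiply to 1.\<close>
    have "mden a ?y = (1 - a \<bullet> a)\<^sup>2 / mden (- a) x"
      using mden_moebius(1)[of "- a" x] D by simp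
    then have "exp (mfac a ?y) * exp (mfac (- a) x) = 1"
      unfolding exp_mfac[OF a y] exp_mfac[OF a' x] using D r by (simp add: power2_eq_square)
    then have "exp (2 * u ?y) * exp (2 * mfac (- a) x) = 1"
      unfolding ua[OF y] exp_double power_mult_distrib[symmetric] by simp
    moreover have "pullback (moebius (- a)) g x = (exp (2 * u ?y) * exp (2 * mfac (- a) x)) *\<^sub>R mat 1"
      by (rule pullback_moebius[OF a' x]) (simp add: assms(1) conformal_metric_def flat_metric_def)
    ultimately show ?thesis by (simp add: flat_metric_def)
  qed
  then show ?thesis
    by (intro exI[of _ "moebius (- a)"] conjI ballI conformal_diffeo_moebius[OF a'])
qed

end
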